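(* Let $\sum_ih_i^2dx_i^2$ be a $\partial$-invariant flat Egoroff metric with rotation coefficient matrix $\beta$, and let $E(x,\lambda)$ be the frame of $\beta$. Let $\alpha\in\mathbb{R}\setminus\{0\}$ and let $N$ be an $n\times n$ matrix with $N^2=0$, $\overline N=N$, such that $N'$, $\tilde N(x)$ and $\tilde{N'}(x)$ (defined in the context) are well-defined. If $\hat E=s_{\alpha,N}*E$ and $\hat c\in\mathbb{R}^n$ is a constant, then $$\hat h(x)=\hat E(x,0)^{-1}\hat c$$ gives a new $\partial$-invariant flat Egoroff metric $\sum_i\hat h_i^2dx_i^2$ (where all $\hat h_i$ are nonzero), with associated family of flat Lagrangian submanifolds of $\mathbb{C}^n$ $$\hat X(x,\lambda)=-i\lambda^{-1}\bigl(\hat E(x,i\lambda)\hat E(x,0)^{-1}\hat c-\hat c\bigr),\qquad \lambda\in\mathbb{R}\setminus\{0\}.$$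
   Context: Egoroff metrics: a metric $\sum_ih_i^2dx_i^2$ on an open subset of $\mathbb{R}^n$ is Egoroff if there is a function $\phi$ with $h_i^2=\partial\phi/\partial x_i$ for all $i$. It is flat if its curvature vanishes. Its rotation coefficient matrix $\beta$ is $\beta_{ij}=(h_i)_{x_j}/h_j$ for $i\ne j$, $\beta_{ii}=0$. A flat Egoroff metric is $\partial$-invariant if $\partial h_i=0$ for all $i$, where $\partial=\sum_j\frac{\partial}{\partial x_j}$. The rotation coefficient matrix of a flat Egoroff metric is a solution of the $\mathrm{GL}(n)/\mathrm{O}(n)$-system, i.e. $\beta$ is real symmetric with zero diagonal and, with $a_i=e_{ii}$ the elementary diagonal matrices, $\sum_i(\lambda a_i+[a_i,\beta])dx_i$ is flat for all $\lambda\in\mathbb{C}$. Frame: $E(x,\lambda)$ is the unique solution of $E^{-1}dE=\sum_i(\lambda a_i+[a_i,\beta])dx_i$, $E(0,\lambda)=\mathrm{Id}$. For a $\partial$-invariant flat Egoroff metric, $E(x,0)h(x)=h(0)$, and the associated family of flat Lagrangian immersions into $\mathbb{C}^n$ is $X(x,\lambda)=-i\lambda^{-1}(E(x,i\lambda)h(x)-h(0))$. Dressing: for a matrix $P$ with $P^2=0$ let $m_{\gamma,1,P}(\lambda)=\mathrm{Id}+\frac{1}{\lambda-\gamma}P$. Set $$N'=\left(\mathrm{Id}-\tfrac{1}{2\alpha}N\right)\left(\mathrm{Id}+\tfrac{1}{4\alpha^2}N^tN\right)^{-1}N^t\left(\mathrm{Id}+\tfrac{1}{2\alpha}N\right),\qquad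 s_{\alpha,N}=m_{-\alpha,1,N'}\,m_{\alpha,1,N}.$$ Put $E_1(x)=\left.\frac{d}{d\lambda}\right|_{\lambda=\alpha}E(x,\lambda)E(x,\alpha)^{-1}$, $\tilde N(x)=E(x,\alpha)^{-1}(\mathrm{Id}+NE_1(x))^{-1}NE(x,\alpha)$, $\tilde E(x,\lambda)=m_{\alpha,1,N}(\lambda)E(x,\lambda)m_{\alpha,1,\tilde N(x)}(\lambda)^{-1}$, $\tilde E_1(x)=\left.\frac{d}{d\lambda}\right|_{\lambda=-\alpha}\tilde E(x,\lambda)\tilde E(x,-\alpha)^{-1}$, and $\tilde{N'}(x)=\tilde E(x,-\alpha)^{-1}(\mathrm{Id}+N'\tilde E_1(x))^{-1}N'\tilde E(x,-\alpha)$. "Well-defined" means that the inverses occurring exist (on the open set of $x$ under consideration, to which the conclusion refers). Then $$\hat E=s_{\alpha,N}*E=m_{-\alpha,1,N'}\,m_{\alpha,1,N}\,E\,m_{\alpha,1,\tilde N}^{-1}\,m_{-\alpha,1,\tilde{N'}}^{-1},$$ which is holomorphic in $\lambda\in\mathbb{C}$ (after removing the removable singularities). *)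

theory Defs
  imports "HOL-Complex_Analysis.Complex_Analysis"
begin

section \<open>Smooth functions and curvature in coordinates\<close>

definition pd :: "'n::finite \<Rightarrow> (real^'n \<Rightarrow> 'b::real_normed_vector) \<Rightarrow> real^'n \<Rightarrow> 'b" where
  "pd i f x = frechet_derivative f (at x) (axis i 1)"

text \<open>The predicates below are meant for open sets \<open>U\<close> only.\<close>

primrec Ck_on :: "nat \<Rightarrow> (real^'n::finite \<Rightarrow> 'b::real_normed_vector) \<Rightarrow> (real^'n) set \<Rightarrow> bool" where
  "Ck_on 0 f U \<longleftrightarrow> continuous_on U f"
| "Ck_on (Suc k) f U \<longleftrightarrow> f differentiable_on U \<and> (\<forall>i. Ck_on k (pd i f) U)"

definition smooth_on :: "(real^'n::finite \<Rightarrow> 'b::real_normed_vector) \<Rightarrow> (real^'n) set \<Rightarrow> bool" where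
  "smooth_on f U \<longleftrightarrow> (\<forall>k. Ck_on k f U)"

text \<open>A metric \<open>\<Sum>\<^sub>i\<^sub>j g\<^sub>i\<^sub>j dx\<^sub>i dx\<^sub>j\<close> is given by its Gram matrix.  \<open>christoffel g k i j\<close> is
  \<open>\<Gamma>\<^sup>k\<^sub>i\<^sub>j\<close>, and \<open>curvature g l k i j\<close> is the \<open>\<partial>\<^sub>l\<close>-component of \<open>R(\<partial>\<^sub>i, \<partial>\<^sub>j)\<partial>\<^sub>k\<close>.\<close>

definition christoffel ::
  "(real^'n::finite \<Rightarrow> real^'n^'n) \<Rightarrow> 'n \<Rightarrow> 'n \<Rightarrow> 'n \<Rightarrow> real^'n \<Rightarrow> real" where
  "christoffel g k i j x =
     (1/2) * (\<Sum>l\<in>UNIV. matrix_inv (g x) $ k $ l *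
        (pd i (\<lambda>y. g y $ j $ l) x + pd j (\<lambda>y. g y $ i $ l) x - pd l (\<lambda>y. g y $ i $ j) x))"

definition curvature ::
  "(real^'n::finite \<Rightarrow> real^'n^'n) \<Rightarrow> 'n \<Rightarrow> 'n \<Rightarrow> 'n \<Rightarrow> 'n \<Rightarrow> real^'n \<Rightarrow> real" where
  "curvature g l k i j x =
     pd i (christoffel g l j k) x - pd j (christoffel g l i k) x
     + (\<Sum>m\<in>UNIV. christoffel g l i m x * christoffel g m j k x
                 - christoffel g l j m x * christoffel g m i k x)"

definition flat_metric_on :: "(real^'n::finite \<Rightarrow> real^'n^'n) \<Rightarrow> (real^'n) set \<Rightarrow> bool" where
  "flat_metric_on g U \<longleftrightarrow> (\<forall>x\<in>U. \<forall>l k i j. curvature g l k i j x = 0)"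

section \<open>Egoroff metrics\<close>

definition diag_metric :: "(real^'n::finite \<Rightarrow> real^'n) \<Rightarrow> real^'n \<Rightarrow> real^'n^'n" where
  "diag_metric h x = (\<chi> i j. if i = j then (h x $ i)\<^sup>2 else 0)"

definition egoroff_metric :: "(real^'n::finite) set \<Rightarrow> (real^'n \<Rightarrow> real^'n) \<Rightarrow> bool" where
  "egoroff_metric U h \<longleftrightarrow>
     open U \<and> smooth_on h U \<and> (\<forall>x\<in>U. \<forall>i. h x $ i \<noteq> 0) \<and>
     (\<exists>\<phi> :: real^'n \<Rightarrow> real. smooth_on \<phi> U \<and> (\<forall>x\<in>U. \<forall>i. (h x $ i)\<^sup>2 = pd i \<phi> x))"

definition invariant_flat_egoroff_metric ::
  "(real^'n::finite) set \<Rightarrow> (real^'n \<Rightarrow> real^'n) \<Rightarrow> bool" where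
  "invariant_flat_egoroff_metric U h \<longleftrightarrow>
     egoroff_metric U h \<and> flat_metric_on (diag_metric h) U \<and>
     (\<forall>x\<in>U. \<forall>i. (\<Sum>j\<in>UNIV. pd j (\<lambda>y. h y $ i) x) = 0)"

definition rotation_coeff :: "(real^'n::finite \<Rightarrow> real^'n) \<Rightarrow> real^'n \<Rightarrow> real^'n^'n" where
  "rotation_coeff h x = (\<chi> i j. if i = j then 0 else pd j (\<lambda>y. h y $ i) x / h x $ j)"

section \<open>Complex matrices and frames\<close>

definition cvec :: "real^'n \<Rightarrow> complex^'n" where
  "cvec v = (\<chi> i. complex_of_real (v $ i))"

definition cmat :: "real^'n^'m \<Rightarrow> complex^'n^'m" where
  "cmat A = (\<chi> i j. complex_of_real (A $ i $ j))"

definition cnj_mat :: "complex^'n^'m \<Rightarrow> complex^'n^'m" where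
  "cnj_mat A = (\<chi> i j. cnj (A $ i $ j))"

definition mscale :: "complex \<Rightarrow> complex^'n^'m \<Rightarrow> complex^'n^'m" where
  "mscale c A = (\<chi> i j. c * A $ i $ j)"

definition elem_diag :: "'n::finite \<Rightarrow> complex^'n^'n" where
  "elem_diag i = (\<chi> j k. if j = i \<and> k = i then 1 else 0)"

text \<open>The value of the 1-form \<open>\<Sum>\<^sub>i (\<mu> a\<^sub>i + [a\<^sub>i, B]) dx\<^sub>i\<close> on the tangent vector \<open>v\<close>.\<close>

definition connection_form :: "real^'n^'n::finite \<Rightarrow> complex \<Rightarrow> real^'n \<Rightarrow> complex^'n^'n" where
  "connection_form B \<mu> v =
     (\<Sum>i\<in>UNIV. v $ i *\<^sub>R (mscale \<mu> (elem_diag i) + (elem_diag i ** cmat B - cmat B ** elem_diag i)))"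

text \<open>\<open>E\<inverse> dE = \<Sum>\<^sub>i (\<mu> a\<^sub>i + [a\<^sub>i, \<beta>]) dx\<^sub>i\<close> on \<open>U\<close> and \<open>E(0,\<mu>) = Id\<close>, for all complex \<open>\<mu>\<close>.
  The values of \<open>E\<close> on \<open>U\<close> are determined by this if \<open>U\<close> is open, connected and contains \<open>0\<close>.\<close>

definition is_frame ::
  "(real^'n::finite) set \<Rightarrow> (real^'n \<Rightarrow> real^'n^'n) \<Rightarrow> (real^'n \<Rightarrow> complex \<Rightarrow> complex^'n^'n) \<Rightarrow> bool" where
  "is_frame U \<beta> E \<longleftrightarrow>
     (\<forall>\<mu>. E 0 \<mu> = mat 1 \<and>
        (\<forall>x\<in>U. invertible (E x \<mu>) \<and>
           (\<exists>D. ((\<lambda>y. E y \<mu>) has_derivative D) (at x) \<and>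
                (\<forall>v. matrix_inv (E x \<mu>) ** D v = connection_form (\<beta> x) \<mu> v))))"

section \<open>Flat Lagrangian immersions\<close>

definition associated_family ::
  "(real^'n::finite \<Rightarrow> complex \<Rightarrow> complex^'n^'n) \<Rightarrow> (real^'n \<Rightarrow> real^'n) \<Rightarrow> real^'n \<Rightarrow> real \<Rightarrow> complex^'n" where
  "associated_family E h x \<mu> =
     (- \<i> / complex_of_real \<mu>) *s (E x (\<i> * complex_of_real \<mu>) *v cvec (h x) - cvec (h 0))"

definition std_symplectic :: "complex^'n::finite \<Rightarrow> complex^'n \<Rightarrow> real" where
  "std_symplectic u v = Im (\<Sum>k\<in>UNIV. cnj (u $ k) * v $ k)"

text \<open>The inner product of \<open>complex^'n\<close> is the Euclidean one of \<open>\<real>\<^sup>2\<^sup>n\<close>.\<close>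

definition induced_metric :: "(real^'n::finite \<Rightarrow> complex^'n) \<Rightarrow> real^'n \<Rightarrow> real^'n^'n" where
  "induced_metric X x = (\<chi> i j. pd i X x \<bullet> pd j X x)"

definition flat_lagrangian_immersion ::
  "(real^'n::finite) set \<Rightarrow> (real^'n \<Rightarrow> complex^'n) \<Rightarrow> bool" where
  "flat_lagrangian_immersion U X \<longleftrightarrow>
     smooth_on X U \<and>
     (\<forall>x\<in>U. inj (frechet_derivative X (at x))) \<and>
     (\<forall>x\<in>U. \<forall>i j. std_symplectic (pd i X x) (pd j X x) = 0) \<and>
     flat_metric_on (induced_metric X) U"

section \<open>Dressing\<close>

text \<open>\<open>m\<^sub>\<gamma>\<^sub>,\<^sub>1\<^sub>,\<^sub>P(\<mu>)\<close>.\<close>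

definition simple_factor :: "complex \<Rightarrow> complex^'n^'n::finite \<Rightarrow> complex \<Rightarrow> complex^'n^'n" where
  "simple_factor \<gamma> P \<mu> = mat 1 + mscale (1 / (\<mu> - \<gamma>)) P"

definition mat_deriv :: "(complex \<Rightarrow> complex^'n^'m) \<Rightarrow> complex \<Rightarrow> complex^'n^'m" where
  "mat_deriv F z0 = (\<chi> i j. deriv (\<lambda>z. F z $ i $ j) z0)"

text \<open>\<open>E\<^sub>1(x)\<close> for \<open>\<gamma> = \<alpha>\<close>; applied to the first dressing of \<open>E\<close> and \<open>\<gamma> = -\<alpha>\<close> it is the second
  such matrix.  Likewise \<open>dressed_residue\<close> gives both \<open>N\<close>-tilde and \<open>N'\<close>-tilde.\<close>

definition frame_log_deriv ::
  "complex \<Rightarrow> (real^'n::finite \<Rightarrow> complex \<Rightarrow> complex^'n^'n) \<Rightarrow> real^'n \<Rightarrow> complex^'n^'n" where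
  "frame_log_deriv \<gamma> E x = mat_deriv (\<lambda>z. E x z ** matrix_inv (E x \<gamma>)) \<gamma>"

definition dressed_residue ::
  "complex \<Rightarrow> complex^'n^'n \<Rightarrow> (real^'n::finite \<Rightarrow> complex \<Rightarrow> complex^'n^'n) \<Rightarrow> real^'n \<Rightarrow> complex^'n^'n" where
  "dressed_residue \<gamma> P E x =
     matrix_inv (E x \<gamma>) ** matrix_inv (mat 1 + P ** frame_log_deriv \<gamma> E x) ** P ** E x \<gamma>"

definition residue_well_defined ::
  "complex \<Rightarrow> complex^'n^'n \<Rightarrow> (real^'n::finite \<Rightarrow> complex \<Rightarrow> complex^'n^'n) \<Rightarrow> real^'n \<Rightarrow> bool" where
  "residue_well_defined \<gamma> P E x \<longleftrightarrow>
     invertible (E x \<gamma>) \<and> invertible (mat 1 + P ** frame_log_deriv \<gamma> E x)"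

text \<open>The value at \<open>\<mu> = \<gamma>\<close> is meaningless.\<close>

definition simple_dressing ::
  "complex \<Rightarrow> complex^'n^'n \<Rightarrow> (real^'n::finite \<Rightarrow> complex \<Rightarrow> complex^'n^'n)
     \<Rightarrow> real^'n \<Rightarrow> complex \<Rightarrow> complex^'n^'n" where
  "simple_dressing \<gamma> P E x \<mu> =
     simple_factor \<gamma> P \<mu> ** E x \<mu> ** matrix_inv (simple_factor \<gamma> (dressed_residue \<gamma> P E x) \<mu>)"

definition N_prime_denom :: "real \<Rightarrow> complex^'n^'n::finite \<Rightarrow> complex^'n^'n" where
  "N_prime_denom \<alpha> N = mat 1 + mscale (1 / (4 * (complex_of_real \<alpha>)\<^sup>2)) (transpose N ** N)"

definition N_prime :: "real \<Rightarrow> complex^'n^'n::finite \<Rightarrow> complex^'n^'n" where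
  "N_prime \<alpha> N =
     (mat 1 - mscale (1 / (2 * complex_of_real \<alpha>)) N) ** matrix_inv (N_prime_denom \<alpha> N)
       ** transpose N ** (mat 1 + mscale (1 / (2 * complex_of_real \<alpha>)) N)"

definition dressing_well_defined ::
  "real \<Rightarrow> complex^'n^'n \<Rightarrow> (real^'n::finite \<Rightarrow> complex \<Rightarrow> complex^'n^'n) \<Rightarrow> real^'n \<Rightarrow> bool" where
  "dressing_well_defined \<alpha> N E x \<longleftrightarrow>
     invertible (N_prime_denom \<alpha> N) \<and>
     residue_well_defined (complex_of_real \<alpha>) N E x \<and>
     residue_well_defined (- complex_of_real \<alpha>) (N_prime \<alpha> N)
       (simple_dressing (complex_of_real \<alpha>) N E) x"

text \<open>\<open>s\<^sub>\<alpha>\<^sub>,\<^sub>N * E\<close>, with the singularities at \<open>\<mu> = \<plusminus>\<alpha>\<close> removed entrywise.\<close>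

definition dressed_frame ::
  "real \<Rightarrow> complex^'n^'n \<Rightarrow> (real^'n::finite \<Rightarrow> complex \<Rightarrow> complex^'n^'n)
     \<Rightarrow> real^'n \<Rightarrow> complex \<Rightarrow> complex^'n^'n" where
  "dressed_frame \<alpha> N E x \<mu> =
     (\<chi> i j. remove_sings
        (\<lambda>z. simple_dressing (- complex_of_real \<alpha>) (N_prime \<alpha> N)
                (simple_dressing (complex_of_real \<alpha>) N E) x z $ i $ j) \<mu>)"

end

theory Submission
  imports Defs
begin

text \<open>Write \<open>A\<^sub>\<mu>(v) = \<mu> \<delta>(v) + [\<delta>(v), B]\<close> for the connection form, where \<open>\<delta>(v)\<close> is the diagonal
  matrix of \<open>v\<close>.  The residue \<open>Q\<close> of a simple dressing satisfies \<open>Q\<^sup>2 = 0\<close> and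
  \<open>dQ = [Q, A\<^sub>\<gamma>] - Q \<delta> Q\<close>, and this identity says exactly that the dressed frame has a connection form of
  the same shape with \<open>B - Q\<close> in place of \<open>B\<close>.  Both poles cancel, so after the two dressings one has an
  entire family \<open>G(x, \<mu>)\<close>; the choice of \<open>N'\<close> and Liouville's theorem give \<open>G(x, -\<mu>)\<^sup>T G(x, \<mu>) = 1\<close>,
  hence the symmetry of the new \<open>B\<close>.  With \<open>h = G(x, 0)\<^sup>T c\<close>, the map \<open>Y = \<partial>\<^sub>\<mu>G(x, 0) h\<close> satisfies
  \<open>dY = G(x, 0) \<delta> h\<close>: it is a system of flat coordinates for the metric with coefficients \<open>h\<^sub>i\<^sup>2\<close>, and the
  inner product of \<open>c\<close> and \<open>Y\<close> is a potential.  The Lagrangian immersions satisfy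
  \<open>dX = G(x, i\<mu>) \<delta> h\<close> with \<open>G(x, i\<mu>)\<close> unitary.\<close>

text \<open>The definition of a frame treats each spectral parameter \<mu> separately, so neither
  continuity nor holomorphy in \<mu> is given. Yet dressing uses the \<mu>-derivative of the frame,
  and that derivative must itself be differentiated in x. Hence the long treatment of linear
  equations with a parameter. Its estimates serve a second time at the pole of a simple factor,
  where the dressed frame is defined only by removing a singularity and its equation has to be
  obtained as a limit.

  The open set W on which the dressing exists need not be connected. Orthogonality of the dressed
  frame is therefore not propagated from 0 by uniqueness, but proved at each x separately, as an
  identity in \<mu>.

  The matrix N' solves the equation that arises from comparing residues in
  \<open>s(-\<mu>)^T s(\<mu>) = 1\<close>; the constant 1/(2\<alpha>) comes from the partial
  fractions of 1/((\<mu> - \<alpha>)(\<mu> + \<alpha>)). The diagonal of B cancels in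
  [\<delta>(v), B], so B - Q is an admissible potential although Q may have a nonzero
  diagonal.\<close>

no_notation fps_nth (infixl "$" 75)

section \<open>Calculus of smooth functions\<close>

lemma frechet_derivative_worksI:
  "f differentiable (at x) \<Longrightarrow> (f has_derivative frechet_derivative f (at x)) (at x)"
  by (simp add: frechet_derivative_works)

lemma pd_eqI: "(f has_derivative D) (at x) \<Longrightarrow> pd i f x = D (axis i 1)"
  by (simp add: pd_def frechet_derivative_at[symmetric])

lemma has_derivative_cong_open:
  assumes "open U" "\<And>y. y \<in> U \<Longrightarrow> f y = g y" "x \<in> U"
  shows "(f has_derivative D) (at x) \<longleftrightarrow> (g has_derivative D) (at x)"
  using has_derivative_transform_within_open[OF _ assms(1) assms(3)] assms(2)
  by metis

lemma pd_cong_open: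
  assumes "open U" "\<And>y. y \<in> U \<Longrightarrow> f y = g y" "x \<in> U"
  shows "pd i f x = pd i g x"
  unfolding pd_def frechet_derivative_def using has_derivative_cong_open[OF assms] by simp

text \<open>Explicit formulas for derivatives hold only on U. This congruence lets them stand in for
  \<open>pd i f\<close>, which is also defined outside U.\<close>

lemma Ck_on_cong:
  assumes "open U" "\<And>y. y \<in> U \<Longrightarrow> f y = g y"
  shows "Ck_on k f U \<longleftrightarrow> Ck_on k g U"
  using assms(2)
proof (induction k arbitrary: f g)
  case 0
  then show ?case by (simp cong: continuous_on_cong)
next
  case (Suc k)
  have "Ck_on k (pd i f) U \<longleftrightarrow> Ck_on k (pd i g) U" for i
    by (rule Suc.IH) (rule pd_cong_open[OF assms(1) Suc.prems])
  moreover have "f differentiable_on U \<longleftrightarrow> g differentiable_on U"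
    unfolding differentiable_on_eq_differentiable_at[OF assms(1)] differentiable_def
    using has_derivative_cong_open[of U f g] assms(1) Suc.prems by metis
  ultimately show ?case by simp
qed

lemma Ck_on_Suc_imp: "Ck_on (Suc k) f U \<Longrightarrow> Ck_on k f U"
proof (induction k arbitrary: f)
  case 0
  then show ?case by (simp add: differentiable_imp_continuous_on)
next
  case (Suc k)
  then show ?case by (metis Ck_on.simps(2))
qed

lemma Ck_on_subset: "Ck_on k f U \<Longrightarrow> V \<subseteq> U \<Longrightarrow> Ck_on k f V"
  by (induction k arbitrary: f) (auto intro: continuous_on_subset differentiable_on_subset)

lemma smooth_on_subset: "smooth_on f U \<Longrightarrow> V \<subseteq> U \<Longrightarrow> smooth_on f V"
  unfolding smooth_on_def using Ck_on_subset by blast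

lemma smooth_on_imp_differentiable:
  assumes "smooth_on f U" "open U" "x \<in> U"
  shows "f differentiable (at x)"
proof -
  have "Ck_on (Suc 0) f U"
    using assms by (simp only: smooth_on_def)
  then show ?thesis
    using assms by (simp add: differentiable_on_eq_differentiable_at)
qed

lemma smooth_on_pd: "smooth_on f U \<Longrightarrow> smooth_on (pd i f) U"
  unfolding smooth_on_def by (metis Ck_on.simps(2))

lemma smooth_on_imp_continuous_on: "smooth_on f U \<Longrightarrow> continuous_on U f"
  unfolding smooth_on_def by (metis Ck_on.simps(1))

section \<open>Closure of smoothness under algebraic operations\<close>

lemma Ck_on_const: "Ck_on k (\<lambda>_. c) (U :: (real^'n::finite) set)"
proof (induction k arbitrary: c)
  case (Suc k)
  have "pd i (\<lambda>_ :: real^'n. c) = (\<lambda>_. 0)" for i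
    by (rule ext) (rule pd_eqI, simp)
  then show ?case using Suc by simp
qed simp

lemma Ck_on_add:
  assumes "open U" "Ck_on k f U" "Ck_on k g U"
  shows "Ck_on k (\<lambda>x. f x + g x) U"
  using assms(2,3)
proof (induction k arbitrary: f g)
  case 0
  then show ?case by (simp add: continuous_on_add)
next
  case (Suc k)
  have d: "f differentiable (at x)" "g differentiable (at x)" if "x \<in> U" for x
    using Suc.prems that by (simp_all add: differentiable_on_eq_differentiable_at[OF assms(1)])
  have "pd i (\<lambda>x. f x + g x) x = pd i f x + pd i g x" if "x \<in> U" for i x
    unfolding pd_def[of i f] pd_def[of i g]
    by (rule pd_eqI) (intro has_derivative_add frechet_derivative_worksI d that)
  then have "Ck_on k (pd i (\<lambda>x. f x + g x)) U \<longleftrightarrow> Ck_on k (\<lambda>x. pd i f x + pd i g x) U" for i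
    by (intro Ck_on_cong assms(1)) auto
  then show ?case using Suc by simp
qed

lemma Ck_on_bounded_linear:
  assumes "open U" "bounded_linear T" "Ck_on k f U"
  shows "Ck_on k (\<lambda>x. T (f x)) U"
  using assms(3)
proof (induction k arbitrary: f)
  case 0
  then show ?case using assms(2) by (simp add: bounded_linear.continuous_on)
next
  case (Suc k)
  have d: "f differentiable (at x)" if "x \<in> U" for x
    using Suc.prems that by (simp add: differentiable_on_eq_differentiable_at[OF assms(1)])
  have hd: "((\<lambda>x. T (f x)) has_derivative (\<lambda>v. T (frechet_derivative f (at x) v))) (at x)"
    if "x \<in> U" for x
    by (intro bounded_linear.has_derivative[OF assms(2)] frechet_derivative_worksI d that)
  have "pd i (\<lambda>x. T (f x)) x = T (pd i f x)" if "x \<in> U" for i x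
    using pd_eqI[OF hd[OF that]] by (simp add: pd_def)
  then have "Ck_on k (pd i (\<lambda>x. T (f x))) U \<longleftrightarrow> Ck_on k (\<lambda>x. T (pd i f x)) U" for i
    by (intro Ck_on_cong assms(1)) auto
  moreover have "(\<lambda>x. T (f x)) differentiable_on U"
    unfolding differentiable_on_eq_differentiable_at[OF assms(1)] differentiable_def using hd by blast
  ultimately show ?case using Suc by simp
qed

text \<open>The product rule gives a sum of two values of P, each with one undifferentiated factor;
  for that factor the order k + 1 is lowered to k before the induction hypothesis applies.\<close>

lemma Ck_on_bounded_bilinear:
  assumes "open U" "bounded_bilinear P" "Ck_on k f U" "Ck_on k g U"
  shows "Ck_on k (\<lambda>x. P (f x) (g x)) U"
  using assms(3,4)
proof (induction k arbitrary: f g)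
  case 0
  then show ?case using assms(2) by (simp add: bounded_bilinear.continuous_on)
next
  case (Suc k)
  have d: "f differentiable (at x)" "g differentiable (at x)" if "x \<in> U" for x
    using Suc.prems that by (simp_all add: differentiable_on_eq_differentiable_at[OF assms(1)])
  have hd: "((\<lambda>x. P (f x) (g x)) has_derivative
      (\<lambda>v. P (f x) (frechet_derivative g (at x) v) + P (frechet_derivative f (at x) v) (g x))) (at x)"
    if "x \<in> U" for x
    by (intro bounded_bilinear.FDERIV[OF assms(2)] frechet_derivative_worksI d that)
  have "pd i (\<lambda>x. P (f x) (g x)) x = P (f x) (pd i g x) + P (pd i f x) (g x)" if "x \<in> U" for i x
    using pd_eqI[OF hd[OF that]] by (simp add: pd_def)
  then have "Ck_on k (pd i (\<lambda>x. P (f x) (g x))) U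
      \<longleftrightarrow> Ck_on k (\<lambda>x. P (f x) (pd i g x) + P (pd i f x) (g x)) U" for i
    by (intro Ck_on_cong assms(1)) auto
  moreover have "Ck_on k (\<lambda>x. P (f x) (pd i g x) + P (pd i f x) (g x)) U" for i
    using Suc.prems Ck_on_Suc_imp[of k f U] Ck_on_Suc_imp[of k g U] by (intro Ck_on_add assms(1) Suc.IH) auto
  moreover have "(\<lambda>x. P (f x) (g x)) differentiable_on U"
    unfolding differentiable_on_eq_differentiable_at[OF assms(1)] differentiable_def using hd by blast
  ultimately show ?case by simp
qed

lemma Ck_on_diff:
  assumes "open U" "Ck_on k f U" "Ck_on k g U"
  shows "Ck_on k (\<lambda>x. f x - g x) U"
  using Ck_on_add[OF assms(1,2) Ck_on_bounded_linear[OF assms(1) _ assms(3), of uminus]]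
  by (simp add: bounded_linear_minus bounded_linear_ident)

lemma Ck_on_sum:
  assumes "open U" "finite S" "\<And>s. s \<in> S \<Longrightarrow> Ck_on k (f s) U"
  shows "Ck_on k (\<lambda>x. \<Sum>s\<in>S. f s x) U"
  using assms(2,3) by (induction S rule: finite_induct) (auto intro: Ck_on_const Ck_on_add[OF assms(1)])

lemma norm_axis_eq: "norm (axis i x :: 'b::real_normed_vector^'n::finite) = norm x"
proof -
  have "(\<Sum>j\<in>UNIV. (norm ((axis i x :: 'b^'n) $ j))\<^sup>2) = (\<Sum>j\<in>UNIV. if j = i then (norm x)\<^sup>2 else 0)"
    by (intro sum.cong) (auto simp: axis_def)
  then show ?thesis by (simp add: norm_vec_def L2_set_def)
qed

lemma bounded_linear_axis: "bounded_linear (axis i :: 'b::real_normed_vector \<Rightarrow> 'b^'n::finite)"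
proof (intro bounded_linear_intro[where K = 1])
  fix x :: 'b
  show "norm (axis i x :: 'b^'n) \<le> norm x * 1"
    using norm_axis_eq[of i x] by simp
qed (auto simp: axis_def vec_eq_iff)

lemma vec_eq_sum_axis: "(v :: 'b::real_normed_vector^'n::finite) = (\<Sum>i\<in>UNIV. axis i (v $ i))"
  by (simp add: vec_eq_iff axis_def if_distrib cong: if_cong)

lemma Ck_on_vec:
  fixes f :: "real^'n::finite \<Rightarrow> 'b::real_normed_vector^'m::finite"
  assumes "open U" "\<And>i. Ck_on k (\<lambda>x. f x $ i) U"
  shows "Ck_on k f U"
proof -
  have "Ck_on k (\<lambda>x. \<Sum>i\<in>UNIV. axis i (f x $ i)) U"
    by (intro Ck_on_sum Ck_on_bounded_linear[OF _ bounded_linear_axis] assms) auto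
  then show ?thesis by (simp add: vec_eq_sum_axis[symmetric])
qed

lemma smooth_on_const: "smooth_on (\<lambda>_. c) U"
  by (simp add: smooth_on_def Ck_on_const)

lemma smooth_on_bounded_linear:
  "open U \<Longrightarrow> bounded_linear T \<Longrightarrow> smooth_on f U \<Longrightarrow> smooth_on (\<lambda>x. T (f x)) U"
  by (simp add: smooth_on_def Ck_on_bounded_linear)

lemma smooth_on_bounded_bilinear:
  "open U \<Longrightarrow> bounded_bilinear P \<Longrightarrow> smooth_on f U \<Longrightarrow> smooth_on g U \<Longrightarrow> smooth_on (\<lambda>x. P (f x) (g x)) U"
  by (simp add: smooth_on_def Ck_on_bounded_bilinear)

lemma smooth_on_diff:
  "open U \<Longrightarrow> smooth_on f U \<Longrightarrow> smooth_on g U \<Longrightarrow> smooth_on (\<lambda>x. f x - g x) U"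
  by (simp add: smooth_on_def Ck_on_diff)

lemma smooth_on_vec: "open U \<Longrightarrow> (\<And>i. smooth_on (\<lambda>x. f x $ i) U) \<Longrightarrow> smooth_on f U"
  by (simp add: smooth_on_def Ck_on_vec)

lemma smooth_on_nth: "open U \<Longrightarrow> smooth_on f U \<Longrightarrow> smooth_on (\<lambda>x. f x $ i) U"
  by (rule smooth_on_bounded_linear[OF _ bounded_linear_vec_nth])

text \<open>Solutions of differential equations gain regularity: if D is built from f and smooth
  data by operations that preserve order k, then order k of f passes to its partial derivatives and
  gives order k + 1 of f. Frames, residues, flat coordinates and immersions obtain their smoothness
  in this way.\<close>

lemma smooth_on_bootstrap:
  assumes "open U" and hd: "\<And>x. x \<in> U \<Longrightarrow> (f has_derivative D x) (at x)"
    and step: "\<And>k i. Ck_on k f U \<Longrightarrow> Ck_on k (\<lambda>x. D x (axis i 1)) U"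
  shows "smooth_on f U"
proof -
  have diff: "f differentiable_on U"
    using hd assms(1) by (auto simp: differentiable_on_eq_differentiable_at differentiable_def)
  have "Ck_on k (\<lambda>x. D x (axis i 1)) U \<longleftrightarrow> Ck_on k (pd i f) U" for k i
    by (intro Ck_on_cong assms(1)) (simp add: pd_eqI[OF hd])
  then have "Ck_on k f U" for k
    by (induction k) (use diff step differentiable_imp_continuous_on in auto)
  then show ?thesis by (simp add: smooth_on_def)
qed

lemma smooth_on_inverse:
  fixes f :: "real^'n::finite \<Rightarrow> real"
  assumes "open U" "smooth_on f U" "\<And>x. x \<in> U \<Longrightarrow> f x \<noteq> 0"
  shows "smooth_on (\<lambda>x. inverse (f x)) U"
proof (rule smooth_on_bootstrap[OF assms(1)])
  show "((\<lambda>x. inverse (f x)) has_derivative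
      (\<lambda>v. - (inverse (f x) * frechet_derivative f (at x) v * inverse (f x)))) (at x)"
    if "x \<in> U" for x
    using that by (intro Deriv.has_derivative_inverse assms frechet_derivative_worksI
        smooth_on_imp_differentiable[OF assms(2,1)])
  fix k i assume "Ck_on k (\<lambda>x. inverse (f x)) U"
  then have "Ck_on k (\<lambda>x. - (inverse (f x) * pd i f x * inverse (f x))) U"
    using smooth_on_pd[OF assms(2)] unfolding smooth_on_def
    by (intro Ck_on_bounded_linear[OF assms(1) bounded_linear_minus[OF bounded_linear_ident]]
        Ck_on_bounded_bilinear[OF assms(1) bounded_bilinear_mult]) auto
  then show "Ck_on k (\<lambda>x. - (inverse (f x) * frechet_derivative f (at x) (axis i 1) * inverse (f x))) U"
    by (simp add: pd_def)
qed

text \<open>The increment of f in direction i is regarded as a function of the displacement in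
  direction j. Its derivative is a difference of two values of \<open>pd j f\<close>, which
  differentiability of \<open>pd j f\<close> at x controls, and the mean value inequality gives the
  bound.\<close>

lemma second_difference_bound:
  fixes f :: "real^'n::finite \<Rightarrow> 'b::real_normed_vector"
  assumes "open U" "smooth_on f U" "x \<in> U" "e > 0"
  obtains d where "d > 0" "\<forall>s. 0 < s \<longrightarrow> s < d \<longrightarrow>
    norm (f (x + s *\<^sub>R axis i 1 + s *\<^sub>R axis j 1) - f (x + s *\<^sub>R axis j 1) - f (x + s *\<^sub>R axis i 1) + f x
      - (s * s) *\<^sub>R pd i (pd j f) x) \<le> e * s * s"
proof -
  let ?p = "pd j f" and ?i = "axis i 1 :: real^'n" and ?j = "axis j 1 :: real^'n"
  obtain D where D: "(?p has_derivative D) (at x)"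
    using smooth_on_imp_differentiable[OF smooth_on_pd[OF assms(2)] assms(1,3)]
    unfolding differentiable_def by blast
  interpret D: bounded_linear D using D by (rule has_derivative_bounded_linear)
  obtain r where r: "r > 0" "ball x r \<subseteq> U"
    using assms(1,3) openE by blast
  \<comment> \<open>The tolerance e/3 is used at two points, at distances at most 2s and s from x;
    the two errors add up to e s.\<close>
  obtain d where d: "d > 0"
    "\<And>y. norm (y - x) < d \<Longrightarrow> norm (?p y - ?p x - D (y - x)) \<le> e/3 * norm (y - x)"
    using has_derivative_at_alt[THEN iffD1, OF D] assms(4)
    by (metis divide_pos_pos zero_less_numeral)
  define d' where "d' = min d r / 2"
  show ?thesis
  proof (rule that[of d'], goal_cases)
    case 1
    show "d' > 0" using d r by (simp add: d'_def)
  next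
    case 2
    show ?case
    proof (intro allI impI)
    fix s assume s: "0 < s" "s < d'"
    have s2: "2 * s < d" "2 * s < r" using s by (auto simp: d'_def)
    have nb: "norm (a *\<^sub>R ?i + b *\<^sub>R ?j) \<le> 2 * s" if "\<bar>a\<bar> \<le> s" "\<bar>b\<bar> \<le> s" for a b
      using that norm_triangle_ineq[of "a *\<^sub>R ?i" "b *\<^sub>R ?j"] by simp
    have dist_add: "dist x (x + w) = norm w" for w :: "real^'n" by (simp add: dist_norm)
    have inU: "x + a *\<^sub>R ?i + b *\<^sub>R ?j \<in> U" if "\<bar>a\<bar> \<le> s" "\<bar>b\<bar> \<le> s" for a b
    proof -
      have "norm (a *\<^sub>R ?i + b *\<^sub>R ?j) < r" using nb[OF that] s2 by simp
      then have "x + (a *\<^sub>R ?i + b *\<^sub>R ?j) \<in> ball x r" using dist_add[of "a *\<^sub>R ?i + b *\<^sub>R ?j"] by simp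
      then show ?thesis using r by (metis add.assoc subset_iff)
    qed
    \<comment> \<open>The linear term makes \<open>\<phi> s - \<phi> 0\<close> the second difference
      minus s^2 times the expected mixed derivative.\<close>
    define \<phi> where "\<phi> t = f (x + s *\<^sub>R ?i + t *\<^sub>R ?j) - f (x + 0 *\<^sub>R ?i + t *\<^sub>R ?j) - t *\<^sub>R s *\<^sub>R D ?i" for t
    define \<phi>' where "\<phi>' t = ?p (x + s *\<^sub>R ?i + t *\<^sub>R ?j) - ?p (x + 0 *\<^sub>R ?i + t *\<^sub>R ?j) - s *\<^sub>R D ?i" for t
    have fd: "((\<lambda>t. f (x + a *\<^sub>R ?i + t *\<^sub>R ?j)) has_derivative (\<lambda>h. h *\<^sub>R ?p (x + a *\<^sub>R ?i + t *\<^sub>R ?j))) (at t within {0..s})"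
      if "\<bar>a\<bar> \<le> s" "t \<in> {0..s}" for a t
    proof -
      let ?y = "x + a *\<^sub>R ?i + t *\<^sub>R ?j"
      have hf: "(f has_derivative frechet_derivative f (at ?y)) (at ?y)"
        using that inU[of a t] smooth_on_imp_differentiable[OF assms(2,1)] by (intro frechet_derivative_worksI) auto
      have hx: "((\<lambda>t. x + a *\<^sub>R ?i + t *\<^sub>R ?j) has_derivative (\<lambda>h. h *\<^sub>R ?j)) (at t within {0..s})"
        by (auto intro!: derivative_eq_intros)
      have "((\<lambda>t. f (x + a *\<^sub>R ?i + t *\<^sub>R ?j)) has_derivative (\<lambda>h. frechet_derivative f (at ?y) (h *\<^sub>R ?j))) (at t within {0..s})"
        using has_derivative_compose[OF hx hf] .
      then show ?thesis
        using linear_scale[OF has_derivative_linear[OF hf]] by (simp add: pd_def)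
    qed
    have \<phi>der: "(\<phi> has_derivative (\<lambda>h. h *\<^sub>R \<phi>' t)) (at t within {0..s})" if "t \<in> {0..s}" for t
    proof -
      have "(\<phi> has_derivative (\<lambda>h. h *\<^sub>R ?p (x + s *\<^sub>R ?i + t *\<^sub>R ?j) - h *\<^sub>R ?p (x + 0 *\<^sub>R ?i + t *\<^sub>R ?j) - h *\<^sub>R s *\<^sub>R D ?i)) (at t within {0..s})"
        unfolding \<phi>_def using that s by (intro has_derivative_diff fd has_derivative_scaleR_left has_derivative_ident) auto
      then show ?thesis unfolding \<phi>'_def by (simp add: scaleR_diff_right)
    qed
    have \<phi>'b: "norm (\<phi>' t) \<le> e * s" if "t \<in> {0..s}" for t
    proof -
      have *: "norm (?p (x + a *\<^sub>R ?i + t *\<^sub>R ?j) - ?p x - (a *\<^sub>R D ?i + t *\<^sub>R D ?j)) \<le> e/3 * norm (a *\<^sub>R ?i + t *\<^sub>R ?j)"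
        if "\<bar>a\<bar> \<le> s" for a
        using d(2)[of "x + a *\<^sub>R ?i + t *\<^sub>R ?j"] nb[OF that, of t] \<open>t \<in> {0..s}\<close> s2
        by (simp add: D.add D.scaleR add.assoc)
      have "norm (s *\<^sub>R ?i + t *\<^sub>R ?j) \<le> 2 * s" using nb[of s t] that s by simp
      moreover have "norm (0 *\<^sub>R ?i + t *\<^sub>R ?j) \<le> s" using that by simp
      ultimately have "e/3 * norm (s *\<^sub>R ?i + t *\<^sub>R ?j) + e/3 * norm (0 *\<^sub>R ?i + t *\<^sub>R ?j) \<le> e/3 * (2 * s) + e/3 * s"
        using assms(4) by (intro add_mono mult_left_mono) auto
      moreover have "\<phi>' t = (?p (x + s *\<^sub>R ?i + t *\<^sub>R ?j) - ?p x - (s *\<^sub>R D ?i + t *\<^sub>R D ?j))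
          - (?p (x + 0 *\<^sub>R ?i + t *\<^sub>R ?j) - ?p x - (0 *\<^sub>R D ?i + t *\<^sub>R D ?j))"
        by (simp add: \<phi>'_def)
      ultimately show ?thesis
        using *[of s] *[of 0] s norm_triangle_ineq4[of "?p (x + s *\<^sub>R ?i + t *\<^sub>R ?j) - ?p x - (s *\<^sub>R D ?i + t *\<^sub>R D ?j)"
          "?p (x + 0 *\<^sub>R ?i + t *\<^sub>R ?j) - ?p x - (0 *\<^sub>R D ?i + t *\<^sub>R D ?j)"]
        by simp
    qed
    have "norm (\<phi> s - \<phi> 0) \<le> e * s * norm (s - 0)"
    proof (rule differentiable_bound[of "{0..s}"])
      show "onorm (\<lambda>h. h *\<^sub>R \<phi>' t) \<le> e * s" if "t \<in> {0..s}" for t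
        using \<phi>'b[OF that] by (intro onorm_le) (metis norm_scaleR mult.commute mult_left_mono norm_ge_zero real_norm_def)
    qed (use \<phi>der s in auto)
    moreover have "pd i ?p x = D ?i" by (rule pd_eqI[OF D])
    ultimately show "norm (f (x + s *\<^sub>R ?i + s *\<^sub>R ?j) - f (x + s *\<^sub>R ?j) - f (x + s *\<^sub>R ?i) + f x
      - (s * s) *\<^sub>R pd i ?p x) \<le> e * s * s"
      using s by (simp add: \<phi>_def algebra_simps)
    qed
  qed
qed

text \<open>The second difference is symmetric in i and j, so both iterated derivatives are
  approximated by the same quotient.\<close>

lemma pd_commute:
  fixes f :: "real^'n::finite \<Rightarrow> 'b::real_normed_vector"
  assumes "open U" "smooth_on f U" "x \<in> U"
  shows "pd i (pd j f) x = pd j (pd i f) x"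
proof -
  have "norm (pd i (pd j f) x - pd j (pd i f) x) \<le> 0 + e" if e: "e > 0" for e
  proof -
    obtain d1 where d1: "d1 > 0" "\<forall>s. 0 < s \<longrightarrow> s < d1 \<longrightarrow>
      norm (f (x + s *\<^sub>R axis i 1 + s *\<^sub>R axis j 1) - f (x + s *\<^sub>R axis j 1) - f (x + s *\<^sub>R axis i 1) + f x
      - (s * s) *\<^sub>R pd i (pd j f) x) \<le> e/2 * s * s"
      by (rule second_difference_bound[OF assms half_gt_zero[OF e], of i j]) (rule that)
    obtain d2 where d2: "d2 > 0" "\<forall>s. 0 < s \<longrightarrow> s < d2 \<longrightarrow>
      norm (f (x + s *\<^sub>R axis j 1 + s *\<^sub>R axis i 1) - f (x + s *\<^sub>R axis i 1) - f (x + s *\<^sub>R axis j 1) + f x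
      - (s * s) *\<^sub>R pd j (pd i f) x) \<le> e/2 * s * s"
      by (rule second_difference_bound[OF assms half_gt_zero[OF e], of j i]) (rule that)
    define s where "s = min d1 d2 / 2"
    have s: "s > 0" "s < d1" "s < d2" using d1 d2 by (auto simp: s_def)
    have tri: "norm (q - p) \<le> norm (a - p) + norm (a - q)" for a p q :: 'b
      using norm_triangle_ineq4[of "a - p" "a - q"] by simp
    let ?\<Delta> = "f (x + s *\<^sub>R axis i 1 + s *\<^sub>R axis j 1) - f (x + s *\<^sub>R axis j 1) - f (x + s *\<^sub>R axis i 1) + f x"
    have "norm (?\<Delta> - (s * s) *\<^sub>R pd j (pd i f) x) \<le> e/2 * s * s"
      using d2(2)[rule_format, of s] s by (simp add: algebra_simps)
    then have "norm ((s * s) *\<^sub>R pd i (pd j f) x - (s * s) *\<^sub>R pd j (pd i f) x) \<le> e * s * s"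
      using d1(2)[rule_format, of s] s tri[of "(s * s) *\<^sub>R pd i (pd j f) x" "(s * s) *\<^sub>R pd j (pd i f) x" ?\<Delta>] by simp
    then have "s * s * norm (pd i (pd j f) x - pd j (pd i f) x) \<le> s * s * e"
      unfolding scaleR_diff_right[symmetric] by (simp add: mult.commute mult.left_commute)
    then show ?thesis using s by simp
  qed
  then have "norm (pd i (pd j f) x - pd j (pd i f) x) \<le> 0"
    by (rule field_le_epsilon)
  then show ?thesis by simp
qed

section \<open>Matrix algebra\<close>

lemma matrix_add_rdistrib': "(A + B) ** C = A ** C + B ** (C :: 'a::semiring_1^'n^'m)"
  by (simp add: matrix_matrix_mult_def vec_eq_iff distrib_right sum.distrib)

lemma matrix_diff_ldistrib: "A ** (B - C) = A ** B - A ** (C :: 'a::ring_1^'n^'m)"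
  by (simp add: matrix_matrix_mult_def vec_eq_iff right_diff_distrib sum_subtractf)

lemma matrix_diff_rdistrib: "(A - B) ** C = A ** C - B ** (C :: 'a::ring_1^'n^'m)"
  by (simp add: matrix_matrix_mult_def vec_eq_iff left_diff_distrib sum_subtractf)

lemma matrix_minus_left: "(- A) ** B = - (A ** (B :: 'a::ring_1^'n^'m))"
  by (simp add: matrix_matrix_mult_def vec_eq_iff sum_negf)

lemma matrix_minus_right: "A ** (- B) = - (A ** (B :: 'a::ring_1^'n^'m))"
  by (simp add: matrix_matrix_mult_def vec_eq_iff sum_negf)

lemma matrix_zero_left [simp]: "0 ** (A :: 'a::semiring_1^'n^'m) = 0"
  by (simp add: matrix_matrix_mult_def vec_eq_iff)

lemma matrix_zero_right [simp]: "(A :: 'a::semiring_1^'n^'m) ** 0 = 0"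
  by (simp add: matrix_matrix_mult_def vec_eq_iff)

lemma mscale_mult_left: "mscale c A ** B = mscale c (A ** B)"
  by (simp add: mscale_def matrix_matrix_mult_def vec_eq_iff sum_distrib_left mult.assoc)

lemma mscale_mult_right: "A ** mscale c B = mscale c (A ** B)"
  by (simp add: mscale_def matrix_matrix_mult_def vec_eq_iff sum_distrib_left mult.left_commute)

lemma mscale_add: "mscale c (A + B) = mscale c A + mscale c B"
  by (simp add: mscale_def vec_eq_iff distrib_left)

lemma mscale_diff: "mscale c (A - B) = mscale c A - mscale c B"
  by (simp add: mscale_def vec_eq_iff right_diff_distrib)

lemma mscale_minus: "mscale c (- A) = - mscale c A"
  by (simp add: mscale_def vec_eq_iff)

lemma mscale_mscale: "mscale c (mscale d A) = mscale (c * d) A"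
  by (simp add: mscale_def vec_eq_iff mult.assoc)

lemma mscale_0 [simp]: "mscale c 0 = 0" "mscale 0 A = 0"
  by (simp_all add: mscale_def vec_eq_iff)

lemma mscale_1 [simp]: "mscale 1 A = A"
  by (simp add: mscale_def vec_eq_iff)

lemma mscale_nth [simp]: "mscale c A $ i $ j = c * A $ i $ j"
  by (simp add: mscale_def)

lemma transpose_add: "transpose (A + B) = transpose A + transpose B"
  by (simp add: transpose_def vec_eq_iff)

lemma transpose_diff: "transpose (A - B) = transpose A - transpose B"
  by (simp add: transpose_def vec_eq_iff)

lemma transpose_mscale: "transpose (mscale c A) = mscale c (transpose A)"
  by (simp add: transpose_def vec_eq_iff)

lemmas matrix_distribs =
  matrix_add_ldistrib matrix_add_rdistrib' matrix_diff_ldistrib matrix_diff_rdistrib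
  matrix_minus_left matrix_minus_right matrix_mul_lid matrix_mul_rid
  mscale_mult_left mscale_mult_right mscale_add mscale_diff mscale_minus mscale_mscale
  matrix_mul_assoc[symmetric]

lemma norm_mscale: "norm (mscale c A) = cmod c * norm A"
  by (simp add: norm_vec_def mscale_def norm_mult L2_set_right_distrib)

lemma bounded_linear_mscale: "bounded_linear (mscale c)"
  by (intro bounded_linear_intro[where K = "cmod c"])
    (auto simp: norm_mscale mult.commute[of "cmod c"] vec_eq_iff distrib_left)

lemma bounded_bilinear_matrix_mult:
  "bounded_bilinear ((**) :: 'a::{euclidean_space,real_normed_algebra_1}^'n^'m \<Rightarrow> 'a^'k^'n \<Rightarrow> 'a^'k^'m)"
  unfolding bilinear_conv_bounded_bilinear[symmetric] bilinear_def
  by (auto intro!: linearI simp: matrix_matrix_mult_def vec_eq_iff distrib_left distrib_right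
      sum.distrib scaleR_sum_right)

lemma bounded_bilinear_matrix_vector_mult:
  "bounded_bilinear ((*v) :: 'a::{euclidean_space,real_normed_algebra_1}^'n^'m \<Rightarrow> 'a^'n \<Rightarrow> 'a^'m)"
  unfolding bilinear_conv_bounded_bilinear[symmetric] bilinear_def
  by (auto intro!: linearI simp: matrix_vector_mult_def vec_eq_iff distrib_left distrib_right
      sum.distrib scaleR_sum_right)

lemma norm_entry_le: "norm (A $ i $ j) \<le> norm (A :: 'a::real_normed_vector^'n^'m)"
  using Finite_Cartesian_Product.norm_nth_le[of "A $ i" j] Finite_Cartesian_Product.norm_nth_le[of A i] by linarith

lemma matrix_inv_left: "invertible A \<Longrightarrow> matrix_inv A ** A = mat 1"
  and matrix_inv_right: "invertible A \<Longrightarrow> A ** matrix_inv A = mat 1"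
  for A :: "'a::semiring_1^'n^'n"
  unfolding invertible_def matrix_inv_def by (metis (mono_tags, lifting) someI_ex)+

lemma matrix_inv_eqI:
  fixes A :: "'a::field^'n^'n"
  assumes "A ** B = mat 1"
  shows "matrix_inv A = B"
proof -
  have BA: "B ** A = mat 1" using assms matrix_left_right_inverse by blast
  then have "invertible A" using assms by (auto simp: invertible_def)
  then show ?thesis using BA
    by (metis matrix_inv_right matrix_mul_assoc matrix_mul_lid matrix_mul_rid)
qed

lemma invertibleI: "A ** B = mat 1 \<Longrightarrow> invertible (A :: 'a::field^'n^'n)"
  using matrix_left_right_inverse by (auto simp: invertible_def)

definition dg :: "real^'n \<Rightarrow> complex^'n^'n::finite" where
  "dg v = (\<chi> k l. if k = l then complex_of_real (v $ k) else 0)"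

text \<open>The complex counterpart of \<open>connection_form\<close>: the potentials B - Q produced
  by dressing are complex matrices at the outset, and their reality is proved separately.\<close>

definition cform :: "complex^'n^'n::finite \<Rightarrow> complex \<Rightarrow> real^'n \<Rightarrow> complex^'n^'n" where
  "cform B \<mu> v = mscale \<mu> (dg v) + (dg v ** B - B ** dg v)"

lemma dg_mult_nth: "(dg v ** B) $ k $ l = complex_of_real (v $ k) * B $ k $ l"
  and mult_dg_nth: "(B ** dg v) $ k $ l = complex_of_real (v $ l) * B $ k $ l"
  by (simp_all add: dg_def matrix_matrix_mult_def if_distrib[of "\<lambda>x. x * _"] if_distrib[of "\<lambda>x. _ * x"] cong: if_cong)

lemma cform_nth: "cform B \<mu> v $ k $ l =
    (if k = l then \<mu> * complex_of_real (v $ k) else 0) + (complex_of_real (v $ k) - complex_of_real (v $ l)) * B $ k $ l"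
  by (simp add: cform_def dg_mult_nth mult_dg_nth algebra_simps) (simp add: dg_def)

lemma bounded_linear_dg: "bounded_linear (dg :: real^'n \<Rightarrow> complex^'n^'n::finite)"
  unfolding linear_conv_bounded_linear[symmetric]
  by (rule linearI) (auto simp: dg_def vec_eq_iff scaleR_conv_of_real[where 'a = complex])

lemma connection_form_eq: "connection_form B \<mu> v = cform (cmat B) \<mu> v"
proof -
  have nth: "(\<Sum>i\<in>UNIV. M i) $ k $ l = (\<Sum>i\<in>UNIV. M i $ k $ l)" for M :: "'a::finite \<Rightarrow> complex^'a^'a" and k l
    by simp
  have e1: "(elem_diag i ** C) $ k $ l = (if k = i then C $ k $ l else 0)"
    and e2: "(C ** elem_diag i) $ k $ l = (if l = i then C $ k $ l else 0)"
    for i k l and C :: "complex^'a^'a"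
    by (auto simp: elem_diag_def matrix_matrix_mult_def if_distrib[of "\<lambda>x. x * _"] if_distrib[of "\<lambda>x. _ * x"] cong: if_cong)
  have e0: "elem_diag i $ k $ l = (if k = i \<and> l = i then 1 else 0)" for i k l :: 'a
    by (simp add: elem_diag_def)
  have "connection_form B \<mu> v $ k $ l = cform (cmat B) \<mu> v $ k $ l" for k l
  proof -
    have "connection_form B \<mu> v $ k $ l =
      (\<Sum>i\<in>UNIV. (if i = k then (if k = l then complex_of_real (v $ k) * \<mu> else 0) + complex_of_real (v $ k) * cmat B $ k $ l else 0)
         - (if i = l then complex_of_real (v $ l) * cmat B $ k $ l else 0))"
      unfolding connection_form_def nth
      by (rule sum.cong) (auto simp: e0 e1 e2 scaleR_conv_of_real[where 'a = complex] algebra_simps)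
    also have "\<dots> = cform (cmat B) \<mu> v $ k $ l"
      by (simp add: sum_subtractf cform_nth algebra_simps)
    finally show ?thesis .
  qed
  then show ?thesis by (simp add: vec_eq_iff)
qed

text \<open>The form is linear in the pair of B and \<mu>, so a bound for it is at once a Lipschitz
  bound. The limits in \<mu> need the connection controlled in this uniform way.\<close>

lemma norm_cform_diff_le:
  "\<exists>K>0. \<forall>B \<mu> B' \<mu>' (v :: real^'n::finite).
    norm (cform B \<mu> v - cform B' \<mu>' v) \<le> K * (cmod (\<mu> - \<mu>') + norm (B - B')) * norm v"
proof -
  obtain K1 where K1: "K1 > 0" "\<And>v :: real^'n. norm (dg v) \<le> norm v * K1"
    using bounded_linear.pos_bounded[OF bounded_linear_dg] by blast
  obtain K2 where K2: "K2 > 0" "\<And>(A::complex^'n^'n) (B::complex^'n^'n). norm (A ** B) \<le> norm A * norm B * K2"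
    using bounded_bilinear.pos_bounded[OF bounded_bilinear_matrix_mult] by blast
  define K where "K = K1 + 2 * K1 * K2"
  have K: "K > 0" using K1 K2 by (simp add: K_def add_pos_pos)
  have bd: "norm (cform B \<mu> v) \<le> K * (cmod \<mu> + norm B) * norm v" for B \<mu> and v :: "real^'n"
  proof -
    have "norm (cform B \<mu> v) \<le> cmod \<mu> * norm (dg v) + (norm (dg v ** B) + norm (B ** dg v))"
      unfolding cform_def using norm_triangle_ineq4[of "dg v ** B" "B ** dg v"]
      by (intro norm_triangle_le) (simp add: norm_mscale)
    also have "\<dots> \<le> cmod \<mu> * (norm v * K1) + (norm v * K1 * norm B * K2 + norm B * (norm v * K1) * K2)"
    proof (intro add_mono)
      show "norm (dg v ** B) \<le> norm v * K1 * norm B * K2"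
        using order_trans[OF K2(2) mult_right_mono[OF mult_right_mono[OF K1(2)]]] K2(1) by simp
      show "norm (B ** dg v) \<le> norm B * (norm v * K1) * K2"
        using order_trans[OF K2(2) mult_right_mono[OF mult_left_mono[OF K1(2)]]] K2(1) by simp
      show "cmod \<mu> * norm (dg v) \<le> cmod \<mu> * (norm v * K1)"
        using K1(2) by (intro mult_left_mono) auto
    qed
    also have "\<dots> \<le> K * (cmod \<mu> + norm B) * norm v"
      using K1(1) K2(1) unfolding K_def by (simp add: algebra_simps)
    finally show ?thesis .
  qed
  have "cform B \<mu> v - cform B' \<mu>' v = cform (B - B') (\<mu> - \<mu>') v" for B B' \<mu> \<mu>' and v :: "real^'n"
    by (simp add: vec_eq_iff cform_nth algebra_simps)
  then show ?thesis using K bd by (intro exI[of _ K]) simp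
qed

lemma bounded_linear_cform: "bounded_linear (cform B \<mu>)"
  unfolding linear_conv_bounded_linear[symmetric]
  by (rule linearI) (auto simp: vec_eq_iff cform_nth scaleR_conv_of_real[where 'a = complex] algebra_simps)

text \<open>Everything follows from F(y)^-1 - F(x)^-1 = - F(y)^-1 (F(y) - F(x)) F(x)^-1. Used on
  norms it shows that the inverse stays bounded near x, hence is continuous there; continuity then
  gives the derivative.\<close>

lemma has_derivative_matrix_inv:
  fixes F :: "'x::real_normed_vector \<Rightarrow> complex^'n^'n::finite"
  assumes F: "(F has_derivative D) (at x)" and U: "open U" "x \<in> U" and inv: "\<And>y. y \<in> U \<Longrightarrow> invertible (F y)"
  shows "((\<lambda>y. matrix_inv (F y)) has_derivative
    (\<lambda>v. - (matrix_inv (F x) ** D v ** matrix_inv (F x)))) (at x)"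
proof -
  let ?I = "\<lambda>y. matrix_inv (F y)"
  obtain K where K: "K > 0" "\<And>(A::complex^'n^'n) (B::complex^'n^'n). norm (A ** B) \<le> norm A * norm B * K"
    using bounded_bilinear.pos_bounded[OF bounded_bilinear_matrix_mult] by blast
  have id: "?I y = ?I x - ?I y ** (F y - F x) ** ?I x" if "y \<in> U" for y
  proof -
    have "?I y ** (F y - F x) ** ?I x = (?I y ** F y) ** ?I x - ?I y ** (F x ** ?I x)"
      by (simp add: matrix_diff_ldistrib matrix_diff_rdistrib matrix_mul_assoc)
    then show ?thesis
      by (simp add: matrix_inv_left[OF inv[OF that]] matrix_inv_right[OF inv[OF U(2)]])
  qed
  have contF: "(F \<longlongrightarrow> F x) (at x)"
    using has_derivative_continuous[OF F] by (simp add: continuous_at isCont_def)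
  have ev: "eventually (\<lambda>y. y \<in> U) (at x)"
    using U by (simp add: eventually_at_topological) blast
  have lim: "(?I \<longlongrightarrow> ?I x) (at x)"
  proof -
    define c where "c = norm (?I x)"
    have t0: "((\<lambda>y. norm (F y - F x) * c * K * K) \<longlongrightarrow> 0) (at x)"
      using contF by (auto intro!: tendsto_eq_intros)
    \<comment> \<open>Below 1/2 the identity gives |F(y)^-1| <= c + |F(y)^-1|/2, so the unknown norm
      is absorbed and bounded by 2c.\<close>
    then have small: "eventually (\<lambda>y. norm (F y - F x) * c * K * K < 1/2) (at x)"
      by (rule order_tendstoD) simp
    have bound: "norm (?I y) \<le> 2 * c \<and> norm (?I y - ?I x) \<le> 2 * c * (norm (F y - F x) * c * K * K)"
      if "y \<in> U" "norm (F y - F x) * c * K * K < 1/2" for y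
    proof -
      have "norm (?I y ** (F y - F x) ** ?I x) \<le> norm (?I y ** (F y - F x)) * c * K"
        using K(2) by (simp add: c_def)
      also have "\<dots> \<le> norm (?I y) * norm (F y - F x) * K * c * K"
        using K by (intro mult_right_mono) (auto simp: c_def)
      finally have 1: "norm (?I y ** (F y - F x) ** ?I x) \<le> norm (?I y) * (norm (F y - F x) * c * K * K)"
        by (simp add: mult_ac)
      have "norm (?I y) * (norm (F y - F x) * c * K * K) \<le> norm (?I y) * (1/2)"
        using that by (intro mult_left_mono) auto
      then have "norm (?I y) \<le> c + norm (?I y) * (1/2)"
        using id[OF that(1)] 1 norm_triangle_ineq4[of "?I x" "?I y ** (F y - F x) ** ?I x"]
        unfolding c_def by simp
      then have 2: "norm (?I y) \<le> 2 * c" by simp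
      have "?I y - ?I x = - (?I y ** (F y - F x) ** ?I x)"
        using id[OF that(1)] by (simp add: algebra_simps)
      then have "norm (?I y - ?I x) \<le> norm (?I y) * (norm (F y - F x) * c * K * K)"
        using 1 by simp
      also have "\<dots> \<le> 2 * c * (norm (F y - F x) * c * K * K)"
        using 2 K(1) by (intro mult_right_mono) (auto simp: c_def)
      finally show ?thesis using 2 by simp
    qed
    have "((\<lambda>y. ?I y - ?I x) \<longlongrightarrow> 0) (at x)"
    proof (rule Lim_null_comparison)
      show "\<forall>\<^sub>F y in at x. norm (?I y - ?I x) \<le> 2 * c * (norm (F y - F x) * c * K * K)"
        using ev small by eventually_elim (use bound in blast)
      show "((\<lambda>y. 2 * c * (norm (F y - F x) * c * K * K)) \<longlongrightarrow> 0) (at x)"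
        using tendsto_mult_right_zero[OF t0] .
    qed
    then show ?thesis by (simp add: Lim_null[symmetric])
  qed
  have G: "((\<lambda>y. ?I x - ?I y ** (F y - F x) ** ?I x) has_derivative
    (\<lambda>v. - (?I x ** D v ** ?I x))) (at x)"
  proof -
    note L1 = bounded_bilinear.bounded_linear_left[OF bounded_bilinear_matrix_mult]
    \<comment> \<open>The second factor vanishes at x, so continuity of the inverse at x suffices to
      differentiate this product.\<close>
    have "((\<lambda>y. ?I y ** (F y - F x)) has_derivative (\<lambda>v. ?I x ** D v)) (at x)"
    proof -
      have blD: "bounded_linear (\<lambda>v. ?I x ** D v)"
        using bounded_linear_compose[OF bounded_bilinear.bounded_linear_right[OF bounded_bilinear_matrix_mult] has_derivative_bounded_linear[OF F]] .
      let ?q = "\<lambda>h. (F (x + h) - F x - D h) /\<^sub>R norm h"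
      have q0: "(?q \<longlongrightarrow> 0) (at 0)"
        using F unfolding has_derivative_at by (simp add: tendsto_norm_zero_iff[symmetric, of ?q] divide_inverse mult.commute)
      obtain KD where KD: "KD > 0" "\<And>v. norm (D v) \<le> norm v * KD"
        using bounded_linear.pos_bounded[OF has_derivative_bounded_linear[OF F]] by blast
      have limh: "((\<lambda>h. ?I (x + h)) \<longlongrightarrow> ?I x) (at 0)"
        using lim by (subst (asm) LIM_offset_zero_iff) auto
      have "((\<lambda>h. ?I (x + h) ** ?q h) \<longlongrightarrow> 0) (at 0)"
        using bounded_bilinear.tendsto[OF bounded_bilinear_matrix_mult limh q0] by simp
      moreover have "((\<lambda>h. (?I (x + h) - ?I x) ** (D h /\<^sub>R norm h)) \<longlongrightarrow> 0) (at 0)"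
      proof (rule Lim_null_comparison)
        show "((\<lambda>h. norm (?I (x + h) - ?I x) * KD * K) \<longlongrightarrow> 0) (at 0)"
          using limh by (auto intro!: tendsto_eq_intros)
        have nb: "norm (D h /\<^sub>R norm h) \<le> KD" for h
          using KD by (cases "h = 0") (auto simp: field_simps)
        show "\<forall>\<^sub>F h in at 0. norm ((?I (x + h) - ?I x) ** (D h /\<^sub>R norm h)) \<le> norm (?I (x + h) - ?I x) * KD * K"
          using K nb by (intro always_eventually allI order_trans[OF K(2)] mult_right_mono mult_left_mono) auto
      qed
      ultimately have "((\<lambda>h. ?I (x + h) ** ?q h + (?I (x + h) - ?I x) ** (D h /\<^sub>R norm h)) \<longlongrightarrow> 0 + 0) (at 0)"
        by (rule tendsto_add)
      moreover have "?I (x + h) ** ?q h + (?I (x + h) - ?I x) ** (D h /\<^sub>R norm h)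
        = (?I (x + h) ** (F (x + h) - F x) - ?I x ** (F x - F x) - ?I x ** D h) /\<^sub>R norm h" for h
        by (simp add: bounded_bilinear.scaleR_right[OF bounded_bilinear_matrix_mult] matrix_distribs scaleR_diff_right)
      ultimately have "((\<lambda>h. (?I (x + h) ** (F (x + h) - F x) - ?I x ** (F x - F x) - ?I x ** D h) /\<^sub>R norm h) \<longlongrightarrow> 0) (at 0)"
        by simp
      from tendsto_norm_zero[OF this] show ?thesis
        unfolding has_derivative_at using blD by (simp add: divide_inverse mult.commute)
    qed
    from has_derivative_diff[OF has_derivative_const[of "?I x"] bounded_linear.has_derivative[OF L1 this, of "?I x"]]
    show ?thesis by simp
  qed
  show ?thesis
    by (rule has_derivative_transform_within_open[OF G U]) (rule id[symmetric])
qed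

section \<open>Linear differential equations depending on a parameter\<close>

lemma mvt_bound_unit:
  fixes f :: "real \<Rightarrow> 'b::real_normed_vector"
  assumes "\<And>t. t \<in> {0..1} \<Longrightarrow> (f has_vector_derivative f' t) (at t within {0..1})"
    and "\<And>t. t \<in> {0..1} \<Longrightarrow> norm (f' t) \<le> B" and "s \<in> {0..1}"
  shows "norm (f s - f 0) \<le> B"
proof -
  have B: "B \<ge> 0" using order_trans[OF norm_ge_zero assms(2)[of 0]] by simp
  have "norm (f s - f 0) \<le> B * norm (s - 0)"
  proof (rule differentiable_bound[of "{0..1}" f "\<lambda>t h. h *\<^sub>R f' t"])
    show "(f has_derivative (\<lambda>h. h *\<^sub>R f' t)) (at t within {0..1})" if "t \<in> {0..1}" for t
      using assms(1)[OF that] by (simp add: has_vector_derivative_def)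
    show "onorm (\<lambda>h. h *\<^sub>R f' t) \<le> B" if "t \<in> {0..1}" for t
    proof (rule onorm_le)
      show "norm (h *\<^sub>R f' t) \<le> B * norm h" for h
        using mult_left_mono[OF assms(2)[OF that], of "\<bar>h\<bar>"] by (simp add: mult.commute)
    qed
  qed (use assms(3) in auto)
  also have "\<dots> \<le> B * 1" using assms(3) B by (intro mult_left_mono) auto
  finally show ?thesis by simp
qed

lemma has_vector_derivative_along_segment:
  assumes "(f has_derivative D) (at (p + t *\<^sub>R v))"
  shows "((\<lambda>t. f (p + t *\<^sub>R v)) has_vector_derivative D v) (at t within T)"
proof -
  have "((\<lambda>t. p + t *\<^sub>R v) has_derivative (\<lambda>h. h *\<^sub>R v)) (at t within T)"
    by (auto intro!: derivative_eq_intros)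
  from has_derivative_compose[OF this assms] show ?thesis
    by (simp add: has_vector_derivative_def linear_scale[OF has_derivative_linear[OF assms]])
qed

text \<open>An a priori estimate from the mean value inequality replaces Gronwall's lemma here: on short
  segments the maximum of a solution is at most twice its initial value.\<close>

lemma has_derivative_limit_linear_ode:
  fixes F :: "'a::real_normed_vector \<Rightarrow> complex \<Rightarrow> 'b::real_normed_vector"
    and L :: "'a \<Rightarrow> complex \<Rightarrow> 'a \<Rightarrow> 'b \<Rightarrow> 'b"
  assumes r: "r > 0" and C: "C > 0"
    and der: "\<And>x \<mu>. x \<in> ball x0 r \<Longrightarrow> \<mu> \<noteq> \<mu>0 \<Longrightarrow> dist \<mu> \<mu>0 < 1 \<Longrightarrow>
        ((\<lambda>y. F y \<mu>) has_derivative (\<lambda>v. L x \<mu> v (F x \<mu>))) (at x)"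
    and bound: "\<And>x \<mu> v w. x \<in> ball x0 r \<Longrightarrow> dist \<mu> \<mu>0 < 1 \<Longrightarrow> norm (L x \<mu> v w) \<le> C * norm v * norm w"
    and lin: "\<And>x \<mu> v w w'. L x \<mu> v (w - w') = L x \<mu> v w - L x \<mu> v w'"
    and linv: "\<And>w. bounded_linear (\<lambda>v. L x0 \<mu>0 v w)"
    and linw: "\<And>v. bounded_linear (\<lambda>w. L x0 \<mu>0 v w)"
    and lim: "\<And>e. e > 0 \<Longrightarrow> \<exists>d>0. \<forall>x \<mu> v w. dist x0 x < d \<longrightarrow> dist \<mu> \<mu>0 < d \<longrightarrow>
        norm (L x \<mu> v w - L x0 \<mu>0 v w) \<le> e * norm v * norm w"
    and pt: "\<And>x. x \<in> ball x0 r \<Longrightarrow> ((F x) \<longlongrightarrow> F x \<mu>0) (at \<mu>0)"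
  shows "((\<lambda>y. F y \<mu>0) has_derivative (\<lambda>v. L x0 \<mu>0 v (F x0 \<mu>0))) (at x0)"
proof -
  have dist_add: "dist x0 (x0 + w) = norm w" for w by (simp add: dist_norm)
  \<comment> \<open>A first-order remainder whose constants do not depend on \<mu>. It is proved for
    \<mu> different from \<mu>0, where the equation is known, and survives the pointwise
    limit.\<close>
  have est: "norm (F (x0 + v) \<mu> - F x0 \<mu> - L x0 \<mu>0 v (F x0 \<mu>)) \<le> (2 * C * C * norm v + e) * norm v * norm (F x0 \<mu>)"
    if v: "norm v < r" "C * norm v \<le> 1/2" and \<mu>: "\<mu> \<noteq> \<mu>0" "dist \<mu> \<mu>0 < 1"
      and e: "\<And>x w. dist x0 x \<le> norm v \<Longrightarrow> norm (L x \<mu> v w - L x0 \<mu>0 v w) \<le> e * norm v * norm w"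
    for v \<mu> e
  proof -
    define f where "f t = F (x0 + t *\<^sub>R v) \<mu>" for t
    let ?J = "{0..1} :: real set"
    have tv: "norm (t *\<^sub>R v) \<le> norm v" if "t \<in> ?J" for t
      using that mult_right_mono[of t 1 "norm v"] by simp
    have inb: "x0 + t *\<^sub>R v \<in> ball x0 r" if "t \<in> ?J" for t
      using tv[OF that] v dist_add by simp
    have fd: "(f has_vector_derivative L (x0 + t *\<^sub>R v) \<mu> v (f t)) (at t within ?J)" if "t \<in> ?J" for t
      unfolding f_def by (rule has_vector_derivative_along_segment[OF der[OF inb[OF that] \<mu>]])
    have "continuous_on ?J (\<lambda>t. norm (f t))"
      using fd by (intro continuous_on_norm) (meson continuous_on_eq_continuous_within has_vector_derivative_continuous)
    then obtain t0 where t0: "t0 \<in> ?J" "\<And>t. t \<in> ?J \<Longrightarrow> norm (f t) \<le> norm (f t0)"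
      using continuous_attains_sup[of ?J "\<lambda>t. norm (f t)"] by auto
    have d1: "norm (f s - f 0) \<le> C * norm v * norm (f t0)" if "s \<in> ?J" for s
    proof (rule mvt_bound_unit[OF fd _ that])
      show "norm (L (x0 + t *\<^sub>R v) \<mu> v (f t)) \<le> C * norm v * norm (f t0)" if "t \<in> ?J" for t
        using order_trans[OF bound[OF inb[OF that] \<mu>(2)] mult_left_mono[OF t0(2)[OF that]]] C by simp
    qed
    have "C * norm v * norm (f t0) \<le> 1/2 * norm (f t0)"
      using v by (intro mult_right_mono) auto
    then have m: "norm (f t0) \<le> 2 * norm (f 0)"
      using d1[OF t0(1)] norm_triangle_ineq2[of "f t0" "f 0"] by simp
    have d2: "norm (f s - f 0) \<le> C * norm v * (2 * norm (f 0))" if "s \<in> ?J" for s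
      using order_trans[OF d1[OF that] mult_left_mono[OF m]] C by simp
    let ?c = "L x0 \<mu>0 v (f 0)"
    define g where "g t = f t - t *\<^sub>R ?c" for t
    have "norm (g 1 - g 0) \<le> (2 * C * C * norm v + e) * norm v * norm (f 0)"
    proof (rule mvt_bound_unit)
      show "(g has_vector_derivative L (x0 + t *\<^sub>R v) \<mu> v (f t) - ?c) (at t within ?J)" if "t \<in> ?J" for t
        unfolding g_def using fd[OF that]
        by (auto intro!: derivative_eq_intros simp: has_vector_derivative_def algebra_simps)
      show "norm (L (x0 + t *\<^sub>R v) \<mu> v (f t) - ?c) \<le> (2 * C * C * norm v + e) * norm v * norm (f 0)" if "t \<in> ?J" for t
      proof -
        let ?x = "x0 + t *\<^sub>R v"
        have "norm (L ?x \<mu> v (f t - f 0)) \<le> C * norm v * (C * norm v * (2 * norm (f 0)))"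
          using order_trans[OF bound[OF inb[OF that] \<mu>(2)] mult_left_mono[OF d2[OF that]]] C by simp
        moreover have "norm (L ?x \<mu> v (f 0) - ?c) \<le> e * norm v * norm (f 0)"
          using e tv[OF that] dist_add by simp
        moreover have "L ?x \<mu> v (f t) - ?c = L ?x \<mu> v (f t - f 0) + (L ?x \<mu> v (f 0) - ?c)"
          by (simp add: lin)
        ultimately show ?thesis
          using norm_triangle_ineq[of "L ?x \<mu> v (f t - f 0)" "L ?x \<mu> v (f 0) - ?c"]
          by (simp add: algebra_simps)
      qed
    qed auto
    then show ?thesis by (simp add: g_def f_def algebra_simps)
  qed
  have est0: "norm (F (x0 + v) \<mu>0 - F x0 \<mu>0 - L x0 \<mu>0 v (F x0 \<mu>0)) \<le> (2 * C * C * norm v + e) * norm v * norm (F x0 \<mu>0)"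
    if v: "norm v < r" "C * norm v \<le> 1/2" and d: "d > 0" "norm v < d"
      and e: "\<And>x \<mu> v w. dist x0 x < d \<Longrightarrow> dist \<mu> \<mu>0 < d \<Longrightarrow> norm (L x \<mu> v w - L x0 \<mu>0 v w) \<le> e * norm v * norm w"
    for v e d
  proof (rule tendsto_le[OF trivial_limit_at])
    have l0: "((F x0) \<longlongrightarrow> F x0 \<mu>0) (at \<mu>0)" and l1: "((F (x0 + v)) \<longlongrightarrow> F (x0 + v) \<mu>0) (at \<mu>0)"
      using pt r v dist_add by auto
    show "((\<lambda>\<mu>. (2 * C * C * norm v + e) * norm v * norm (F x0 \<mu>)) \<longlongrightarrow> (2 * C * C * norm v + e) * norm v * norm (F x0 \<mu>0)) (at \<mu>0)"
      by (intro tendsto_intros l0)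
    show "((\<lambda>\<mu>. norm (F (x0 + v) \<mu> - F x0 \<mu> - L x0 \<mu>0 v (F x0 \<mu>))) \<longlongrightarrow>
        norm (F (x0 + v) \<mu>0 - F x0 \<mu>0 - L x0 \<mu>0 v (F x0 \<mu>0))) (at \<mu>0)"
      by (intro tendsto_norm tendsto_diff l0 l1 bounded_linear.tendsto[OF linw])
    have "\<forall>\<^sub>F \<mu> in at \<mu>0. \<mu> \<noteq> \<mu>0 \<and> dist \<mu> \<mu>0 < min 1 d"
      using d unfolding eventually_at by (intro exI[of _ "min 1 d"]) auto
    then show "\<forall>\<^sub>F \<mu> in at \<mu>0. norm (F (x0 + v) \<mu> - F x0 \<mu> - L x0 \<mu>0 v (F x0 \<mu>))
        \<le> (2 * C * C * norm v + e) * norm v * norm (F x0 \<mu>)"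
    proof eventually_elim
      case (elim \<mu>)
      then show ?case using v d e by (intro est) auto
    qed
  qed
  show ?thesis
    unfolding has_derivative_at_alt
  proof (intro conjI linv allI impI)
    fix e :: real assume e: "e > 0"
    \<comment> \<open>The summand 1 keeps M positive even if \<open>F x0 \<mu>0\<close> vanishes.
      The radius d' makes both errors, 2 C^2 |v| and the oscillation of L, at most e/(2M).\<close>
    define M where "M = norm (F x0 \<mu>0) + 1"
    have M: "M > 0" by (simp add: M_def add_nonneg_pos)
    obtain d where d: "d > 0" "\<forall>x \<mu> v w. dist x0 x < d \<longrightarrow> dist \<mu> \<mu>0 < d \<longrightarrow>
        norm (L x \<mu> v w - L x0 \<mu>0 v w) \<le> (e / (2 * M)) * norm v * norm w"
      using lim[of "e / (2 * M)"] e M by auto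
    define d' where "d' = Min {d, r, 1 / (2 * C), e / (4 * C * C * M)}"
    have d': "d' > 0" "d' \<le> d" "d' \<le> r" "d' \<le> 1 / (2 * C)" "d' \<le> e / (4 * C * C * M)"
      using d r C e M by (auto simp: d'_def)
    show "\<exists>d>0. \<forall>y. norm (y - x0) < d \<longrightarrow>
        norm (F y \<mu>0 - F x0 \<mu>0 - L x0 \<mu>0 (y - x0) (F x0 \<mu>0)) \<le> e * norm (y - x0)"
    proof (intro exI[of _ d'] conjI d' allI impI)
      fix y assume y: "norm (y - x0) < d'"
      let ?v = "y - x0"
      have "C * norm ?v \<le> 1/2"
      proof -
        have "C * norm ?v \<le> C * d'" using y C by (intro mult_left_mono) auto
        also have "\<dots> \<le> 1/2" using d'(4) C by (simp add: field_simps)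
        finally show ?thesis .
      qed
      then have "norm (F (x0 + ?v) \<mu>0 - F x0 \<mu>0 - L x0 \<mu>0 ?v (F x0 \<mu>0))
          \<le> (2 * C * C * norm ?v + e / (2 * M)) * norm ?v * norm (F x0 \<mu>0)"
        using y d' d by (intro est0[of ?v d]) auto
      also have "\<dots> = norm ?v * ((2 * C * C * norm ?v + e / (2 * M)) * norm (F x0 \<mu>0))"
        by simp
      also have "\<dots> \<le> norm ?v * ((e / (2 * M) + e / (2 * M)) * M)"
      proof (intro mult_left_mono mult_mono add_right_mono)
        have "2 * C * C * norm ?v \<le> 2 * C * C * (e / (4 * C * C * M))"
          using y d'(5) C by (intro mult_left_mono) auto
        also have "\<dots> = e / (2 * M)" using C M by (simp add: field_simps)
        finally show "2 * C * C * norm ?v \<le> e / (2 * M)" .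
      qed (use e M in \<open>auto simp: M_def\<close>)
      also have "\<dots> = e * norm ?v" using M by (simp add: field_simps)
      finally show "norm (F y \<mu>0 - F x0 \<mu>0 - L x0 \<mu>0 ?v (F x0 \<mu>0)) \<le> e * norm ?v" by simp
    qed
  qed
qed

text \<open>Variation of constants around \<mu>0. Since Zi is the inverse of the solution for
  \<mu>0, the product G of Y \<mu> with Zi starts at the identity and satisfies G' = (\<mu> -
  \<mu>0) G \<Omega>, with \<Omega> the conjugate of \<Delta> by that solution. Hence G - 1 is of
  first order in \<mu> - \<mu>0; inserting this into the equation exhibits the derivative of G up to
  a quadratic error. Continuity of Y in \<mu> is not presupposed.\<close>

lemma field_differentiable_parameter:
  fixes Y :: "complex \<Rightarrow> real \<Rightarrow> complex^'n^'n::finite"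
  assumes Y: "\<And>\<mu> t. t \<in> {0..1} \<Longrightarrow> (Y \<mu> has_vector_derivative Y \<mu> t ** (A t + mscale (\<mu> - \<mu>0) \<Delta>)) (at t within {0..1})"
    and Zi: "\<And>t. t \<in> {0..1} \<Longrightarrow> (Zi has_vector_derivative - (A t ** Zi t)) (at t within {0..1})"
    and Zinv: "\<And>t. t \<in> {0..1} \<Longrightarrow> Zi t ** Y \<mu>0 t = mat 1"
    and Y0: "\<And>\<mu>. Y \<mu> 0 ** Zi 0 = mat 1"
  shows "(\<lambda>\<mu>. Y \<mu> 1 $ i $ j) field_differentiable (at \<mu>0)"
proof -
  let ?J = "{0..1} :: real set"
  note bb = bounded_bilinear_matrix_mult
  obtain K where K: "K > 0" "\<And>(A::complex^'n^'n) (B::complex^'n^'n). norm (A ** B) \<le> norm A * norm B * K"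
    using bounded_bilinear.pos_bounded[OF bb] by blast
  define \<Omega> where "\<Omega> t = Y \<mu>0 t ** \<Delta> ** Zi t" for t
  define G where "G \<mu> t = Y \<mu> t ** Zi t" for \<mu> t
  have contY: "continuous_on ?J (Y \<mu>)" for \<mu>
    using Y by (meson continuous_on_eq_continuous_within has_vector_derivative_continuous)
  have contZi: "continuous_on ?J Zi"
    using Zi by (meson continuous_on_eq_continuous_within has_vector_derivative_continuous)
  have cont\<Omega>: "continuous_on ?J \<Omega>" unfolding \<Omega>_def
    by (intro bounded_bilinear.continuous_on[OF bb] contY contZi continuous_on_const)
  have contG: "continuous_on ?J (G \<mu>)" for \<mu> unfolding G_def
    by (intro bounded_bilinear.continuous_on[OF bb] contY contZi)
  have G0: "G \<mu> 0 = mat 1" for \<mu> by (simp add: G_def Y0)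
  have G': "(G \<mu> has_vector_derivative mscale (\<mu> - \<mu>0) (G \<mu> t ** \<Omega> t)) (at t within ?J)" if t: "t \<in> ?J" for \<mu> t
  proof -
    have "Zi t ** (Y \<mu>0 t ** X) = X" for X :: "complex^'n^'n"
      using Zinv[OF t] by (simp add: matrix_mul_assoc)
    then have "mscale (\<mu> - \<mu>0) (G \<mu> t ** \<Omega> t) = Y \<mu> t ** - (A t ** Zi t) + Y \<mu> t ** (A t + mscale (\<mu> - \<mu>0) \<Delta>) ** Zi t"
      by (simp add: G_def \<Omega>_def matrix_distribs)
    then show ?thesis
      unfolding G_def using bounded_bilinear.has_vector_derivative[OF bb Y[OF t, of \<mu>] Zi[OF t]] by simp
  qed
  obtain t1 where t1: "t1 \<in> ?J" "\<And>t. t \<in> ?J \<Longrightarrow> norm (\<Omega> t) \<le> norm (\<Omega> t1)"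
    using continuous_attains_sup[of ?J "\<lambda>t. norm (\<Omega> t)"] continuous_on_norm[OF cont\<Omega>] by auto
  define c where "c = norm (\<Omega> t1) * K + 1"
  have c: "c > 0" using K by (simp add: c_def add_nonneg_pos)
  have \<Omega>c: "norm (A ** \<Omega> t) \<le> c * norm A" if "t \<in> ?J" for A :: "complex^'n^'n" and t
  proof -
    have "norm (A ** \<Omega> t) \<le> norm A * norm (\<Omega> t) * K" by (rule K(2))
    also have "\<dots> \<le> norm A * norm (\<Omega> t1) * K"
      using t1(2)[OF that] K by (intro mult_right_mono mult_left_mono) auto
    also have "\<dots> \<le> c * norm A" by (simp add: c_def algebra_simps)
    finally show ?thesis .
  qed
  define I where "I = norm (mat 1 :: complex^'n^'n)"
  have small: "norm (G \<mu> t - mat 1) \<le> 2 * c * I * cmod (\<mu> - \<mu>0)"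
    if \<mu>: "cmod (\<mu> - \<mu>0) * c \<le> 1/2" and t: "t \<in> ?J" for \<mu> t
  proof -
    obtain t0 where t0: "t0 \<in> ?J" "\<And>t. t \<in> ?J \<Longrightarrow> norm (G \<mu> t) \<le> norm (G \<mu> t0)"
      using continuous_attains_sup[of ?J "\<lambda>t. norm (G \<mu> t)"] continuous_on_norm[OF contG[of \<mu>]] by auto
    have d: "norm (G \<mu> s - G \<mu> 0) \<le> cmod (\<mu> - \<mu>0) * (c * norm (G \<mu> t0))" if "s \<in> ?J" for s
    proof (rule mvt_bound_unit[OF G' _ that])
      show "norm (mscale (\<mu> - \<mu>0) (G \<mu> t ** \<Omega> t)) \<le> cmod (\<mu> - \<mu>0) * (c * norm (G \<mu> t0))" if "t \<in> ?J" for t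
        unfolding norm_mscale
        using order_trans[OF \<Omega>c[OF that] mult_left_mono[OF t0(2)[OF that]]] c by (intro mult_left_mono) auto
    qed
    have "cmod (\<mu> - \<mu>0) * c * norm (G \<mu> t0) \<le> 1/2 * norm (G \<mu> t0)"
      using \<mu> by (intro mult_right_mono) auto
    then have "norm (G \<mu> t0) \<le> 2 * I"
      using d[OF t0(1)] norm_triangle_ineq2[of "G \<mu> t0" "G \<mu> 0"] by (simp add: G0 I_def mult.assoc)
    then have "cmod (\<mu> - \<mu>0) * (c * norm (G \<mu> t0)) \<le> cmod (\<mu> - \<mu>0) * (c * (2 * I))"
      using c by (intro mult_left_mono) auto
    then show ?thesis using d[OF t] by (simp add: G0 mult_ac)
  qed
  \<comment> \<open>The integral of \<Omega> is the first-order term of G in \<mu> - \<mu>0, so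
    \<open>P 1\<close> is the derivative of G at the end point.\<close>
  define P where "P t = integral {0..t} \<Omega>" for t
  have P': "(P has_vector_derivative \<Omega> t) (at t within ?J)" if "t \<in> ?J" for t
    unfolding P_def by (rule integral_has_vector_derivative[OF cont\<Omega> that])
  have P0: "P 0 = 0" by (simp add: P_def)
  define C where "C = c * (2 * c * I)"
  have quad: "norm (G \<mu> 1 - mat 1 - mscale (\<mu> - \<mu>0) (P 1)) \<le> C * cmod (\<mu> - \<mu>0) * cmod (\<mu> - \<mu>0)"
    if \<mu>: "cmod (\<mu> - \<mu>0) * c \<le> 1/2" for \<mu>
  proof -
    define H where "H t = G \<mu> t - mscale (\<mu> - \<mu>0) (P t)" for t
    have "norm (H 1 - H 0) \<le> C * cmod (\<mu> - \<mu>0) * cmod (\<mu> - \<mu>0)"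
    proof (rule mvt_bound_unit)
      fix t :: real assume t: "t \<in> ?J"
      show "(H has_vector_derivative mscale (\<mu> - \<mu>0) ((G \<mu> t - mat 1) ** \<Omega> t)) (at t within ?J)"
        unfolding H_def matrix_diff_rdistrib mscale_diff matrix_mul_lid
        by (intro has_vector_derivative_diff G' t bounded_linear.has_vector_derivative[OF bounded_linear_mscale] P')
      have "norm ((G \<mu> t - mat 1) ** \<Omega> t) \<le> c * (2 * c * I * cmod (\<mu> - \<mu>0))"
        using order_trans[OF \<Omega>c[OF t] mult_left_mono[OF small[OF \<mu> t]]] c by simp
      then have "cmod (\<mu> - \<mu>0) * norm ((G \<mu> t - mat 1) ** \<Omega> t) \<le> cmod (\<mu> - \<mu>0) * (c * (2 * c * I * cmod (\<mu> - \<mu>0)))"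
        by (intro mult_left_mono) auto
      then show "norm (mscale (\<mu> - \<mu>0) ((G \<mu> t - mat 1) ** \<Omega> t)) \<le> C * cmod (\<mu> - \<mu>0) * cmod (\<mu> - \<mu>0)"
        unfolding norm_mscale C_def by (simp add: mult_ac)
    qed auto
    then show ?thesis by (simp add: H_def P0 G0 algebra_simps)
  qed
  have Gder: "((\<lambda>\<mu>. G \<mu> 1 $ k $ l) has_field_derivative P 1 $ k $ l) (at \<mu>0)" for k l
  proof -
    have Gm: "G \<mu>0 1 = mat 1" using quad[of \<mu>0] by simp
    have "((\<lambda>\<mu>. (G \<mu> 1 $ k $ l - G \<mu>0 1 $ k $ l) / (\<mu> - \<mu>0) - P 1 $ k $ l) \<longlongrightarrow> 0) (at \<mu>0)"
    proof (rule Lim_null_comparison)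
      have "\<forall>\<^sub>F \<mu> in at \<mu>0. \<mu> \<noteq> \<mu>0 \<and> dist \<mu> \<mu>0 < 1 / (2 * c)"
        using c unfolding eventually_at by (intro exI[of _ "1 / (2 * c)"]) auto
      then show "\<forall>\<^sub>F \<mu> in at \<mu>0. norm ((G \<mu> 1 $ k $ l - G \<mu>0 1 $ k $ l) / (\<mu> - \<mu>0) - P 1 $ k $ l) \<le> C * cmod (\<mu> - \<mu>0)"
      proof eventually_elim
        case (elim \<mu>)
        then have \<mu>: "cmod (\<mu> - \<mu>0) * c \<le> 1/2" "\<mu> \<noteq> \<mu>0"
          using c by (auto simp: dist_norm field_simps)
        have "(G \<mu> 1 $ k $ l - G \<mu>0 1 $ k $ l) / (\<mu> - \<mu>0) - P 1 $ k $ l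
          = (G \<mu> 1 - mat 1 - mscale (\<mu> - \<mu>0) (P 1)) $ k $ l / (\<mu> - \<mu>0)"
          using \<mu> by (simp add: Gm field_simps)
        also have "norm \<dots> \<le> C * cmod (\<mu> - \<mu>0) * cmod (\<mu> - \<mu>0) / cmod (\<mu> - \<mu>0)"
          unfolding norm_divide
          by (intro divide_right_mono order_trans[OF norm_entry_le quad[OF \<mu>(1)]]) auto
        also have "\<dots> = C * cmod (\<mu> - \<mu>0)" using \<mu> by simp
        finally show ?case .
      qed
      show "((\<lambda>\<mu>. C * cmod (\<mu> - \<mu>0)) \<longlongrightarrow> 0) (at \<mu>0)"
        by (auto intro!: tendsto_eq_intros)
    qed
    then show ?thesis by (simp add: has_field_derivative_iff Lim_null[symmetric])
  qed
  have "Y \<mu> 1 $ i $ j = (\<Sum>k\<in>UNIV. G \<mu> 1 $ i $ k * Y \<mu>0 1 $ k $ j)" for \<mu>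
  proof -
    have "G \<mu> 1 ** Y \<mu>0 1 = Y \<mu> 1"
      unfolding G_def matrix_mul_assoc[symmetric] using Zinv[of 1] by simp
    then show ?thesis by (metis (no_types, lifting) matrix_matrix_mult_def vec_lambda_beta sum.cong)
  qed
  moreover have "(\<lambda>\<mu>. \<Sum>k\<in>UNIV. G \<mu> 1 $ i $ k * Y \<mu>0 1 $ k $ j) field_differentiable (at \<mu>0)"
    by (intro field_differentiable_sum field_differentiable_mult field_differentiable_const)
       (use Gder in \<open>auto simp: field_differentiable_def\<close>)
  ultimately show ?thesis by simp
qed

text \<open>The bilinear map P and the target of \<Lambda> are kept abstract because two systems are
  of this kind: a frame alone, and a frame together with its difference quotient in \<mu>. The
  potential B enters only through a Lipschitz bound for \<Lambda>.\<close>

lemma has_derivative_limit_connection: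
  fixes F :: "'a::real_normed_vector \<Rightarrow> complex \<Rightarrow> 'b::real_normed_vector"
    and \<Lambda> :: "'a \<Rightarrow> complex \<Rightarrow> 'a \<Rightarrow> 'c::real_normed_vector" and B :: "'a \<Rightarrow> 'd::real_normed_vector"
  assumes W: "open W" "x0 \<in> W" and B: "continuous_on W B" and P: "bounded_bilinear P"
    and der: "\<And>x \<mu>. x \<in> W \<Longrightarrow> \<mu> \<noteq> \<mu>0 \<Longrightarrow>
        ((\<lambda>y. F y \<mu>) has_derivative (\<lambda>v. P (F x \<mu>) (\<Lambda> x \<mu> v))) (at x)"
    and K: "K > 0" "\<And>x \<mu> v. x \<in> W \<Longrightarrow> norm (\<Lambda> x \<mu> v - \<Lambda> x0 \<mu>0 v) \<le> K * (cmod (\<mu> - \<mu>0) + norm (B x - B x0)) * norm v"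
    and \<Lambda>: "bounded_linear (\<Lambda> x0 \<mu>0)"
    and pt: "\<And>x. x \<in> W \<Longrightarrow> (F x \<longlongrightarrow> F x \<mu>0) (at \<mu>0)"
  shows "((\<lambda>y. F y \<mu>0) has_derivative (\<lambda>v. P (F x0 \<mu>0) (\<Lambda> x0 \<mu>0 v))) (at x0)"
proof -
  obtain K2 where K2: "K2 > 0" "\<And>a b. norm (P a b) \<le> norm a * norm b * K2"
    using bounded_bilinear.pos_bounded[OF P] by blast
  obtain K3 where K3: "K3 > 0" "\<And>v. norm (\<Lambda> x0 \<mu>0 v) \<le> norm v * K3"
    using bounded_linear.pos_bounded[OF \<Lambda>] by blast
  have near: "\<exists>d>0. \<forall>x. dist x0 x < d \<longrightarrow> x \<in> W \<and> norm (B x - B x0) < e" if "e > 0" for e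
  proof -
    have "isCont B x0" using B W by (simp add: continuous_on_eq_continuous_at)
    then have "((\<lambda>x. norm (B x - B x0)) \<longlongrightarrow> 0) (at x0)"
      by (auto simp: isCont_def intro!: tendsto_eq_intros)
    then have "eventually (\<lambda>x. norm (B x - B x0) < e) (at x0)"
      by (rule order_tendstoD) (rule that)
    then have "eventually (\<lambda>x. norm (B x - B x0) < e) (nhds x0)"
      by (rule eventually_nhds_conv_at[THEN iffD2, OF conjI]) (simp add: that)
    moreover have "eventually (\<lambda>x. x \<in> W) (nhds x0)"
      using W by (rule eventually_nhds_in_open)
    ultimately have "eventually (\<lambda>x. x \<in> W \<and> norm (B x - B x0) < e) (nhds x0)"
      by (simp add: eventually_conj)
    then show ?thesis by (simp add: eventually_nhds_metric dist_commute)
  qed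
  obtain r where r: "r > 0" "\<And>x. dist x0 x < r \<Longrightarrow> x \<in> W \<and> norm (B x - B x0) < 1"
    using near[of 1] by auto
  define C where "C = K2 * (K * 2 + K3)"
  have C: "C > 0" using K K2 K3 by (simp add: C_def add_pos_pos)
  have Pd: "P a c - P a d = P a (c - d)" for a c d
    by (simp add: bounded_bilinear.diff_right[OF P])
  show ?thesis
  proof (rule has_derivative_limit_linear_ode[where r = r and C = C and L = "\<lambda>x \<mu> v w. P w (\<Lambda> x \<mu> v)"])
    show "((\<lambda>y. F y \<mu>) has_derivative (\<lambda>v. P (F x \<mu>) (\<Lambda> x \<mu> v))) (at x)"
      if "x \<in> ball x0 r" "\<mu> \<noteq> \<mu>0" "dist \<mu> \<mu>0 < 1" for x \<mu>
      using r(2)[of x] that by (intro der) auto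
    show "norm (P w (\<Lambda> x \<mu> v)) \<le> C * norm v * norm w" if "x \<in> ball x0 r" "dist \<mu> \<mu>0 < 1" for x \<mu> v w
    proof -
      have x: "x \<in> W" "norm (B x - B x0) < 1" using r(2)[of x] that by auto
      have "norm (\<Lambda> x \<mu> v) \<le> norm (\<Lambda> x \<mu> v - \<Lambda> x0 \<mu>0 v) + norm (\<Lambda> x0 \<mu>0 v)"
        by (metis add.commute norm_triangle_sub)
      also have "\<dots> \<le> K * (cmod (\<mu> - \<mu>0) + norm (B x - B x0)) * norm v + norm v * K3"
        by (intro add_mono K x K3)
      also have "\<dots> \<le> K * (1 + 1) * norm v + norm v * K3"
        using that x K by (intro add_right_mono mult_right_mono mult_left_mono add_mono) (auto simp: dist_norm)
      finally have l: "norm (\<Lambda> x \<mu> v) \<le> (K * 2 + K3) * norm v" by (simp add: algebra_simps)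
      have "norm (P w (\<Lambda> x \<mu> v)) \<le> norm w * norm (\<Lambda> x \<mu> v) * K2" by (rule K2)
      also have "\<dots> \<le> norm w * ((K * 2 + K3) * norm v) * K2"
        using l K2 by (intro mult_right_mono mult_left_mono) auto
      finally show ?thesis by (simp add: C_def mult_ac)
    qed
    show "\<exists>d>0. \<forall>x \<mu> v w. dist x0 x < d \<longrightarrow> dist \<mu> \<mu>0 < d \<longrightarrow>
        norm (P w (\<Lambda> x \<mu> v) - P w (\<Lambda> x0 \<mu>0 v)) \<le> e * norm v * norm w" if "e > 0" for e
    proof -
      \<comment> \<open>Both |\<mu> - \<mu>0| and the change of B are made smaller than \<eta>,
        whence the factor 2 in the denominator.\<close>
      define \<eta> where "\<eta> = e / (2 * K * K2)"
      have \<eta>: "\<eta> > 0" using that K K2 by (simp add: \<eta>_def)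
      obtain d where d: "d > 0" "\<forall>x. dist x0 x < d \<longrightarrow> x \<in> W \<and> norm (B x - B x0) < \<eta>"
        using near[OF \<eta>] by blast
      show ?thesis
      proof (intro exI[of _ "min d \<eta>"] conjI allI impI)
        fix x \<mu> v w assume x: "dist x0 x < min d \<eta>" "dist \<mu> \<mu>0 < min d \<eta>"
        then have xW: "x \<in> W" "norm (B x - B x0) < \<eta>" using d by auto
        have "norm (P w (\<Lambda> x \<mu> v) - P w (\<Lambda> x0 \<mu>0 v)) \<le> norm w * norm (\<Lambda> x \<mu> v - \<Lambda> x0 \<mu>0 v) * K2"
          unfolding Pd by (rule K2)
        also have "\<dots> \<le> norm w * (K * (cmod (\<mu> - \<mu>0) + norm (B x - B x0)) * norm v) * K2"
          using K2 by (intro mult_right_mono mult_left_mono K xW) auto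
        also have "\<dots> \<le> norm w * (K * (\<eta> + \<eta>) * norm v) * K2"
          using x xW K K2 by (intro mult_right_mono mult_left_mono add_mono) (auto simp: dist_norm)
        also have "\<dots> = e * norm v * norm w"
          using K K2 by (simp add: \<eta>_def field_simps)
        finally show "norm (P w (\<Lambda> x \<mu> v) - P w (\<Lambda> x0 \<mu>0 v)) \<le> e * norm v * norm w" .
      qed (use d \<eta> in auto)
    qed
    show "bounded_linear (\<lambda>v. P w (\<Lambda> x0 \<mu>0 v))" for w
      using bounded_linear_compose[OF bounded_bilinear.bounded_linear_right[OF P] \<Lambda>] .
    show "bounded_linear (\<lambda>w. P w (\<Lambda> x0 \<mu>0 v))" for v
      by (rule bounded_bilinear.bounded_linear_left[OF P])
    show "P (w - w') (\<Lambda> x \<mu> v) = P w (\<Lambda> x \<mu> v) - P w' (\<Lambda> x \<mu> v)" for w w' x \<mu> v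
      by (rule bounded_bilinear.diff_left[OF P])
    show "(F x \<longlongrightarrow> F x \<mu>0) (at \<mu>0)" if "x \<in> ball x0 r" for x
      using r(2)[of x] that by (intro pt) auto
  qed (use r C in auto)
qed

section \<open>Entire families of frames\<close>

definition entire_mat :: "(complex \<Rightarrow> complex^'n^'m) \<Rightarrow> bool" where
  "entire_mat F \<longleftrightarrow> (\<forall>i j. (\<lambda>z. F z $ i $ j) holomorphic_on UNIV)"

text \<open>In contrast to \<open>is_frame\<close>, normalisation at 0 and invertibility are dropped
  and entire dependence on the spectral parameter is demanded. In this form the notion is inherited
  under dressing.\<close>

definition frame_family ::
  "(real^'n::finite) set \<Rightarrow> (real^'n \<Rightarrow> complex^'n^'n) \<Rightarrow> (real^'n \<Rightarrow> complex \<Rightarrow> complex^'n^'n) \<Rightarrow> bool" where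
  "frame_family W B F \<longleftrightarrow> (\<forall>x\<in>W. entire_mat (F x) \<and>
     (\<forall>\<mu>. ((\<lambda>y. F y \<mu>) has_derivative (\<lambda>v. F x \<mu> ** cform (B x) \<mu> v)) (at x)))"

lemma frame_familyD:
  "frame_family W B F \<Longrightarrow> x \<in> W \<Longrightarrow> ((\<lambda>y. F y \<mu>) has_derivative (\<lambda>v. F x \<mu> ** cform (B x) \<mu> v)) (at x)"
  by (simp add: frame_family_def)

lemma matrix_tendstoI:
  "(\<And>i j. ((\<lambda>z. F z $ i $ j) \<longlongrightarrow> A $ i $ j) G) \<Longrightarrow> (F \<longlongrightarrow> (A :: 'a::topological_space^'n^'m)) G"
  by (intro vec_tendstoI)

lemma entire_mat_DERIV:
  "entire_mat F \<Longrightarrow> ((\<lambda>z. F z $ i $ j) has_field_derivative mat_deriv F z0 $ i $ j) (at z0)"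
  by (auto simp: entire_mat_def mat_deriv_def intro!: holomorphic_derivI[OF _ open_UNIV])

lemma entire_mat_tendsto: "entire_mat F \<Longrightarrow> (F \<longlongrightarrow> F z) (at z)"
  using DERIV_isCont[OF entire_mat_DERIV] by (intro matrix_tendstoI) (auto simp: isCont_def)

lemma entire_mat_tendsto_deriv:
  assumes "entire_mat F"
  shows "((\<lambda>z. mscale (1 / (z - z0)) (F z - F z0)) \<longlongrightarrow> mat_deriv F z0) (at z0)"
  using entire_mat_DERIV[OF assms, of _ _ z0] unfolding has_field_derivative_iff
  by (intro matrix_tendstoI) simp

lemma entire_mat_const: "entire_mat (\<lambda>_. A)"
  by (simp add: entire_mat_def)

lemma entire_mat_mult: "entire_mat F \<Longrightarrow> entire_mat G \<Longrightarrow> entire_mat (\<lambda>z. F z ** G z)"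
  unfolding entire_mat_def by (auto simp: matrix_matrix_mult_def intro!: holomorphic_intros)

lemma mat_deriv_mult:
  assumes "entire_mat F" "entire_mat G"
  shows "mat_deriv (\<lambda>z. F z ** G z) z0 = mat_deriv F z0 ** G z0 + F z0 ** mat_deriv G z0"
proof -
  have "((\<lambda>z. (F z ** G z) $ i $ j) has_field_derivative (mat_deriv F z0 ** G z0 + F z0 ** mat_deriv G z0) $ i $ j) (at z0)" for i j
    using entire_mat_DERIV[OF assms(1), of i _ z0] entire_mat_DERIV[OF assms(2), of _ j z0]
    by (auto simp: matrix_matrix_mult_def sum.distrib[symmetric] algebra_simps intro!: derivative_eq_intros sum.cong)
  then show ?thesis
    by (auto simp: mat_deriv_def vec_eq_iff intro!: DERIV_imp_deriv)
qed

lemma mat_deriv_const: "mat_deriv (\<lambda>_. A) z0 = 0"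
  by (simp add: mat_deriv_def vec_eq_iff)

text \<open>Meant for the parameter at which a dressing formula has its pole: the equation is known
  for all other parameters, and only convergence of the frame is available there.\<close>

lemma has_derivative_frame_limit:
  fixes F :: "real^'n::finite \<Rightarrow> complex \<Rightarrow> complex^'n^'n"
  assumes "open W" "x0 \<in> W" "continuous_on W B"
    and "\<And>x \<mu>. x \<in> W \<Longrightarrow> \<mu> \<noteq> \<mu>0 \<Longrightarrow> ((\<lambda>y. F y \<mu>) has_derivative (\<lambda>v. F x \<mu> ** cform (B x) \<mu> v)) (at x)"
    and "\<And>x. x \<in> W \<Longrightarrow> (F x \<longlongrightarrow> F x \<mu>0) (at \<mu>0)"
  shows "((\<lambda>y. F y \<mu>0) has_derivative (\<lambda>v. F x0 \<mu>0 ** cform (B x0) \<mu>0 v)) (at x0)"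
proof -
  obtain K where K: "K > 0" "\<And>B \<mu> B' \<mu>' (v :: real^'n).
    norm (cform B \<mu> v - cform B' \<mu>' v) \<le> K * (cmod (\<mu> - \<mu>') + norm (B - B')) * norm v"
    using norm_cform_diff_le[where 'n = 'n] by metis
  show ?thesis
    using assms(4,5)
    by (intro has_derivative_limit_connection[OF assms(1-3) bounded_bilinear_matrix_mult _ K(1,2) bounded_linear_cform])
qed

text \<open>The pair consisting of a frame and its difference quotient in the spectral parameter again
  solves a linear equation, whose coefficients stay bounded as the difference quotient becomes a
  derivative.\<close>

lemma has_derivative_frame_mat_deriv:
  fixes F :: "real^'n::finite \<Rightarrow> complex \<Rightarrow> complex^'n^'n"
  assumes W: "open W" "x0 \<in> W" and B: "continuous_on W B" and F: "frame_family W B F"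
  shows "((\<lambda>y. mat_deriv (F y) \<mu>0) has_derivative
    (\<lambda>v. mat_deriv (F x0) \<mu>0 ** cform (B x0) \<mu>0 v + F x0 \<mu>0 ** dg v)) (at x0)"
proof -
  obtain K where K: "K > 0" "\<And>B \<mu> B' \<mu>' (v :: real^'n).
    norm (cform B \<mu> v - cform B' \<mu>' v) \<le> K * (cmod (\<mu> - \<mu>') + norm (B - B')) * norm v"
    using norm_cform_diff_le[where 'n = 'n] by metis
  define Q where "Q y \<mu> = (if \<mu> = \<mu>0 then mat_deriv (F y) \<mu>0 else mscale (1 / (\<mu> - \<mu>0)) (F y \<mu> - F y \<mu>0))" for y \<mu>
  \<comment> \<open>Right multiplication of the row (F, Q) by a block triangular matrix; the three
    components of the second argument are its two diagonal blocks and the block that couples F to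
    Q.\<close>
  define P :: "(complex^'n^'n) \<times> (complex^'n^'n) \<Rightarrow> (complex^'n^'n) \<times> (complex^'n^'n) \<times> (complex^'n^'n) \<Rightarrow> (complex^'n^'n) \<times> (complex^'n^'n)"
    where "P w a = (fst w ** fst a, snd w ** fst (snd a) + fst w ** snd (snd a))" for w a
  define \<Lambda> where "\<Lambda> x \<mu> v = (cform (B x) \<mu>0 v, cform (B x) \<mu> v, dg v)" for x \<mu> v
  note bs = bounded_bilinear.scaleR_left[OF bounded_bilinear_matrix_mult] bounded_bilinear.scaleR_right[OF bounded_bilinear_matrix_mult]
  have P: "bounded_bilinear P"
    unfolding bilinear_conv_bounded_bilinear[symmetric] bilinear_def
    by (auto intro!: linearI simp: P_def matrix_distribs bs scaleR_add_right)
  have dF: "((\<lambda>y. F y \<mu>) has_derivative (\<lambda>v. F x \<mu> ** cform (B x) \<mu> v)) (at x)" if "x \<in> W" for x \<mu>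
    using F that by (simp add: frame_family_def)
  have "((\<lambda>y. (F y \<mu>0, Q y \<mu>0)) has_derivative (\<lambda>v. P (F x0 \<mu>0, Q x0 \<mu>0) (\<Lambda> x0 \<mu>0 v))) (at x0)"
  proof (rule has_derivative_limit_connection[where K = "2 * K" and B = B and W = W and \<Lambda> = \<Lambda> and F = "\<lambda>y \<mu>. (F y \<mu>0, Q y \<mu>)"])
    fix x \<mu> assume x: "x \<in> W" and \<mu>: "\<mu> \<noteq> \<mu>0"
    have "((\<lambda>y. mscale (1 / (\<mu> - \<mu>0)) (F y \<mu> - F y \<mu>0)) has_derivative
       (\<lambda>v. mscale (1 / (\<mu> - \<mu>0)) (F x \<mu> ** cform (B x) \<mu> v - F x \<mu>0 ** cform (B x) \<mu>0 v))) (at x)"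
      by (intro bounded_linear.has_derivative[OF bounded_linear_mscale] has_derivative_diff dF x)
    \<comment> \<open>The connection forms for \<mu> and \<mu>0 differ by (\<mu> - \<mu>0)
      \<delta>(v), so the singular prefactor cancels exactly and the coupling block is
      \<delta>(v).\<close>
    moreover have "mscale (1 / (\<mu> - \<mu>0)) (F x \<mu> ** cform (B x) \<mu> v - F x \<mu>0 ** cform (B x) \<mu>0 v)
      = Q x \<mu> ** cform (B x) \<mu> v + F x \<mu>0 ** dg v" for v
    proof -
      have c: "cform (B x) \<mu> v = cform (B x) \<mu>0 v + mscale (\<mu> - \<mu>0) (dg v)"
        by (simp add: cform_def mscale_def vec_eq_iff algebra_simps)
      have "F x \<mu> ** cform (B x) \<mu> v - F x \<mu>0 ** cform (B x) \<mu>0 v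
        = (F x \<mu> - F x \<mu>0) ** cform (B x) \<mu> v + mscale (\<mu> - \<mu>0) (F x \<mu>0 ** dg v)"
        unfolding c by (simp add: matrix_distribs)
      then show ?thesis using \<mu> by (simp add: Q_def mscale_add mscale_mscale mscale_mult_left)
    qed
    ultimately have "((\<lambda>y. Q y \<mu>) has_derivative (\<lambda>v. Q x \<mu> ** cform (B x) \<mu> v + F x \<mu>0 ** dg v)) (at x)"
      using \<mu> by (simp add: Q_def)
    from has_derivative_Pair[OF dF[OF x, of \<mu>0] this]
    show "((\<lambda>y. (F y \<mu>0, Q y \<mu>)) has_derivative (\<lambda>v. P (F x \<mu>0, Q x \<mu>) (\<Lambda> x \<mu> v))) (at x)"
      by (simp add: P_def \<Lambda>_def)
  next
    fix x \<mu> v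
    have "norm (\<Lambda> x \<mu> v - \<Lambda> x0 \<mu>0 v) \<le> norm (cform (B x) \<mu>0 v - cform (B x0) \<mu>0 v) + norm (cform (B x) \<mu> v - cform (B x0) \<mu>0 v)"
      using norm_Pair_le[of "cform (B x) \<mu>0 v - cform (B x0) \<mu>0 v" "(cform (B x) \<mu> v - cform (B x0) \<mu>0 v, 0 :: complex^'n^'n)"]
        norm_Pair_le[of "cform (B x) \<mu> v - cform (B x0) \<mu>0 v" "0 :: complex^'n^'n"]
      by (simp add: \<Lambda>_def)
    also have "\<dots> \<le> K * (cmod (\<mu>0 - \<mu>0) + norm (B x - B x0)) * norm v + K * (cmod (\<mu> - \<mu>0) + norm (B x - B x0)) * norm v"
      by (intro add_mono K)
    also have "\<dots> \<le> 2 * K * (cmod (\<mu> - \<mu>0) + norm (B x - B x0)) * norm v"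
      using K by (simp add: algebra_simps)
    finally show "norm (\<Lambda> x \<mu> v - \<Lambda> x0 \<mu>0 v) \<le> 2 * K * (cmod (\<mu> - \<mu>0) + norm (B x - B x0)) * norm v" .
  next
    show "bounded_linear (\<Lambda> x0 \<mu>0)"
      unfolding \<Lambda>_def by (intro bounded_linear_Pair bounded_linear_cform bounded_linear_dg)
  next
    fix x assume "x \<in> W"
    then have "entire_mat (F x)" using F by (simp add: frame_family_def)
    from Lim_transform_eventually[OF entire_mat_tendsto_deriv[OF this, of \<mu>0], of "Q x"]
    have "(Q x \<longlongrightarrow> Q x \<mu>0) (at \<mu>0)"
      by (simp add: Q_def eventually_at_filter)
    then show "((\<lambda>\<mu>. (F x \<mu>0, Q x \<mu>)) \<longlongrightarrow> (F x \<mu>0, Q x \<mu>0)) (at \<mu>0)"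
      by (intro tendsto_Pair tendsto_const)
  qed (use W B P K(1) in auto)
  from has_derivative_snd[OF this] show ?thesis
    by (simp add: P_def \<Lambda>_def Q_def)
qed

lemma transpose_cform:
  assumes "\<And>k l. k \<noteq> l \<Longrightarrow> B $ k $ l = B $ l $ k"
  shows "transpose (cform B \<mu> v) = - cform B (- \<mu>) v"
proof -
  have "transpose (cform B \<mu> v) $ k $ l = (- cform B (- \<mu>) v) $ k $ l" for k l
    using assms[of k l] by (cases "k = l") (simp_all add: transpose_def cform_nth algebra_simps)
  then show ?thesis by (simp add: vec_eq_iff)
qed

lemma bounded_linear_transpose: "bounded_linear (transpose :: complex^'n::finite^'m::finite \<Rightarrow> complex^'m^'n)"
  unfolding linear_conv_bounded_linear[symmetric]
  by (rule linearI) (auto simp: transpose_def vec_eq_iff)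

text \<open>Solutions for the parameters \<open>\<mu>\<close> and \<open>- \<mu>\<close> are dual to each other because \<open>B\<close> is symmetric.\<close>

lemma frame_mult_transpose_eq_1:
  fixes F :: "real^'n::finite \<Rightarrow> complex^'n^'n"
  assumes U: "open U" "connected U" "a \<in> U" "x \<in> U"
    and B: "\<And>x k l. x \<in> U \<Longrightarrow> k \<noteq> l \<Longrightarrow> B x $ k $ l = B x $ l $ k"
    and F: "\<And>x. x \<in> U \<Longrightarrow> (F has_derivative (\<lambda>v. F x ** cform (B x) \<mu> v)) (at x)"
    and G: "\<And>x. x \<in> U \<Longrightarrow> (G has_derivative (\<lambda>v. G x ** cform (B x) (- \<mu>) v)) (at x)"
    and init: "F a ** transpose (G a) = mat 1"
  shows "F x ** transpose (G x) = mat 1"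
proof -
  have "((\<lambda>y. F y ** transpose (G y)) has_derivative (\<lambda>v. 0)) (at y)" if y: "y \<in> U" for y
  proof -
    have "((\<lambda>y. F y ** transpose (G y)) has_derivative
      (\<lambda>v. F y ** transpose (G y ** cform (B y) (- \<mu>) v) + (F y ** cform (B y) \<mu> v) ** transpose (G y))) (at y)"
      by (intro bounded_bilinear.FDERIV[OF bounded_bilinear_matrix_mult] F y
          bounded_linear.has_derivative[OF bounded_linear_transpose] G)
    then show ?thesis
      by (simp add: matrix_transpose_mul transpose_cform[OF B[OF y]] matrix_distribs)
  qed
  from has_derivative_zero_unique_connected[OF U(1,2) this U(4,3)] init show ?thesis by simp
qed

text \<open>The transition matrix from p to q is considered instead of F itself because along the
  segment it starts at the identity for every \<mu>. Orthogonality supplies its inverse at \<mu>0 as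
  a transpose at - \<mu>0, which solves the adjoint equation.\<close>

lemma frame_transition_entire:
  fixes F :: "real^'n::finite \<Rightarrow> complex \<Rightarrow> complex^'n^'n"
  assumes seg: "closed_segment p q \<subseteq> U"
    and B: "\<And>x k l. x \<in> U \<Longrightarrow> k \<noteq> l \<Longrightarrow> B x $ k $ l = B x $ l $ k"
    and F: "\<And>x \<mu>. x \<in> U \<Longrightarrow> ((\<lambda>y. F y \<mu>) has_derivative (\<lambda>v. F x \<mu> ** cform (B x) \<mu> v)) (at x)"
    and inv: "\<And>x \<mu>. x \<in> U \<Longrightarrow> F x \<mu> ** transpose (F x (- \<mu>)) = mat 1"
  shows "entire_mat (\<lambda>\<mu>. transpose (F p (- \<mu>)) ** F q \<mu>)"
proof -
  define v where "v = q - p"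
  have inU: "p + t *\<^sub>R v \<in> U" if "t \<in> {0..1}" for t
  proof -
    have "p + t *\<^sub>R v = (1 - t) *\<^sub>R p + t *\<^sub>R q" by (simp add: v_def algebra_simps)
    moreover have "(1 - t) *\<^sub>R p + t *\<^sub>R q \<in> closed_segment p q" using that by (auto simp: in_segment)
    ultimately show ?thesis using seg by auto
  qed
  have pU: "p \<in> U" using inU[of 0] by simp
  have inv': "transpose (F x (- \<mu>)) ** F x \<mu> = mat 1" if "x \<in> U" for x \<mu>
    using inv[OF that] matrix_left_right_inverse by blast
  have "(\<lambda>\<mu>. (transpose (F p (- \<mu>)) ** F (p + 1 *\<^sub>R v) \<mu>) $ i $ j) field_differentiable (at \<mu>0)" for \<mu>0 i j
  proof (rule field_differentiable_parameter[where Y = "\<lambda>\<mu> t. transpose (F p (- \<mu>)) ** F (p + t *\<^sub>R v) \<mu>"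
        and A = "\<lambda>t. cform (B (p + t *\<^sub>R v)) \<mu>0 v" and \<Delta> = "dg v"
        and Zi = "\<lambda>t. transpose (F (p + t *\<^sub>R v) (- \<mu>0)) ** F p \<mu>0"])
    fix t :: real assume t: "t \<in> {0..1}"
    let ?x = "p + t *\<^sub>R v"
    have c: "cform (B ?x) \<mu>0 v + mscale (\<mu> - \<mu>0) (dg v) = cform (B ?x) \<mu> v" for \<mu>
      by (simp add: cform_def mscale_def vec_eq_iff algebra_simps)
    have d: "((\<lambda>t. F (p + t *\<^sub>R v) \<mu>) has_vector_derivative F ?x \<mu> ** cform (B ?x) \<mu> v) (at t within {0..1})" for \<mu>
      using has_vector_derivative_along_segment[of "\<lambda>y. F y \<mu>", OF F[OF inU[OF t]]] .
    show "((\<lambda>t. transpose (F p (- \<mu>)) ** F (p + t *\<^sub>R v) \<mu>) has_vector_derivative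
        transpose (F p (- \<mu>)) ** F ?x \<mu> ** (cform (B ?x) \<mu>0 v + mscale (\<mu> - \<mu>0) (dg v))) (at t within {0..1})" for \<mu>
      unfolding c matrix_mul_assoc[symmetric]
      by (rule bounded_linear.has_vector_derivative[OF bounded_bilinear.bounded_linear_right[OF bounded_bilinear_matrix_mult] d])
    have "((\<lambda>t. transpose (F (p + t *\<^sub>R v) (- \<mu>0)) ** F p \<mu>0) has_vector_derivative
        transpose (F ?x (- \<mu>0) ** cform (B ?x) (- \<mu>0) v) ** F p \<mu>0) (at t within {0..1})"
      by (rule bounded_linear.has_vector_derivative[OF bounded_bilinear.bounded_linear_left[OF bounded_bilinear_matrix_mult]
            bounded_linear.has_vector_derivative[OF bounded_linear_transpose d]])
    then show "((\<lambda>t. transpose (F (p + t *\<^sub>R v) (- \<mu>0)) ** F p \<mu>0) has_vector_derivative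
        - (cform (B ?x) \<mu>0 v ** (transpose (F ?x (- \<mu>0)) ** F p \<mu>0))) (at t within {0..1})"
      by (simp add: matrix_transpose_mul transpose_cform[OF B[OF inU[OF t]]] matrix_distribs)
    have "transpose (F ?x (- \<mu>0)) ** (F p \<mu>0 ** transpose (F p (- \<mu>0))) ** F ?x \<mu>0 = mat 1"
      by (simp add: inv[OF pU] inv'[OF inU[OF t]])
    then show "transpose (F ?x (- \<mu>0)) ** F p \<mu>0 ** (transpose (F p (- \<mu>0)) ** F ?x \<mu>0) = mat 1"
      by (simp add: matrix_mul_assoc)
  next
    fix \<mu>
    have "(transpose (F p (- \<mu>)) ** F p \<mu>) ** (transpose (F p (- \<mu>0)) ** F p \<mu>0) = mat 1"
      by (simp add: inv'[OF pU])
    then show "transpose (F p (- \<mu>)) ** F (p + 0 *\<^sub>R v) \<mu> ** (transpose (F (p + 0 *\<^sub>R v) (- \<mu>0)) ** F p \<mu>0) = mat 1"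
      by simp
  qed
  then show ?thesis
    by (simp add: entire_mat_def holomorphic_on_def v_def)
qed

text \<open>F q is F p times an entire transition matrix whenever the segment from p to q lies in U.
  Balls provide such segments, and connectedness of U carries holomorphy from a to x.\<close>

lemma frame_entire:
  fixes F :: "real^'n::finite \<Rightarrow> complex \<Rightarrow> complex^'n^'n"
  assumes U: "open U" "connected U" "a \<in> U" "x \<in> U"
    and B: "\<And>x k l. x \<in> U \<Longrightarrow> k \<noteq> l \<Longrightarrow> B x $ k $ l = B x $ l $ k"
    and F: "\<And>x \<mu>. x \<in> U \<Longrightarrow> ((\<lambda>y. F y \<mu>) has_derivative (\<lambda>v. F x \<mu> ** cform (B x) \<mu> v)) (at x)"
    and inv: "\<And>x \<mu>. x \<in> U \<Longrightarrow> F x \<mu> ** transpose (F x (- \<mu>)) = mat 1"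
    and a: "entire_mat (F a)"
  shows "entire_mat (F x)"
proof -
  have step: "entire_mat (F q)" if "closed_segment p q \<subseteq> U" "entire_mat (F p)" for p q
  proof -
    have pU: "p \<in> U" using that(1) by auto
    have "F q \<mu> = F p \<mu> ** (transpose (F p (- \<mu>)) ** F q \<mu>)" for \<mu>
      by (simp add: matrix_mul_assoc inv[OF pU])
    then show ?thesis
      using entire_mat_mult[OF that(2) frame_transition_entire[OF that(1) B F inv]] by simp
  qed
  \<comment> \<open>Stated as an equivalence so that it is an equivalence relation between points;
    segments can be run through in both directions.\<close>
  have "entire_mat (F a) \<longleftrightarrow> entire_mat (F x)"
  proof (rule connected_equivalence_relation[OF U(2-4), where R = "\<lambda>p q. entire_mat (F p) \<longleftrightarrow> entire_mat (F q)"])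
    fix p assume p: "p \<in> U"
    obtain r where r: "r > 0" "ball p r \<subseteq> U" using U(1) p openE by blast
    have "entire_mat (F p) \<longleftrightarrow> entire_mat (F q)" if "q \<in> ball p r" for q
    proof -
      have "closed_segment p q \<subseteq> U"
        using r that by (meson centre_in_ball closed_segment_subset convex_ball order_trans)
      then show ?thesis using step[of p q] step[of q p] by (auto simp: closed_segment_commute)
    qed
    then show "\<exists>T. openin (top_of_set U) T \<and> p \<in> T \<and> (\<forall>q\<in>T. entire_mat (F p) \<longleftrightarrow> entire_mat (F q))"
      using r by (intro exI[of _ "ball p r"]) (auto intro: open_subset)
  qed auto
  with a show ?thesis by simp
qed

section \<open>The frame of an Egoroff metric\<close>

text \<open>Both sides are half of a mixed second derivative of the potential \<phi>, because the
  derivative of h_i^2 is 2 h_i times that of h_i. Division by h_i h_j turns this into the symmetry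
  of the rotation coefficients.\<close>

lemma egoroff_pd_symmetric:
  fixes U :: "(real^'n::finite) set"
  assumes "egoroff_metric U h" "x \<in> U"
  shows "h x $ i * pd j (\<lambda>y. h y $ i) x = h x $ j * pd i (\<lambda>y. h y $ j) x"
proof -
  obtain \<phi> :: "real^'n \<Rightarrow> real" where U: "open U" and h: "smooth_on h U"
    and \<phi>: "smooth_on \<phi> U" "\<And>x i. x \<in> U \<Longrightarrow> (h x $ i)\<^sup>2 = pd i \<phi> x"
    using assms(1) unfolding egoroff_metric_def by blast
  have "pd j (pd i \<phi>) x = 2 * (h x $ i * pd j (\<lambda>y. h y $ i) x)" for i j
  proof -
    have "pd j (pd i \<phi>) x = pd j (\<lambda>y. (h y $ i)\<^sup>2) x"
      using \<phi>(2) by (intro pd_cong_open[OF U _ assms(2)]) simp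
    also have "\<dots> = 2 * (h x $ i * pd j (\<lambda>y. h y $ i) x)"
    proof -
      have "((\<lambda>y. h y $ i) has_derivative frechet_derivative (\<lambda>y. h y $ i) (at x)) (at x)"
        using smooth_on_imp_differentiable[OF smooth_on_nth[OF U h] U assms(2)]
        by (rule frechet_derivative_worksI)
      from has_derivative_power[OF this, of 2] show ?thesis
        by (subst pd_eqI, assumption) (simp add: pd_def)
    qed
    finally show ?thesis .
  qed
  then show ?thesis using pd_commute[OF U \<phi>(1) assms(2), of i j] by (simp add: mult.commute)
qed

lemma rotation_coeff_symmetric:
  assumes "egoroff_metric U h" "x \<in> U"
  shows "rotation_coeff h x $ i $ j = rotation_coeff h x $ j $ i"
proof -
  have "h x $ i \<noteq> 0" "h x $ j \<noteq> 0" using assms by (auto simp: egoroff_metric_def)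
  then show ?thesis
    using egoroff_pd_symmetric[OF assms, of i j] by (simp add: rotation_coeff_def field_simps)
qed

lemma bounded_linear_cmat: "bounded_linear (cmat :: real^'n::finite^'m::finite \<Rightarrow> complex^'n^'m)"
  unfolding linear_conv_bounded_linear[symmetric]
  by (rule linearI) (auto simp: cmat_def vec_eq_iff scaleR_conv_of_real[where 'a = complex])

lemma smooth_on_rotation_coeff:
  assumes "egoroff_metric U h"
  shows "smooth_on (rotation_coeff h) U"
proof -
  have U: "open U" "smooth_on h U" "\<And>x i. x \<in> U \<Longrightarrow> h x $ i \<noteq> 0"
    using assms by (auto simp: egoroff_metric_def)
  show ?thesis
  proof (intro smooth_on_vec U)
    fix i j
    have "smooth_on (\<lambda>x. pd j (\<lambda>y. h y $ i) x * inverse (h x $ j)) U"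
      by (intro smooth_on_bounded_bilinear[OF U(1) bounded_bilinear_mult] smooth_on_inverse
          smooth_on_nth smooth_on_pd U)
    then show "smooth_on (\<lambda>x. rotation_coeff h x $ i $ j) U"
      by (cases "i = j") (simp_all add: rotation_coeff_def smooth_on_const divide_inverse)
  qed
qed

lemma cnj_mat_mult: "cnj_mat (A ** B) = cnj_mat A ** cnj_mat B"
  by (simp add: cnj_mat_def matrix_matrix_mult_def vec_eq_iff cnj_sum)

lemma bounded_linear_cnj_mat: "bounded_linear (cnj_mat :: complex^'n::finite^'m::finite \<Rightarrow> complex^'n^'m)"
  unfolding linear_conv_bounded_linear[symmetric]
  by (rule linearI) (auto simp: cnj_mat_def vec_eq_iff scaleR_conv_of_real[where 'a = complex])

lemma cnj_mat_cform: "cnj_mat (cform B \<mu> v) = cform (cnj_mat B) (cnj \<mu>) v"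
  by (simp add: vec_eq_iff cform_nth cnj_mat_def)

lemma cnj_mat_cmat [simp]: "cnj_mat (cmat A) = cmat A"
  by (simp add: vec_eq_iff cmat_def cnj_mat_def)

lemma cnj_mat_1 [simp]: "cnj_mat (mat 1) = mat 1"
  by (simp add: vec_eq_iff cnj_mat_def mat_def)

text \<open>Orthogonality comes before holomorphy, since the parameter argument takes the inverse
  frame from it. Both orthogonality and reality are uniqueness statements on the connected set U
  with the value 1 at 0.\<close>

lemma egoroff_frame:
  fixes E :: "real^'n::finite \<Rightarrow> complex \<Rightarrow> complex^'n^'n"
  assumes "connected U" "0 \<in> U" "egoroff_metric U h" "is_frame U (rotation_coeff h) E"
  defines "B \<equiv> \<lambda>x. cmat (rotation_coeff h x)"
  shows "frame_family U B E"
    and "\<And>x \<mu>. x \<in> U \<Longrightarrow> E x \<mu> ** transpose (E x (- \<mu>)) = mat 1"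
    and "\<And>x \<mu>. x \<in> U \<Longrightarrow> cnj_mat (E x \<mu>) = E x (cnj \<mu>)"
proof -
  have U: "open U" "smooth_on h U" "\<And>x i. x \<in> U \<Longrightarrow> h x $ i \<noteq> 0"
    using assms by (auto simp: egoroff_metric_def)
  have E0: "E 0 \<mu> = mat 1" for \<mu> using assms by (simp add: is_frame_def)
  have dE: "((\<lambda>y. E y \<mu>) has_derivative (\<lambda>v. E x \<mu> ** cform (B x) \<mu> v)) (at x)" if "x \<in> U" for x \<mu>
  proof -
    obtain D where D: "((\<lambda>y. E y \<mu>) has_derivative D) (at x)" "invertible (E x \<mu>)"
      "\<And>v. matrix_inv (E x \<mu>) ** D v = cform (B x) \<mu> v"
      using assms(4) \<open>x \<in> U\<close> unfolding is_frame_def B_def connection_form_eq by blast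
    have "D = (\<lambda>v. E x \<mu> ** cform (B x) \<mu> v)"
      unfolding D(3)[symmetric] matrix_mul_assoc by (simp add: matrix_inv_right[OF D(2)])
    with D(1) show ?thesis by simp
  qed
  have sym: "B x $ k $ l = B x $ l $ k" if "x \<in> U" for x k l
    using rotation_coeff_symmetric[OF assms(3) that] by (simp add: B_def cmat_def)
  show inv: "E x \<mu> ** transpose (E x (- \<mu>)) = mat 1" if "x \<in> U" for x \<mu>
    by (rule frame_mult_transpose_eq_1[OF U(1) assms(1,2) that, where B = B and \<mu> = \<mu>])
      (use sym dE E0 in \<open>auto simp: transpose_mat\<close>)
  show "frame_family U B E"
    unfolding frame_family_def
    using dE frame_entire[OF U(1) assms(1,2) _ sym dE inv] E0 by (auto simp: entire_mat_const)
  show "cnj_mat (E x \<mu>) = E x (cnj \<mu>)" if x: "x \<in> U" for x \<mu>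
  proof -
    \<comment> \<open>The potential is real, so the conjugated frame solves the equation for
      \<open>cnj \<mu>\<close>. The matrix on the right also inverts \<open>E x (cnj \<mu>)\<close>,
      and the two inverses are compared.\<close>
    have "cnj_mat (E x \<mu>) ** transpose (E x (- cnj \<mu>)) = mat 1"
    proof (rule frame_mult_transpose_eq_1[OF U(1) assms(1,2) x, where B = B and \<mu> = "cnj \<mu>"])
      fix y assume y: "y \<in> U"
      show "((\<lambda>y. cnj_mat (E y \<mu>)) has_derivative (\<lambda>v. cnj_mat (E y \<mu>) ** cform (B y) (cnj \<mu>) v)) (at y)"
        using bounded_linear.has_derivative[OF bounded_linear_cnj_mat dE[OF y, of \<mu>]]
        by (simp add: cnj_mat_mult cnj_mat_cform B_def)
      show "((\<lambda>y. E y (- cnj \<mu>)) has_derivative (\<lambda>v. E y (- cnj \<mu>) ** cform (B y) (- cnj \<mu>) v)) (at y)"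
        by (rule dE[OF y])
    qed (use sym E0 in \<open>auto simp: transpose_mat\<close>)
    moreover have "transpose (E x (- cnj \<mu>)) ** E x (cnj \<mu>) = mat 1"
      using inv[OF x] matrix_left_right_inverse by blast
    ultimately show ?thesis
      by (metis matrix_mul_assoc matrix_mul_lid matrix_mul_rid)
  qed
qed

section \<open>Dressing by a simple factor\<close>

text \<open>Each of the two zeros is divided out by a difference quotient, completed at \<gamma> by
  its derivative.\<close>

lemma remove_double_zero:
  assumes "h holomorphic_on UNIV" "h \<gamma> = 0" "deriv h \<gamma> = 0"
  obtains k where "k holomorphic_on UNIV" "\<And>z. z \<noteq> \<gamma> \<Longrightarrow> k z = h z / (z - \<gamma>)\<^sup>2"
proof -
  define k1 where "k1 = (\<lambda>z. if z = \<gamma> then deriv h \<gamma> else (h z - h \<gamma>) / (z - \<gamma>))"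
  define k2 where "k2 = (\<lambda>z. if z = \<gamma> then deriv k1 \<gamma> else (k1 z - k1 \<gamma>) / (z - \<gamma>))"
  have "k1 holomorphic_on UNIV" unfolding k1_def by (rule pole_lemma_open[OF assms(1) open_UNIV])
  then have "k2 holomorphic_on UNIV" unfolding k2_def by (rule pole_lemma_open[OF _ open_UNIV])
  moreover have "k2 z = h z / (z - \<gamma>)\<^sup>2" if "z \<noteq> \<gamma>" for z
    using that assms by (simp add: k2_def k1_def power2_eq_square)
  ultimately show ?thesis by (rule that)
qed

lemma remove_sings_eq_entire:
  assumes "k holomorphic_on UNIV" "eventually (\<lambda>z. f z = k z) (at \<mu>)"
  shows "remove_sings f \<mu> = k \<mu>"
proof -
  have "k analytic_on {\<mu>}" using assms(1) analytic_at by blast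
  then show ?thesis using remove_sings_cong[OF assms(2) refl] by simp
qed

text \<open>One dressing step with its singularity removed. The second step acts on this entire
  family rather than on the raw product of the first, whose value at \<gamma> is arbitrary.\<close>

definition dressed_extension ::
  "complex \<Rightarrow> complex^'n^'n \<Rightarrow> (real^'n::finite \<Rightarrow> complex \<Rightarrow> complex^'n^'n) \<Rightarrow> real^'n \<Rightarrow> complex \<Rightarrow> complex^'n^'n" where
  "dressed_extension \<gamma> P F x \<mu> = (\<chi> i j. remove_sings (\<lambda>z. simple_dressing \<gamma> P F x z $ i $ j) \<mu>)"

lemma mult_assoc_eq: "A ** B = C \<Longrightarrow> A ** (B ** X) = C ** (X :: 'a::semiring_1^'n^'n)"
  by (simp add: matrix_mul_assoc)

lemma simple_factor_inverse:
  assumes "P ** P = 0"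
  shows "simple_factor \<gamma> P z ** (mat 1 - mscale (1 / (z - \<gamma>)) P) = mat 1"
  using assms by (simp add: simple_factor_def matrix_distribs)

lemma frame_log_deriv_eq:
  "entire_mat (F x) \<Longrightarrow> frame_log_deriv \<gamma> F x = mat_deriv (F x) \<gamma> ** matrix_inv (F x \<gamma>)"
  by (simp add: frame_log_deriv_def mat_deriv_mult entire_mat_const mat_deriv_const)

text \<open>All three rest on P R = P for R the inverse of 1 + P M, which holds because P (1 + P M)
  = P. The second and third say that the numerator of the dressed frame vanishes at \<gamma>
  together with its first derivative.\<close>

lemma dressed_residue_identities:
  assumes P: "P ** P = 0" and wd: "residue_well_defined \<gamma> P F x"
  defines "Q \<equiv> dressed_residue \<gamma> P F x" and "M \<equiv> frame_log_deriv \<gamma> F x"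
  shows "Q ** Q = 0" and "P ** F x \<gamma> ** Q = 0"
    and "(F x \<gamma> + P ** M ** F x \<gamma>) ** Q = P ** F x \<gamma>"
proof -
  let ?F = "F x \<gamma>" and ?Fi = "matrix_inv (F x \<gamma>)"
  define R where "R = matrix_inv (mat 1 + P ** M)"
  have inv: "invertible ?F" "invertible (mat 1 + P ** M)"
    using wd by (simp_all add: residue_well_defined_def M_def)
  have Q: "Q = ?Fi ** R ** P ** ?F" by (simp add: Q_def dressed_residue_def R_def M_def)
  have FFi: "?F ** ?Fi = mat 1" using matrix_inv_right[OF inv(1)] .
  have MR: "(mat 1 + P ** M) ** R = mat 1" unfolding R_def by (rule matrix_inv_right[OF inv(2)])
  have "P ** ((mat 1 + P ** M) ** R) = P ** R"
    by (simp add: matrix_distribs mult_assoc_eq[OF P])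
  then have PR: "P ** R = P" by (simp add: MR)
  show "Q ** Q = 0" "P ** ?F ** Q = 0"
    by (simp_all add: Q matrix_distribs mult_assoc_eq[OF FFi] mult_assoc_eq[OF PR] mult_assoc_eq[OF P])
  have "(?F + P ** M ** ?F) ** Q = ((mat 1 + P ** M) ** R) ** P ** ?F"
    by (simp add: Q matrix_distribs mult_assoc_eq[OF FFi])
  then show "(?F + P ** M ** ?F) ** Q = P ** ?F" by (simp add: MR)
qed

lemma simple_dressing_eq:
  assumes "P ** P = 0" "residue_well_defined \<gamma> P F x"
  shows "simple_dressing \<gamma> P F x z =
    simple_factor \<gamma> P z ** F x z ** (mat 1 - mscale (1 / (z - \<gamma>)) (dressed_residue \<gamma> P F x))"
  unfolding simple_dressing_def
  by (simp add: matrix_inv_eqI[OF simple_factor_inverse[OF dressed_residue_identities(1)[OF assms]]])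

text \<open>The factor on the left and the inverse factor on the right each contribute a simple
  pole, so the product has at most a double pole at \<gamma>; the residue identities are exactly the
  two cancellation conditions.\<close>

lemma dressed_extension_entire:
  assumes F: "entire_mat (F x)" and P: "P ** P = 0" and wd: "residue_well_defined \<gamma> P F x"
  shows "entire_mat (dressed_extension \<gamma> P F x)"
    and "z \<noteq> \<gamma> \<Longrightarrow> dressed_extension \<gamma> P F x z = simple_dressing \<gamma> P F x z"
proof -
  define Q where "Q = dressed_residue \<gamma> P F x"
  note ids = dressed_residue_identities[OF P wd, folded Q_def]
  have ent: "entire_mat (\<lambda>z. mscale (z - \<gamma>) (mat 1) + A)" for A :: "complex^'a^'a"
    by (auto simp: entire_mat_def intro!: holomorphic_intros)
  have der: "mat_deriv (\<lambda>z. mscale (z - \<gamma>) (mat 1) + A) \<gamma> = mat 1" for A :: "complex^'a^'a"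
    unfolding mat_deriv_def by (auto simp: vec_eq_iff intro!: DERIV_imp_deriv derivative_eq_intros)
  define S where "S = - Q"
  \<comment> \<open>(z - \<gamma>)^2 times the dressed frame.\<close>
  define H where "H z = (mscale (z - \<gamma>) (mat 1) + P) ** F x z ** (mscale (z - \<gamma>) (mat 1) + S)" for z
  have entH: "entire_mat H" unfolding H_def by (intro entire_mat_mult ent F)
  have H0: "H \<gamma> = 0" using ids(2) by (simp add: H_def S_def matrix_distribs)
  have "mat_deriv (F x) \<gamma> = frame_log_deriv \<gamma> F x ** F x \<gamma>"
    using wd matrix_inv_left[of "F x \<gamma>"]
    by (simp add: frame_log_deriv_eq[where F = F, OF F] residue_well_defined_def matrix_mul_assoc[symmetric])
  moreover have "mat_deriv H \<gamma> = (F x \<gamma> + P ** mat_deriv (F x) \<gamma>) ** S + P ** F x \<gamma>"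
    unfolding H_def by (simp add: mat_deriv_mult entire_mat_mult ent F der)
  ultimately have "mat_deriv H \<gamma> = 0"
    using ids(3) by (simp add: S_def matrix_distribs algebra_simps)
  then have dH: "deriv (\<lambda>z. H z $ i $ j) \<gamma> = 0" for i j
    by (simp add: mat_deriv_def vec_eq_iff)
  have sd: "simple_dressing \<gamma> P F x z $ i $ j = H z $ i $ j / (z - \<gamma>)\<^sup>2" if "z \<noteq> \<gamma>" for z i j
  proof -
    have "H z = mscale ((z - \<gamma>)\<^sup>2) (simple_dressing \<gamma> P F x z)"
      using that unfolding simple_dressing_eq[OF P wd, folded Q_def]
      by (simp add: H_def S_def matrix_distribs simple_factor_def power2_eq_square)
    then show ?thesis using that by simp
  qed
  have "\<exists>k. k holomorphic_on UNIV \<and> (\<forall>z. z \<noteq> \<gamma> \<longrightarrow> k z = simple_dressing \<gamma> P F x z $ i $ j)" for i j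
  proof -
    obtain k where "k holomorphic_on UNIV" "\<And>z. z \<noteq> \<gamma> \<Longrightarrow> k z = H z $ i $ j / (z - \<gamma>)\<^sup>2"
      using remove_double_zero[of "\<lambda>z. H z $ i $ j" \<gamma>] entH dH[of i j] H0 unfolding entire_mat_def by auto
    then show ?thesis using sd by auto
  qed
  then obtain k where k: "\<And>i j. k i j holomorphic_on UNIV"
      "\<And>i j z. z \<noteq> \<gamma> \<Longrightarrow> k i j z = simple_dressing \<gamma> P F x z $ i $ j"
    by metis
  have ext: "dressed_extension \<gamma> P F x \<mu> $ i $ j = k i j \<mu>" for \<mu> i j
  proof -
    have "eventually (\<lambda>z. z \<noteq> \<gamma>) (at \<mu>)"
      by (cases "\<mu> = \<gamma>") (auto simp: eventually_at_filter intro: t1_space_nhds eventually_mono)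
    then have "eventually (\<lambda>z. simple_dressing \<gamma> P F x z $ i $ j = k i j z) (at \<mu>)"
      by eventually_elim (simp add: k(2))
    from remove_sings_eq_entire[OF k(1) this] show ?thesis
      by (simp add: dressed_extension_def)
  qed
  show "entire_mat (dressed_extension \<gamma> P F x)"
    unfolding entire_mat_def ext by (simp add: k)
  show "dressed_extension \<gamma> P F x z = simple_dressing \<gamma> P F x z" if "z \<noteq> \<gamma>"
    using that by (simp add: vec_eq_iff ext k)
qed

lemma Ck_on_cform:
  assumes "open W" "Ck_on k B W"
  shows "Ck_on k (\<lambda>x. cform (B x) \<mu> v) W"
  unfolding cform_def
  by (intro Ck_on_add Ck_on_diff Ck_on_const assms Ck_on_bounded_bilinear[OF _ bounded_bilinear_matrix_mult])

section \<open>Differential equations of the residue and of the dressed frame\<close>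

context
  fixes W :: "(real^'n::finite) set" and B F P \<gamma>
  assumes W: "open W" and B: "smooth_on B W" and F: "frame_family W B F"
    and P: "P ** P = 0" and wd: "\<And>x. x \<in> W \<Longrightarrow> residue_well_defined \<gamma> P F x"
begin

text \<open>Q is F^-1 R P F. The outer factors F^-1 and F contribute the commutator of Q with the
  connection form, and differentiating the inverse R contributes the quadratic term.\<close>

lemma has_derivative_dressed_residue:
  assumes x: "x \<in> W"
  defines "A \<equiv> cform (B x) \<gamma>" and "Q \<equiv> dressed_residue \<gamma> P F"
  shows "(Q has_derivative (\<lambda>v. Q x ** A v - A v ** Q x - Q x ** dg v ** Q x)) (at x)"
proof -
  note bb = bounded_bilinear_matrix_mult
  define M where "M y = mat_deriv (F y) \<gamma> ** matrix_inv (F y \<gamma>)" for y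
  have M: "frame_log_deriv \<gamma> F y = M y" if "y \<in> W" for y
    using F that by (simp add: M_def frame_family_def frame_log_deriv_eq)
  define R where "R y = matrix_inv (mat 1 + P ** M y)" for y
  have inv: "invertible (F y \<gamma>)" "invertible (mat 1 + P ** M y)" if "y \<in> W" for y
    using wd[OF that] by (simp_all add: residue_well_defined_def M[OF that])
  define Fi where "Fi y = matrix_inv (F y \<gamma>)" for y
  have FF: "F x \<gamma> ** Fi x = mat 1" "Fi x ** F x \<gamma> = mat 1"
    unfolding Fi_def using matrix_inv_left matrix_inv_right inv(1)[OF x] by blast+
  have dF: "((\<lambda>y. F y \<gamma>) has_derivative (\<lambda>v. F x \<gamma> ** A v)) (at x)"
    unfolding A_def by (rule frame_familyD[OF F x])
  have dFi: "(Fi has_derivative (\<lambda>v. - (A v ** Fi x))) (at x)"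
    unfolding Fi_def
    using has_derivative_matrix_inv[OF dF W x inv(1)] by (simp add: Fi_def[symmetric] matrix_distribs mult_assoc_eq[OF FF(2)])
  \<comment> \<open>The two terms containing the connection form cancel between the \<mu>-derivative
    of F and the inverse of F; only the conjugate of \<delta>(v) by F remains.\<close>
  have dM: "(M has_derivative (\<lambda>v. F x \<gamma> ** dg v ** Fi x)) (at x)"
    unfolding M_def Fi_def[symmetric]
    using bounded_bilinear.FDERIV[OF bb has_derivative_frame_mat_deriv[OF W x smooth_on_imp_continuous_on[OF B] F] dFi, of \<gamma>]
    by (simp add: A_def matrix_distribs)
  have dPM: "((\<lambda>y. mat 1 + P ** M y) has_derivative (\<lambda>v. P ** (F x \<gamma> ** dg v ** Fi x))) (at x)"
    using has_derivative_add[OF has_derivative_const bounded_linear.has_derivative[OF bounded_bilinear.bounded_linear_right[OF bb] dM]]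
    by simp
  have dR: "(R has_derivative (\<lambda>v. - (R x ** (P ** (F x \<gamma> ** dg v ** Fi x)) ** R x))) (at x)"
    unfolding R_def by (rule has_derivative_matrix_inv[OF dPM W x inv(2)])
  have Qeq: "Q y = Fi y ** R y ** P ** F y \<gamma>" if "y \<in> W" for y
    by (simp add: Q_def dressed_residue_def Fi_def R_def M[OF that])
  have "((\<lambda>y. Fi y ** R y ** P ** F y \<gamma>) has_derivative (\<lambda>v. Q x ** A v - A v ** Q x - Q x ** dg v ** Q x)) (at x)"
    using bounded_bilinear.FDERIV[OF bb
        bounded_linear.has_derivative[OF bounded_bilinear.bounded_linear_left[OF bb] bounded_bilinear.FDERIV[OF bb dFi dR]] dF, of P]
    by (simp add: Qeq[OF x] matrix_distribs algebra_simps)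
  then show ?thesis
    by (rule has_derivative_transform_within_open[OF _ W x]) (simp add: Qeq)
qed

text \<open>The equation of Q has a right side polynomial in Q and B, so regularity of Q improves
  step by step.\<close>

lemma smooth_on_dressed_residue: "smooth_on (dressed_residue \<gamma> P F) W" (is "smooth_on ?Q W")
proof (rule smooth_on_bootstrap[OF W has_derivative_dressed_residue])
  fix k i assume "Ck_on k ?Q W"
  then show "Ck_on k (\<lambda>x. ?Q x ** cform (B x) \<gamma> (axis i 1) - cform (B x) \<gamma> (axis i 1) ** ?Q x
      - ?Q x ** dg (axis i 1) ** ?Q x) W"
    using B unfolding smooth_on_def
    by (intro Ck_on_diff Ck_on_cform Ck_on_const Ck_on_bounded_bilinear[OF _ bounded_bilinear_matrix_mult] W) auto
qed

lemma frame_family_dressed_extension: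
  "frame_family W (\<lambda>x. B x - dressed_residue \<gamma> P F x) (dressed_extension \<gamma> P F)"
proof -
  let ?Q = "dressed_residue \<gamma> P F"
  let ?G = "dressed_extension \<gamma> P F"
  have entF: "entire_mat (F x)" if "x \<in> W" for x using F that by (simp add: frame_family_def)
  have ent: "entire_mat (?G x)" if "x \<in> W" for x
    by (rule dressed_extension_entire(1)[OF entF[OF that] P wd[OF that]])
  have off: "((\<lambda>y. ?G y \<mu>) has_derivative (\<lambda>v. ?G x \<mu> ** cform (B x - ?Q x) \<mu> v)) (at x)"
    if x: "x \<in> W" and \<mu>: "\<mu> \<noteq> \<gamma>" for x \<mu>
  proof -
    define c where "c = 1 / (\<mu> - \<gamma>)"
    let ?m = "simple_factor \<gamma> P \<mu>"
    have G: "?G y \<mu> = ?m ** (F y \<mu> ** (mat 1 - mscale c (?Q y)))" if "y \<in> W" for y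
      using dressed_extension_entire(2)[OF entF[OF that] P wd[OF that] \<mu>] simple_dressing_eq[OF P wd[OF that], of \<mu>]
      by (simp add: c_def matrix_mul_assoc)
    note QQ = dressed_residue_identities(1)[OF P wd[OF x]]
    have c1: "mscale c (mscale (\<mu> - \<gamma>) X) = X" for X :: "complex^'n^'n"
      using \<mu> by (simp add: c_def mscale_mscale)
    have cf: "cform (B x) \<mu> v = cform (B x) \<gamma> v + mscale (\<mu> - \<gamma>) (dg v)" for v
      by (simp add: cform_def mscale_def vec_eq_iff algebra_simps)
    have cf': "cform (B x - ?Q x) \<mu> v = cform (B x) \<gamma> v + mscale (\<mu> - \<gamma>) (dg v) - dg v ** ?Q x + ?Q x ** dg v" for v
      unfolding cf[symmetric] by (simp add: cform_def matrix_distribs)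
    have "((\<lambda>y. ?m ** (F y \<mu> ** (mat 1 - mscale c (?Q y)))) has_derivative
       (\<lambda>v. ?m ** (F x \<mu> ** (0 - mscale c (?Q x ** cform (B x) \<gamma> v - cform (B x) \<gamma> v ** ?Q x - ?Q x ** dg v ** ?Q x))
          + F x \<mu> ** cform (B x) \<mu> v ** (mat 1 - mscale c (?Q x))))) (at x)"
      by (intro bounded_linear.has_derivative[OF bounded_bilinear.bounded_linear_right[OF bounded_bilinear_matrix_mult]]
          bounded_bilinear.FDERIV[OF bounded_bilinear_matrix_mult] frame_familyD[OF F] x
          has_derivative_diff has_derivative_const bounded_linear.has_derivative[OF bounded_linear_mscale]
          has_derivative_dressed_residue)
    \<comment> \<open>A gauge transformation by 1 - c Q. It closes up because the forms for \<mu>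
      and \<gamma> differ by (\<mu> - \<gamma>) \<delta>(v), c (\<mu> - \<gamma>) = 1 and Q^2 =
      0.\<close>
    moreover have "F x \<mu> ** (0 - mscale c (?Q x ** cform (B x) \<gamma> v - cform (B x) \<gamma> v ** ?Q x - ?Q x ** dg v ** ?Q x))
          + F x \<mu> ** cform (B x) \<mu> v ** (mat 1 - mscale c (?Q x))
        = F x \<mu> ** (mat 1 - mscale c (?Q x)) ** cform (B x - ?Q x) \<mu> v" for v
      using \<mu> unfolding cf cf' 
      by (simp add: matrix_distribs mult_assoc_eq[OF QQ] c_def)
    ultimately have "((\<lambda>y. ?m ** (F y \<mu> ** (mat 1 - mscale c (?Q y)))) has_derivative
       (\<lambda>v. ?m ** (F x \<mu> ** (mat 1 - mscale c (?Q x)) ** cform (B x - ?Q x) \<mu> v))) (at x)"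
      by simp
    from has_derivative_transform_within_open[OF this W x, of "\<lambda>y. ?G y \<mu>"] show ?thesis
      by (simp add: G x matrix_mul_assoc)
  qed
  have "((\<lambda>y. ?G y \<mu>) has_derivative (\<lambda>v. ?G x \<mu> ** cform (B x - ?Q x) \<mu> v)) (at x)" if x: "x \<in> W" for x \<mu>
  proof (cases "\<mu> = \<gamma>")
    case True
    have "continuous_on W (\<lambda>x. B x - ?Q x)"
      using smooth_on_imp_continuous_on B smooth_on_dressed_residue by (intro continuous_on_diff) auto
    then show ?thesis
      using has_derivative_frame_limit[OF W x _ off entire_mat_tendsto[OF ent]] True by simp
  qed (rule off[OF x])
  then show ?thesis using ent by (simp add: frame_family_def)
qed

end

text \<open>A frame identically 1 has vanishing logarithmic derivative, so the residue is P itself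
  and the two simple factors cancel. Applied at x = 0 this preserves the normalisation of the
  frame.\<close>

lemma dressed_extension_id:
  assumes F: "\<And>z. F x z = mat 1" and P: "P ** P = 0" and wd: "residue_well_defined \<gamma> P F x"
  shows "dressed_extension \<gamma> P F x \<mu> = mat 1"
proof -
  have M: "frame_log_deriv \<gamma> F x = 0"
    by (simp add: frame_log_deriv_def F mat_deriv_const)
  have i1: "matrix_inv (mat 1 :: complex^'a^'a) = mat 1" by (rule matrix_inv_eqI) simp
  have Q: "dressed_residue \<gamma> P F x = P" by (simp add: dressed_residue_def M F i1)
  have sd: "simple_dressing \<gamma> P F x z = mat 1" for z
    by (simp add: simple_dressing_eq[OF P wd] Q F simple_factor_inverse[OF P])
  have "dressed_extension \<gamma> P F x \<mu> $ i $ j = mat 1 $ i $ j" for i j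
    unfolding dressed_extension_def by (simp add: sd remove_sings_eq_entire[where k = "\<lambda>_. mat 1 $ i $ j"])
  then show ?thesis by (simp add: vec_eq_iff)
qed

section \<open>Reality of the dressed family\<close>

lemma mscale_minus_left: "mscale (- c) A = - mscale c A"
  by (simp add: vec_eq_iff)

lemma cnj_mat_add: "cnj_mat (A + B) = cnj_mat A + cnj_mat B"
  and cnj_mat_diff: "cnj_mat (A - B) = cnj_mat A - cnj_mat B"
  and cnj_mat_mscale: "cnj_mat (mscale c A) = mscale (cnj c) (cnj_mat A)"
  and cnj_mat_transpose: "cnj_mat (transpose A) = transpose (cnj_mat A)"
  by (simp_all add: vec_eq_iff cnj_mat_def transpose_def)

lemma cnj_mat_matrix_inv:
  fixes A :: "complex^'n^'n"
  assumes "invertible A"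
  shows "cnj_mat (matrix_inv A) = matrix_inv (cnj_mat A)"
proof -
  have "cnj_mat A ** cnj_mat (matrix_inv A) = mat 1"
    by (simp add: cnj_mat_mult[symmetric] matrix_inv_right[OF assms])
  from matrix_inv_eqI[OF this] show ?thesis by simp
qed

text \<open>On the real parameter \<gamma> both F and its \<mu>-derivative are real, hence so is the
  residue; the dressing formula then inherits the conjugation symmetry of F.\<close>

lemma dressing_real:
  assumes F: "entire_mat (F x)" "\<And>z. cnj_mat (F x z) = F x (cnj z)"
    and P: "P ** P = 0" "cnj_mat P = P" and \<gamma>: "cnj \<gamma> = \<gamma>" and wd: "residue_well_defined \<gamma> P F x"
  shows "cnj_mat (dressed_residue \<gamma> P F x) = dressed_residue \<gamma> P F x"
    and "cnj_mat (dressed_extension \<gamma> P F x z) = dressed_extension \<gamma> P F x (cnj z)"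
proof -
  have inv: "invertible (F x \<gamma>)" "invertible (mat 1 + P ** frame_log_deriv \<gamma> F x)"
    using wd by (simp_all add: residue_well_defined_def)
  have Fc: "cnj_mat (F x \<gamma>) = F x \<gamma>" by (simp add: F \<gamma>)
  have "cnj (mat_deriv (F x) \<gamma> $ i $ j) = mat_deriv (F x) \<gamma> $ i $ j" for i j
  proof -
    have eq: "(cnj \<circ> (\<lambda>z. F x z $ i $ j) \<circ> cnj) = (\<lambda>z. F x z $ i $ j)"
    proof
      fix z
      have "cnj_mat (F x (cnj z)) $ i $ j = F x z $ i $ j" by (simp add: F)
      then show "(cnj \<circ> (\<lambda>z. F x z $ i $ j) \<circ> cnj) z = F x z $ i $ j" by (simp add: cnj_mat_def)
    qed
    have d: "((\<lambda>z. F x z $ i $ j) has_field_derivative mat_deriv (F x) \<gamma> $ i $ j) (at \<gamma>)"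
      by (rule entire_mat_DERIV[OF F(1)])
    then have "((\<lambda>z. F x z $ i $ j) has_field_derivative cnj (mat_deriv (F x) \<gamma> $ i $ j)) (at \<gamma>)"
      using has_field_derivative_cnj_cnj[of "\<lambda>z. F x z $ i $ j" _ \<gamma>] unfolding eq by (simp add: \<gamma>)
    from DERIV_unique[OF this d] show ?thesis .
  qed
  then have "cnj_mat (mat_deriv (F x) \<gamma>) = mat_deriv (F x) \<gamma>" by (simp add: vec_eq_iff cnj_mat_def)
  then have M: "cnj_mat (frame_log_deriv \<gamma> F x) = frame_log_deriv \<gamma> F x"
    by (simp add: frame_log_deriv_eq[where F = F, OF F(1)] cnj_mat_mult cnj_mat_matrix_inv inv Fc)
  show Q: "cnj_mat (dressed_residue \<gamma> P F x) = dressed_residue \<gamma> P F x"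
    by (simp add: dressed_residue_def cnj_mat_mult cnj_mat_add cnj_mat_matrix_inv inv Fc M P)
  let ?G = "dressed_extension \<gamma> P F x"
  note G = dressed_extension_entire[OF F(1) P(1) wd]
  have off: "cnj_mat (?G z) = ?G (cnj z)" if "z \<noteq> \<gamma>" for z
  proof -
    have "cnj z \<noteq> \<gamma>" using that \<gamma> by (metis complex_cnj_cnj)
    then show ?thesis
      using that by (simp add: G(2) simple_dressing_eq[OF P(1) wd] simple_factor_def
        cnj_mat_mult cnj_mat_add cnj_mat_diff cnj_mat_mscale P F Q \<gamma>)
  qed
  show "cnj_mat (?G z) = ?G (cnj z)"
  \<comment> \<open>The formula does not reach z = \<gamma>, where the identity follows from
    continuity of both sides.\<close>
  proof (cases "z = \<gamma>")
    case True
    have "isCont ?G \<gamma>" using entire_mat_tendsto[OF G(1)] by (simp add: isCont_def)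
    moreover have "(cnj \<longlongrightarrow> \<gamma>) (at \<gamma>)"
      using tendsto_cnj[OF tendsto_ident_at, of \<gamma> UNIV] \<gamma> by simp
    ultimately have "((\<lambda>z. ?G (cnj z)) \<longlongrightarrow> ?G \<gamma>) (at \<gamma>)"
      by (rule isCont_tendsto_compose)
    moreover have "((\<lambda>z. cnj_mat (?G z)) \<longlongrightarrow> cnj_mat (?G \<gamma>)) (at \<gamma>)"
      by (rule bounded_linear.tendsto[OF bounded_linear_cnj_mat entire_mat_tendsto[OF G(1)]])
    then have "((\<lambda>z. ?G (cnj z)) \<longlongrightarrow> cnj_mat (?G \<gamma>)) (at \<gamma>)"
      by (rule Lim_transform_eventually) (auto simp: eventually_at_filter off)
    ultimately have "cnj_mat (?G \<gamma>) = ?G \<gamma>"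
      using tendsto_unique[OF trivial_limit_at] by blast
    then show ?thesis by (simp add: True \<gamma>)
  qed (rule off)
qed

section \<open>The dressing element\<close>

text \<open>The second identity is the coefficient of 1/(z + \<alpha>) in the partial fractions of
  the orthogonality condition on the dressing element. It is obtained by stripping the last factor 1
  + a N from N'. With J the inverse of the denominator K, the rules J N = N and N^T J = N^T,
  consequences of N^2 = 0, collapse all products.\<close>

lemma N_prime_identities:
  assumes \<alpha>: "\<alpha> \<noteq> 0" and N: "N ** N = 0" and K: "invertible (N_prime_denom \<alpha> N)"
  defines "a \<equiv> 1 / (2 * complex_of_real \<alpha>)" and "N' \<equiv> N_prime \<alpha> N"
  shows "N' ** N' = 0"
    and "N' + mscale a (transpose N' ** N') = transpose N + mscale a (transpose N ** N)"
proof -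
  define T where "T = transpose N"
  define J where "J = matrix_inv (N_prime_denom \<alpha> N)"
  have a0: "a \<noteq> 0" using \<alpha> by (simp add: a_def)
  have TT: "T ** T = 0" unfolding T_def by (simp add: matrix_transpose_mul[symmetric] N) (simp add: transpose_def vec_eq_iff)
  have Kd: "N_prime_denom \<alpha> N = mat 1 + mscale (a * a) (T ** N)"
    by (simp add: N_prime_denom_def a_def T_def power2_eq_square)
  have KJ: "N_prime_denom \<alpha> N ** J = mat 1" and JK: "J ** N_prime_denom \<alpha> N = mat 1"
    unfolding J_def using matrix_inv_left matrix_inv_right K by blast+
  have "J ** (N_prime_denom \<alpha> N ** N) = J ** N" by (simp add: Kd matrix_distribs mult_assoc_eq[OF N] N)
  then have JN: "J ** N = N" by (simp add: matrix_mul_assoc JK)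
  have "(T ** N_prime_denom \<alpha> N) ** J = T ** J" by (simp add: Kd matrix_distribs mult_assoc_eq[OF TT] TT)
  then have TJ: "T ** J = T" by (simp add: matrix_mul_assoc[symmetric] KJ)
  have Kt: "transpose (N_prime_denom \<alpha> N) = N_prime_denom \<alpha> N"
    by (simp add: Kd transpose_add transpose_mscale matrix_transpose_mul T_def transpose_mat)
  have "transpose (N_prime_denom \<alpha> N ** J) = mat 1" by (simp add: KJ)
  then have "transpose J ** N_prime_denom \<alpha> N = mat 1" by (simp add: matrix_transpose_mul Kt)
  then have Jt: "transpose J = J"
    using KJ by (metis matrix_mul_assoc matrix_mul_lid matrix_mul_rid)
  \<comment> \<open>This is K J = 1, solved for the term that contains N.\<close>
  have TNJ: "mscale (a * a) (T ** (N ** (J ** X))) = X - J ** X" for X :: "complex^'a^'a"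
  proof -
    have "(N_prime_denom \<alpha> N ** J) ** X = J ** X + mscale (a * a) (T ** (N ** (J ** X)))"
      by (simp add: Kd matrix_distribs)
    then show ?thesis by (simp add: KJ algebra_simps)
  qed
  note N2 = N mult_assoc_eq[OF N] and T2 = TT mult_assoc_eq[OF TT]
    and JN2 = JN mult_assoc_eq[OF JN] and TJ2 = TJ mult_assoc_eq[OF TJ]
  note rules = mult.assoc N2 T2 JN2 TJ2
  have N': "N' = (mat 1 - mscale a N) ** J ** T ** (mat 1 + mscale a N)"
    by (simp add: N'_def N_prime_def a_def J_def T_def)
  show "N' ** N' = 0"
    unfolding N' by (simp add: matrix_distribs rules)
  have N't: "transpose N' = (mat 1 + mscale a T) ** N ** J ** (mat 1 - mscale a T)"
    unfolding N' by (simp add: matrix_transpose_mul transpose_add transpose_diff transpose_mscale transpose_mat Jt matrix_mul_assoc)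
      (simp add: T_def)
  let ?A = "(mat 1 - mscale a N) ** J ** T"
  \<comment> \<open>The product that stands in the middle of N'^T N'. It differs from K only by
    terms in N and N^T, which die against the neighbouring N J and J N^T.\<close>
  have mid: "(mat 1 - mscale a T) ** (mat 1 - mscale a N) = N_prime_denom \<alpha> N - mscale a N - mscale a T"
    by (simp add: Kd matrix_distribs)
  have "N ** J ** ((mat 1 - mscale a T) ** (mat 1 - mscale a N)) ** J ** T
      = N ** (J ** N_prime_denom \<alpha> N) ** J ** T"
    unfolding mid by (simp add: matrix_distribs rules)
  then have "N ** J ** ((mat 1 - mscale a T) ** (mat 1 - mscale a N)) ** J ** T = N ** J ** T"
    by (simp add: JK)
  from arg_cong[OF this, of "\<lambda>X. (mat 1 + mscale a T) ** X"]
  have "transpose N' ** ?A = (mat 1 + mscale a T) ** N ** J ** T"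
    unfolding N't by (simp only: matrix_mul_assoc)
  then have "?A + mscale a (transpose N' ** ?A) = T"
    using TNJ[of T] by (simp add: matrix_distribs)
  moreover have "(?A + mscale a (transpose N' ** ?A)) ** (mat 1 + mscale a N) = N' + mscale a (transpose N' ** N')"
    unfolding matrix_add_rdistrib' mscale_mult_left matrix_mul_assoc[symmetric]
    by (simp only: N' matrix_mul_assoc[symmetric])
  ultimately show "N' + mscale a (transpose N' ** N') = transpose N + mscale a (transpose N ** N)"
    by (simp add: T_def[symmetric] matrix_distribs)
qed

text \<open>The two middle factors, built from N', are rewritten as a product of factors built from
  N. After that, neighbouring factors are inverse to each other because N^2 = 0.\<close>

lemma dressing_element_orthogonal:
  assumes \<alpha>: "\<alpha> \<noteq> 0" and N: "N ** N = 0" and K: "invertible (N_prime_denom \<alpha> N)"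
    and z: "z \<noteq> complex_of_real \<alpha>" "z \<noteq> - complex_of_real \<alpha>"
  defines "s \<equiv> \<lambda>z. simple_factor (- complex_of_real \<alpha>) (N_prime \<alpha> N) z ** simple_factor (complex_of_real \<alpha>) N z"
  shows "transpose (s (- z)) ** s z = mat 1"
proof -
  define a c c' where "a = 1 / (2 * complex_of_real \<alpha>)" and "c = 1 / (z - complex_of_real \<alpha>)"
    and "c' = 1 / (z + complex_of_real \<alpha>)"
  define N' where "N' = N_prime \<alpha> N"
  define T T' where "T = transpose N" and "T' = transpose N'"
  have nz: "z - complex_of_real \<alpha> \<noteq> 0" "z + complex_of_real \<alpha> \<noteq> 0" "complex_of_real \<alpha> \<noteq> 0"
    using z \<alpha> by (auto simp: add_eq_0_iff)
  \<comment> \<open>Partial fractions of c c'. This relation explains the constants 1/(2\<alpha>)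
    and 1/(4\<alpha>^2) in N'.\<close>
  have acc: "a * (c' - c) = - (c * c')"
    using nz by (simp add: a_def c_def c'_def field_simps)
  have id1: "N' = T + mscale a (T ** N) - mscale a (T' ** N')"
    using N_prime_identities(2)[OF \<alpha> N K] by (simp add: a_def N'_def T_def T'_def algebra_simps)
  from arg_cong[OF this, of transpose] have id2: "T' = N + mscale a (T ** N) - mscale a (T' ** N')"
    by (simp add: T_def T'_def transpose_add transpose_diff transpose_mscale matrix_transpose_mul)
  have sz: "s z = (mat 1 + mscale c' N') ** (mat 1 + mscale c N)"
    by (simp add: s_def simple_factor_def c_def c'_def N'_def)
  have "1 / (- z - complex_of_real \<alpha>) = inverse (- (z + complex_of_real \<alpha>))"
    "1 / (- z - - complex_of_real \<alpha>) = inverse (- (z - complex_of_real \<alpha>))"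
    by (simp_all add: divide_inverse)
  then have "1 / (- z - complex_of_real \<alpha>) = - c'" "1 / (- z - - complex_of_real \<alpha>) = - c"
    unfolding inverse_minus_eq by (simp_all add: c_def c'_def divide_inverse)
  then have "s (- z) = (mat 1 - mscale c N') ** (mat 1 - mscale c' N)"
    unfolding s_def simple_factor_def by (simp add: N'_def mscale_minus_left)
  then have st: "transpose (s (- z)) = (mat 1 - mscale c' T) ** (mat 1 - mscale c T')"
    by (simp add: matrix_transpose_mul transpose_diff transpose_mscale transpose_mat T_def T'_def)
  have TT: "T ** T = 0" unfolding T_def by (simp add: matrix_transpose_mul[symmetric] N) (simp add: transpose_def vec_eq_iff)
  have "(mat 1 - mscale c T') ** (mat 1 + mscale c' N') = (mat 1 + mscale c' T) ** (mat 1 - mscale c N)"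
  proof -
    let ?X = "T' ** N'" and ?Y = "T ** N"
    have "(mat 1 - mscale c T') ** (mat 1 + mscale c' N') = mat 1 + mscale c' N' - mscale c T' - mscale (c * c') ?X"
      by (simp add: matrix_distribs mult.commute)
    also have "\<dots> = mat 1 + mscale c' (T + mscale a ?Y - mscale a ?X) - mscale c (N + mscale a ?Y - mscale a ?X) - mscale (c * c') ?X"
      using id1 id2 by metis
    also have "\<dots> = mat 1 + mscale c' T - mscale c N + mscale (a * (c' - c)) ?Y - mscale (a * (c' - c)) ?X - mscale (c * c') ?X"
      by (simp add: vec_eq_iff algebra_simps)
    also have "\<dots> = (mat 1 + mscale c' T) ** (mat 1 - mscale c N)"
      unfolding acc by (simp add: matrix_distribs) (simp add: vec_eq_iff algebra_simps)
    finally show ?thesis .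
  qed
  then have "transpose (s (- z)) ** s z
      = (mat 1 - mscale c' T) ** ((mat 1 + mscale c' T) ** (mat 1 - mscale c N)) ** (mat 1 + mscale c N)"
    unfolding st sz by (metis matrix_mul_assoc)
  also have "\<dots> = ((mat 1 - mscale c' T) ** (mat 1 + mscale c' T)) ** ((mat 1 - mscale c N) ** (mat 1 + mscale c N))"
    by (simp add: matrix_mul_assoc)
  also have "\<dots> = mat 1" by (simp add: matrix_distribs N TT mult_assoc_eq[OF N] mult_assoc_eq[OF TT])
  finally show ?thesis .
qed

section \<open>Orthogonality and reality of the twice dressed frame\<close>

lemma tendsto_inverse_shift_at_infinity: "((\<lambda>z. 1 / (z - a)) \<longlongrightarrow> 0) (at_infinity :: complex filter)"
proof -
  have "filterlim (\<lambda>z. z - a) at_infinity (at_infinity :: complex filter)"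
    using tendsto_add_filterlim_at_infinity[OF tendsto_const[of "- a"] filterlim_ident] by simp
  from filterlim_compose[OF tendsto_inverse_0 this] show ?thesis by (simp add: divide_inverse)
qed

text \<open>By Liouville's theorem: \<open>G(-z)\<^sup>T G(z)\<close> is entire and equals \<open>r(-z)\<^sup>T r(z)\<close>, where
  \<open>r\<close> tends to the identity at infinity.\<close>

lemma dressed_orthogonal:
  fixes E G s :: "complex \<Rightarrow> complex^'n^'n::finite"
  assumes G: "entire_mat G" and E: "\<And>z. E z ** transpose (E (- z)) = mat 1"
    and s: "\<And>z. z \<noteq> \<alpha> \<Longrightarrow> z \<noteq> - \<alpha> \<Longrightarrow> transpose (s (- z)) ** s z = mat 1"
    and eq: "\<And>z. z \<noteq> \<alpha> \<Longrightarrow> z \<noteq> - \<alpha> \<Longrightarrow>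
      G z = s z ** E z ** (mat 1 - mscale (1 / (z - \<alpha>)) Q1) ** (mat 1 - mscale (1 / (z - - \<alpha>)) Q2)"
  shows "G z ** transpose (G (- z)) = mat 1"
proof -
  define r where "r z = (mat 1 - mscale (1 / (z - \<alpha>)) Q1) ** (mat 1 - mscale (1 / (z - - \<alpha>)) Q2)" for z
  define H where "H z = transpose (G (- z)) ** G z" for z
  have E': "transpose (E (- z)) ** E z = mat 1" for z
    using E matrix_left_right_inverse by blast
  have Hr: "H z = transpose (r (- z)) ** r z" if z: "z \<noteq> \<alpha>" "z \<noteq> - \<alpha>" for z
  proof -
    \<comment> \<open>The pair of poles is symmetric under z to - z, so the factorisation is
      available at both arguments.\<close>
    have z': "- z \<noteq> \<alpha>" "- z \<noteq> - \<alpha>" using z by auto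
    have "G z = s z ** E z ** r z" "G (- z) = s (- z) ** E (- z) ** r (- z)"
      using eq[OF z] eq[OF z'] by (simp_all add: r_def matrix_mul_assoc)
    then show ?thesis
      by (simp add: H_def matrix_transpose_mul matrix_mul_assoc[symmetric] mult_assoc_eq[OF s[OF z]] mult_assoc_eq[OF E'])
  qed
  have lim1: "((\<lambda>z. mat 1 - mscale (1 / (z - b)) A) \<longlongrightarrow> mat 1) at_infinity" for A :: "complex^'n^'n" and b
  proof (rule matrix_tendstoI)
    fix i j
    have "((\<lambda>z. mat 1 $ i $ j - 1 / (z - b) * A $ i $ j) \<longlongrightarrow> mat 1 $ i $ j - 0 * A $ i $ j) at_infinity"
      by (intro tendsto_diff tendsto_const tendsto_mult tendsto_inverse_shift_at_infinity)
    then show "((\<lambda>z. (mat 1 - mscale (1 / (z - b)) A) $ i $ j) \<longlongrightarrow> mat 1 $ i $ j) at_infinity"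
      by simp
  qed
  note tm = bounded_bilinear.tendsto[OF bounded_bilinear_matrix_mult]
  have limr: "(r \<longlongrightarrow> mat 1) at_infinity"
    using tm[OF lim1[of \<alpha> Q1] lim1[of "- \<alpha>" Q2]] unfolding r_def by simp
  have "filterlim (uminus :: complex \<Rightarrow> complex) at_infinity at_infinity"
    by (simp add: filterlim_at_infinity_conv_norm_at_top filterlim_norm_at_top)
  from filterlim_compose[OF limr this] have limr': "((\<lambda>z. r (- z)) \<longlongrightarrow> mat 1) at_infinity" .
  have lim: "((\<lambda>z. transpose (r (- z)) ** r z) \<longlongrightarrow> mat 1) at_infinity"
    using tm[OF bounded_linear.tendsto[OF bounded_linear_transpose limr'] limr] by (simp add: transpose_mat)
  have "eventually (\<lambda>z. z \<noteq> \<alpha> \<and> z \<noteq> - \<alpha>) at_infinity"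
    by (intro eventually_conj eventually_not_equal_at_infinity)
  then have "eventually (\<lambda>z. transpose (r (- z)) ** r z = H z) at_infinity"
    by eventually_elim (simp add: Hr)
  then have limH: "(H \<longlongrightarrow> mat 1) at_infinity"
    by (rule Lim_transform_eventually[OF lim])
  have G': "(\<lambda>z. G (- z) $ i $ j) holomorphic_on UNIV" for i j
  proof -
    have "(\<lambda>z. G z $ i $ j) holomorphic_on UNIV" using G by (simp add: entire_mat_def)
    from holomorphic_on_compose_gen[OF holomorphic_on_minus[OF holomorphic_on_ident, of UNIV] this] show ?thesis
      by (simp add: o_def)
  qed
  have entH: "entire_mat H"
    unfolding H_def using G' by (intro entire_mat_mult G) (simp add: entire_mat_def transpose_def)
  have "H z $ i $ j = mat 1 $ i $ j" for z i j
    by (rule Liouville_weak[of "\<lambda>z. H z $ i $ j"])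
      (use entH in \<open>simp add: entire_mat_def\<close>, intro tendsto_vec_nth limH)
  then have "H z = mat 1" by (simp add: vec_eq_iff)
  then have "transpose (G (- z)) ** G z = mat 1" by (simp add: H_def)
  then show ?thesis using matrix_left_right_inverse by blast
qed

text \<open>The raw first dressing and its entire extension may differ at the pole \<beta> =
  \<alpha>. The second dressing depends only on values and derivatives near - \<alpha>, so one may
  replace the other.\<close>

lemma dressing_cong:
  assumes "\<And>z. z \<noteq> \<beta> \<Longrightarrow> D x z = G x z" and "\<gamma> \<noteq> \<beta>"
  shows "frame_log_deriv \<gamma> D x = frame_log_deriv \<gamma> G x"
    and "residue_well_defined \<gamma> P D x \<longleftrightarrow> residue_well_defined \<gamma> P G x"
    and "dressed_residue \<gamma> P D x = dressed_residue \<gamma> P G x"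
    and "z \<noteq> \<beta> \<Longrightarrow> simple_dressing \<gamma> P D x z = simple_dressing \<gamma> P G x z"
proof -
  have eq: "D x \<gamma> = G x \<gamma>" using assms by simp
  have "eventually (\<lambda>z. z \<noteq> \<beta>) (nhds \<gamma>)" using assms(2) by (rule t1_space_nhds)
  then have "eventually (\<lambda>z. D x z ** matrix_inv (D x \<gamma>) = G x z ** matrix_inv (G x \<gamma>)) (nhds \<gamma>)"
    by eventually_elim (simp add: assms(1) eq)
  then have "deriv (\<lambda>z. (D x z ** matrix_inv (D x \<gamma>)) $ i $ j) \<gamma> = deriv (\<lambda>z. (G x z ** matrix_inv (G x \<gamma>)) $ i $ j) \<gamma>" for i j
    by (intro deriv_cong_ev refl) (auto elim: eventually_mono)
  then show M: "frame_log_deriv \<gamma> D x = frame_log_deriv \<gamma> G x"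
    by (simp add: frame_log_deriv_def mat_deriv_def)
  show "residue_well_defined \<gamma> P D x \<longleftrightarrow> residue_well_defined \<gamma> P G x"
    by (simp add: residue_well_defined_def M eq)
  show Q: "dressed_residue \<gamma> P D x = dressed_residue \<gamma> P G x"
    by (simp add: dressed_residue_def M eq)
  show "simple_dressing \<gamma> P D x z = simple_dressing \<gamma> P G x z" if "z \<noteq> \<beta>"
    using that by (simp add: simple_dressing_def Q assms(1))
qed

lemma cnj_mat_N_prime:
  assumes "cnj_mat N = N" "invertible (N_prime_denom \<alpha> N)"
  shows "cnj_mat (N_prime \<alpha> N) = N_prime \<alpha> N"
proof -
  have "cnj_mat (N_prime_denom \<alpha> N) = N_prime_denom \<alpha> N"
    by (simp add: N_prime_denom_def cnj_mat_add cnj_mat_mscale cnj_mat_mult cnj_mat_transpose assms)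
  then show ?thesis
    by (simp add: N_prime_def cnj_mat_add cnj_mat_diff cnj_mat_mscale cnj_mat_mult cnj_mat_transpose
        cnj_mat_matrix_inv assms)
qed

text \<open>Collects the effect of both steps, with new potential B minus the two residues. The
  intermediate family after one step is real but not treated as orthogonal; orthogonality appears
  only for the full dressing element.\<close>

lemma dressed_frame_properties:
  fixes E :: "real^'n::finite \<Rightarrow> complex \<Rightarrow> complex^'n^'n"
  assumes W: "open W" and B: "smooth_on B W" and E: "frame_family W B E"
    and orth: "\<And>x \<mu>. x \<in> W \<Longrightarrow> E x \<mu> ** transpose (E x (- \<mu>)) = mat 1"
    and real: "\<And>x \<mu>. x \<in> W \<Longrightarrow> cnj_mat (E x \<mu>) = E x (cnj \<mu>)"
    and Breal: "\<And>x. x \<in> W \<Longrightarrow> cnj_mat (B x) = B x"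
    and \<alpha>: "\<alpha> \<noteq> 0" and N: "N ** N = 0" "cnj_mat N = N"
    and wd: "\<And>x. x \<in> W \<Longrightarrow> dressing_well_defined \<alpha> N E x"
  shows "\<exists>B'. smooth_on B' W \<and> frame_family W B' (dressed_frame \<alpha> N E) \<and> (\<forall>x\<in>W. cnj_mat (B' x) = B' x)"
    and "\<And>x \<mu>. x \<in> W \<Longrightarrow> dressed_frame \<alpha> N E x \<mu> ** transpose (dressed_frame \<alpha> N E x (- \<mu>)) = mat 1"
    and "\<And>x \<mu>. x \<in> W \<Longrightarrow> cnj_mat (dressed_frame \<alpha> N E x \<mu>) = dressed_frame \<alpha> N E x (cnj \<mu>)"
    and "\<And>x. x \<in> W \<Longrightarrow> (\<And>\<mu>. E x \<mu> = mat 1) \<Longrightarrow> dressed_frame \<alpha> N E x \<mu> = mat 1"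
proof -
  let ?a = "complex_of_real \<alpha>" and ?N' = "N_prime \<alpha> N"
  let ?D = "simple_dressing ?a N E"
  define G1 where "G1 = dressed_extension ?a N E"
  define G2 where "G2 = dressed_extension (- ?a) ?N' G1"
  define Q1 where "Q1 = dressed_residue ?a N E"
  define Q2 where "Q2 = dressed_residue (- ?a) ?N' G1"
  have a: "- ?a \<noteq> ?a" using \<alpha> by (simp add: neg_equal_iff_equal eq_neg_iff_add_eq_0)
  have ent: "entire_mat (E x)" if "x \<in> W" for x using E that by (simp add: frame_family_def)
  have wd1: "residue_well_defined ?a N E x" if "x \<in> W" for x
    using wd[OF that] by (simp add: dressing_well_defined_def)
  have G1D: "?D x z = G1 x z" if "x \<in> W" "z \<noteq> ?a" for x z
    unfolding G1_def using dressed_extension_entire(2)[OF ent[OF that(1)] N(1) wd1[OF that(1)] that(2)] by simp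
  note cong = dressing_cong[where D = ?D and G = G1 and \<beta> = ?a and \<gamma> = "- ?a", OF G1D a]
  have wd2: "residue_well_defined (- ?a) ?N' G1 x" if "x \<in> W" for x
    using wd[OF that] cong(2)[OF that] by (simp add: dressing_well_defined_def)
  have K: "invertible (N_prime_denom \<alpha> N)" if "x \<in> W" for x
    using wd[OF that] by (simp add: dressing_well_defined_def)
  have F1: "frame_family W (\<lambda>x. B x - Q1 x) G1"
    unfolding Q1_def G1_def by (rule frame_family_dressed_extension[OF W B E N(1) wd1])
  have B1: "smooth_on (\<lambda>x. B x - Q1 x) W"
    unfolding Q1_def by (intro smooth_on_diff W B smooth_on_dressed_residue[OF W B E N(1) wd1])
  have N'0: "?N' ** ?N' = 0" if "x \<in> W" for x by (rule N_prime_identities(1)[OF \<alpha> N(1) K[OF that]])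
  have ent1: "entire_mat (G1 x)" if "x \<in> W" for x using F1 that by (simp add: frame_family_def)
  have G2: "dressed_frame \<alpha> N E x \<mu> = G2 x \<mu>" if x: "x \<in> W" for x \<mu>
  proof -
    have "eventually (\<lambda>z. z \<noteq> ?a) (at \<mu>)"
      by (cases "\<mu> = ?a") (auto simp: eventually_at_filter intro: t1_space_nhds eventually_mono)
    then have "eventually (\<lambda>z. simple_dressing (- ?a) ?N' ?D x z = simple_dressing (- ?a) ?N' G1 x z) (at \<mu>)"
      by eventually_elim (rule cong(4)[OF x])
    then show ?thesis
      unfolding dressed_frame_def G2_def dressed_extension_def
      by (auto simp: vec_eq_iff intro!: remove_sings_cong elim: eventually_mono)
  qed
  have r1: "cnj_mat (Q1 x) = Q1 x" "cnj_mat (G1 x z) = G1 x (cnj z)"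
    and r2: "cnj_mat (Q2 x) = Q2 x" "cnj_mat (G2 x z) = G2 x (cnj z)" if x: "x \<in> W" for x z
  proof -
    show 1: "cnj_mat (Q1 x) = Q1 x" "cnj_mat (G1 x z) = G1 x (cnj z)" for z
      unfolding Q1_def G1_def using dressing_real[of E x, OF ent[OF x] real[OF x] N _ wd1[OF x]] by simp_all
    show "cnj_mat (Q2 x) = Q2 x" "cnj_mat (G2 x z) = G2 x (cnj z)"
      unfolding Q2_def G2_def
      using dressing_real[of G1 x, OF ent1[OF x] 1(2) N'0[OF x] cnj_mat_N_prime[OF N(2) K[OF x]] _ wd2[OF x]] by simp_all
  qed
  have ent2: "entire_mat (G2 x)" if x: "x \<in> W" for x
    unfolding G2_def by (rule dressed_extension_entire(1)[OF ent1[OF x] N'0[OF x] wd2[OF x]])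
  show "dressed_frame \<alpha> N E x \<mu> ** transpose (dressed_frame \<alpha> N E x (- \<mu>)) = mat 1" if x: "x \<in> W" for x \<mu>
    unfolding G2[OF x]
  proof (rule dressed_orthogonal[where \<alpha> = ?a and G = "G2 x" and E = "E x"
        and s = "\<lambda>z. simple_factor (- ?a) ?N' z ** simple_factor ?a N z", OF ent2[OF x] orth[OF x] dressing_element_orthogonal[OF \<alpha> N(1) K[OF x]]])
    fix z assume z: "z \<noteq> ?a" "z \<noteq> - ?a"
    show "G2 x z = simple_factor (- ?a) ?N' z ** simple_factor ?a N z ** E x z **
      (mat 1 - mscale (1 / (z - ?a)) (Q1 x)) ** (mat 1 - mscale (1 / (z - - ?a)) (Q2 x))"
      unfolding G2_def dressed_extension_entire(2)[OF ent1[OF x] N'0[OF x] wd2[OF x] z(2)]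
        simple_dressing_eq[OF N'0[OF x] wd2[OF x]] G1D[OF x z(1), symmetric]
        simple_dressing_eq[OF N(1) wd1[OF x]] Q1_def Q2_def
      by (simp add: matrix_mul_assoc)
  qed
  show "cnj_mat (dressed_frame \<alpha> N E x \<mu>) = dressed_frame \<alpha> N E x (cnj \<mu>)" if x: "x \<in> W" for x \<mu>
    unfolding G2[OF x] by (rule r2(2)[OF x])
  show "dressed_frame \<alpha> N E x \<mu> = mat 1" if x: "x \<in> W" and E1: "\<And>\<mu>. E x \<mu> = mat 1" for x
    unfolding G2[OF x] unfolding G2_def
  proof (rule dressed_extension_id[OF _ N'0[OF x] wd2[OF x]])
    show "G1 x z = mat 1" for z
      unfolding G1_def by (rule dressed_extension_id[OF E1 N(1) wd1[OF x]])
  qed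
  let ?B' = "\<lambda>x. B x - Q1 x - Q2 x"
  show "\<exists>B'. smooth_on B' W \<and> frame_family W B' (dressed_frame \<alpha> N E) \<and> (\<forall>x\<in>W. cnj_mat (B' x) = B' x)"
  \<comment> \<open>That N' squares to 0 is drawn from well-definedness at some point, so the empty
    domain is treated apart.\<close>
  proof (cases "W = {}")
    case True
    then show ?thesis using B by (intro exI[of _ B]) (auto simp: frame_family_def)
  next
    case False
    then have NN: "?N' ** ?N' = 0" using N'0 by blast
    have "frame_family W ?B' G2"
      unfolding Q2_def G2_def by (rule frame_family_dressed_extension[OF W B1 F1 NN wd2])
    moreover have "dressed_frame \<alpha> N E x = G2 x" if "x \<in> W" for x using G2[OF that] by (rule ext)
    ultimately have "frame_family W ?B' (dressed_frame \<alpha> N E)"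
      using has_derivative_cong_open[OF W, of "\<lambda>y. dressed_frame \<alpha> N E y _" "\<lambda>y. G2 y _"] G2
      by (simp add: frame_family_def)
    moreover have "smooth_on ?B' W"
      unfolding Q2_def by (intro smooth_on_diff W B1 smooth_on_dressed_residue[OF W B1 F1 NN wd2])
    moreover have "cnj_mat (?B' x) = ?B' x" if "x \<in> W" for x
      using that by (simp add: cnj_mat_diff Breal r1 r2)
    ultimately show ?thesis by blast
  qed
qed

section \<open>Flatness of pulled back Euclidean metrics\<close>

lemma matrix_vector_mult_minus_left: "(- A) *v x = - (A *v (x :: 'a::ring_1^'n))"
  by (simp add: vec_eq_iff matrix_vector_mult_def sum_negf)

lemma pd_matrix_vector_mult:
  fixes A :: "real^'n::finite \<Rightarrow> real^'m::finite^'k::finite"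
  assumes "A differentiable (at x)" "f differentiable (at x)"
  shows "pd i (\<lambda>y. A y *v f y) x = A x *v pd i f x + pd i A x *v f x"
  unfolding pd_def[of i f] pd_def[of i A]
  by (rule pd_eqI) (intro bounded_bilinear.FDERIV[OF bounded_bilinear_matrix_vector_mult] frechet_derivative_worksI assms)

lemma pd_inner:
  assumes "f differentiable (at x)" "g differentiable (at x)"
  shows "pd i (\<lambda>y. f y \<bullet> g y) x = f x \<bullet> pd i g x + pd i f x \<bullet> g x"
  unfolding pd_def[of i f] pd_def[of i g]
  by (rule pd_eqI) (intro has_derivative_inner frechet_derivative_worksI assms)

lemma pd_nth:
  assumes "f differentiable (at x)"
  shows "pd i (\<lambda>y. f y $ k) x = pd i f x $ k"
  unfolding pd_def[of i f]
  by (rule pd_eqI) (intro bounded_linear.has_derivative[OF bounded_linear_vec_nth] frechet_derivative_worksI assms)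

text \<open>In the flat coordinates \<open>Y\<close> the Christoffel symbols are \<open>\<Gamma>\<^sub>i\<^sub>j = J\<inverse> \<partial>\<^sub>i\<partial>\<^sub>jY\<close>, where \<open>J\<close> is the
  Jacobian matrix, so the curvature vanishes because third derivatives commute.\<close>

lemma flat_metric_on_pullback:
  fixes Y :: "real^'n::finite \<Rightarrow> real^'n" and g K :: "real^'n \<Rightarrow> real^'n^'n"
  assumes V: "open V" and Y: "smooth_on Y V" and K: "smooth_on K V"
    and g: "\<And>x i j. x \<in> V \<Longrightarrow> g x $ i $ j = pd i Y x \<bullet> pd j Y x"
    and KJ: "\<And>x. x \<in> V \<Longrightarrow> K x ** (\<chi> k j. pd j Y x $ k) = mat 1"
  shows "flat_metric_on g V"
proof -
  let ?Y2 = "\<lambda>i j. pd i (pd j Y)"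
  define J :: "real^'n \<Rightarrow> real^'n^'n" where "J x = (\<chi> k j. pd j Y x $ k)" for x
  have KJ': "K x ** J x = mat 1" "J x ** K x = mat 1" if "x \<in> V" for x
    using KJ[OF that] matrix_left_right_inverse unfolding J_def by blast+
  have dY: "pd j Y differentiable (at x)" "?Y2 i j differentiable (at x)" if "x \<in> V" for i j x
    by (intro smooth_on_imp_differentiable[OF _ V that] smooth_on_pd Y)+
  have sJ: "smooth_on J V"
    by (intro smooth_on_vec V) (simp add: J_def smooth_on_nth smooth_on_pd V Y)
  have sym: "?Y2 i j x = ?Y2 j i x" if "x \<in> V" for i j x by (rule pd_commute[OF V Y that])
  \<comment> \<open>The Gram matrix is J^T J, so the smooth inverse K of J gives its inverse
    explicitly and no derivative of \<open>matrix_inv\<close> is needed.\<close>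
  have ginv: "matrix_inv (g x) = K x ** transpose (K x)" if x: "x \<in> V" for x
  proof (rule matrix_inv_eqI)
    have "g x = transpose (J x) ** J x"
      by (simp add: vec_eq_iff g[OF x] J_def matrix_matrix_mult_def transpose_def inner_vec_def)
    then have "g x ** (K x ** transpose (K x)) = transpose (J x) ** (J x ** K x) ** transpose (K x)"
      by (simp add: matrix_mul_assoc)
    also have "\<dots> = transpose (K x ** J x)" by (simp add: KJ'[OF x] matrix_transpose_mul[symmetric])
    finally show "g x ** (K x ** transpose (K x)) = mat 1" by (simp add: KJ'[OF x] transpose_mat)
  qed
  have dg: "pd k (\<lambda>y. g y $ i $ j) x = pd i Y x \<bullet> ?Y2 k j x + ?Y2 k i x \<bullet> pd j Y x" if x: "x \<in> V" for i j k x
  proof -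
    have "pd k (\<lambda>y. g y $ i $ j) x = pd k (\<lambda>y. pd i Y y \<bullet> pd j Y y) x"
      by (rule pd_cong_open[OF V _ x]) (rule g)
    then show ?thesis by (simp add: pd_inner dY[OF x])
  qed
  have chr: "christoffel g k i j x = (K x *v ?Y2 i j x) $ k" if x: "x \<in> V" for k i j x
  proof -
    have "pd i (\<lambda>y. g y $ j $ l) x + pd j (\<lambda>y. g y $ i $ l) x - pd l (\<lambda>y. g y $ i $ j) x
        = 2 * (transpose (J x) *v ?Y2 i j x) $ l" for l
    proof -
      have "(transpose (J x) *v ?Y2 i j x) $ l = ?Y2 i j x \<bullet> pd l Y x"
        by (simp add: matrix_vector_mult_def transpose_def J_def inner_vec_def mult.commute)
      then show ?thesis
        unfolding dg[OF x] using sym[OF x, of i j] sym[OF x, of i l] sym[OF x, of j l] by (simp add: inner_commute)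
    qed
    then have "christoffel g k i j x = (matrix_inv (g x) *v (transpose (J x) *v ?Y2 i j x)) $ k"
      unfolding christoffel_def by (simp add: matrix_vector_mult_def sum_distrib_left)
    also have "\<dots> = ((K x ** transpose (J x ** K x)) *v ?Y2 i j x) $ k"
      by (simp only: ginv[OF x] matrix_transpose_mul matrix_vector_mul_assoc matrix_mul_assoc)
    finally show ?thesis by (simp add: KJ'[OF x] transpose_mat)
  qed
  have dK: "pd i K x ** J x = - (K x ** pd i J x)" if x: "x \<in> V" for i x
  proof -
    note KJd = smooth_on_imp_differentiable[OF K V x] smooth_on_imp_differentiable[OF sJ V x]
    have "pd i (\<lambda>y. K y ** J y) x = K x ** pd i J x + pd i K x ** J x"
      unfolding pd_def[of i K] pd_def[of i J]
      by (rule pd_eqI) (intro bounded_bilinear.FDERIV[OF bounded_bilinear_matrix_mult] frechet_derivative_worksI KJd)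
    moreover have "pd i (\<lambda>y. K y ** J y) x = pd i (\<lambda>y. mat 1) x"
      by (rule pd_cong_open[OF V _ x]) (rule KJ')
    moreover have "pd i (\<lambda>y. mat 1 :: real^'n^'n) x = 0" by (rule pd_eqI) simp
    ultimately have "K x ** pd i J x + pd i K x ** J x = 0" by metis
    then show ?thesis by (simp only: add_eq_0_iff)
  qed
  have dJ: "pd i J x *v w = (\<Sum>m\<in>UNIV. w $ m *\<^sub>R ?Y2 i m x)" if x: "x \<in> V" for i x w
  proof -
    have "pd i J x $ k $ m = ?Y2 i m x $ k" for k m
    proof -
      have "pd i J x $ k $ m = pd i (\<lambda>y. J y $ k $ m) x"
        using smooth_on_imp_differentiable[OF sJ V x] smooth_on_imp_differentiable[OF smooth_on_nth[OF V sJ] V x]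
        by (simp add: pd_nth)
      also have "\<dots> = ?Y2 i m x $ k" by (simp add: J_def pd_nth dY[OF x])
      finally show ?thesis .
    qed
    then show ?thesis by (simp add: vec_eq_iff matrix_vector_mult_def mult.commute)
  qed
  \<comment> \<open>The subtracted sum is a quadratic term of the curvature. It cancels there, and
    only third derivatives of Y are left.\<close>
  have dchr: "pd i (christoffel g l j k) x = (K x *v pd i (?Y2 j k) x) $ l
      - (\<Sum>m\<in>UNIV. christoffel g l i m x * christoffel g m j k x)" if x: "x \<in> V" for i j k l x
  proof -
    let ?w = "K x *v ?Y2 j k x"
    have "pd i (christoffel g l j k) x = pd i (\<lambda>y. (K y *v ?Y2 j k y) $ l) x"
      by (rule pd_cong_open[OF V _ x]) (rule chr)
    also have "\<dots> = pd i (\<lambda>y. K y *v ?Y2 j k y) x $ l"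
      by (intro pd_nth smooth_on_imp_differentiable[OF _ V x] smooth_on_bounded_bilinear[OF V bounded_bilinear_matrix_vector_mult]
          K smooth_on_pd Y)
    also have "\<dots> = (K x *v pd i (?Y2 j k) x) $ l + (pd i K x *v ?Y2 j k x) $ l"
      by (simp add: pd_matrix_vector_mult dY[OF x] smooth_on_imp_differentiable[OF K V x])
    \<comment> \<open>J K = 1 is inserted so that the derivative of K appears next to J, where
      differentiating K J = 1 moves it onto J.\<close>
    also have "pd i K x *v ?Y2 j k x = (pd i K x ** J x) *v ?w"
      by (simp add: matrix_vector_mul_assoc matrix_mul_assoc[symmetric] KJ'[OF x])
    also have "\<dots> = - (K x *v (pd i J x *v ?w))"
      unfolding dK[OF x] matrix_vector_mult_minus_left by (simp only: matrix_vector_mul_assoc matrix_mul_assoc)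
    also have "pd i J x *v ?w = (\<Sum>m\<in>UNIV. ?w $ m *\<^sub>R ?Y2 i m x)" by (rule dJ[OF x])
    also have "K x *v \<dots> = (\<Sum>m\<in>UNIV. ?w $ m *\<^sub>R (K x *v ?Y2 i m x))"
      by (simp add: linear_sum[OF matrix_vector_mul_linear] linear_scale[OF matrix_vector_mul_linear] o_def)
    finally show ?thesis
      by (simp add: chr[OF x] mult.commute)
  qed
  have "curvature g l k i j x = 0" if x: "x \<in> V" for l k i j x
  proof -
    have "pd i (?Y2 j k) x = pd j (?Y2 i k) x"
      by (rule pd_commute[OF V smooth_on_pd[OF Y] x])
    then show ?thesis
      unfolding curvature_def dchr[OF x] by (simp add: sum_subtractf)
  qed
  then show ?thesis by (simp add: flat_metric_on_def)
qed

section \<open>The metric of an orthogonal frame\<close>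

text \<open>This is the vector G(x, 0)^-1 c, since the inverse is a transpose for orthogonal G.
  Taking real parts only changes the type: on W the entries are already real.\<close>

definition frame_field ::
  "(real^'n::finite \<Rightarrow> complex \<Rightarrow> complex^'n^'n) \<Rightarrow> real^'n \<Rightarrow> real^'n \<Rightarrow> real^'n" where
  "frame_field G c x = (\<chi> i. Re ((transpose (G x 0) *v cvec c) $ i))"

lemma bounded_linear_Re_vec: "bounded_linear (\<lambda>u :: complex^'n::finite. \<chi> i. Re (u $ i))"
  unfolding linear_conv_bounded_linear[symmetric]
  by (rule linearI) (auto simp: vec_eq_iff)

lemma mult_dg_axis_nth: "(A *v (dg (axis i 1) *v cvec u)) $ k = A $ k $ i * complex_of_real (u $ i)"
proof -
  have "dg (axis i 1) *v cvec u = axis i (complex_of_real (u $ i))"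
    by (auto simp: vec_eq_iff matrix_vector_mult_def dg_def cvec_def axis_def if_distrib[of "\<lambda>x. x * _"] cong: if_cong)
  then show ?thesis by (simp add: matrix_vector_mult_def axis_def if_distrib[of "\<lambda>x. _ * x"] cong: if_cong)
qed

lemma mscale_vector_mult: "mscale a A *v u = a *s (A *v u)"
  by (simp add: vec_eq_iff matrix_vector_mult_def sum_distrib_left mult.assoc)

lemma bounded_linear_vector_scalar_mult: "bounded_linear (\<lambda>u :: complex^'n::finite. a *s u)"
  unfolding linear_conv_bounded_linear[symmetric]
  by (rule linearI) (auto simp: vec_eq_iff distrib_left)

context
  fixes W :: "(real^'n::finite) set" and B G and c :: "real^'n"
  assumes W: "open W" and B: "smooth_on B W" and G: "frame_family W B G"
    and orthogonal: "\<forall>x\<in>W. \<forall>\<mu>. G x \<mu> ** transpose (G x (- \<mu>)) = mat 1"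
    and real_frame: "\<forall>x\<in>W. \<forall>\<mu>. cnj_mat (G x \<mu>) = G x (cnj \<mu>)"
    and real_potential: "\<forall>x\<in>W. cnj_mat (B x) = B x"
begin

lemma frame_orthogonal: "x \<in> W \<Longrightarrow> G x \<mu> ** transpose (G x (- \<mu>)) = mat 1"
  and frame_real: "x \<in> W \<Longrightarrow> cnj_mat (G x \<mu>) = G x (cnj \<mu>)"
  and potential_real: "x \<in> W \<Longrightarrow> cnj_mat (B x) = B x"
  using orthogonal real_frame real_potential by blast+

lemma frame_orthogonal_left: "x \<in> W \<Longrightarrow> transpose (G x (- \<mu>)) ** G x \<mu> = mat 1"
  using frame_orthogonal matrix_left_right_inverse by blast

lemma cvec_frame_field:
  assumes "x \<in> W"
  shows "cvec (frame_field G c x) = transpose (G x 0) *v cvec c"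
proof -
  have "cnj_mat (G x 0) = G x 0" using frame_real[OF assms, of 0] by simp
  then have "cnj (G x 0 $ k $ i) = G x 0 $ k $ i" for k i by (metis cnj_mat_def vec_lambda_beta)
  then have "cnj ((transpose (G x 0) *v cvec c) $ i) = (transpose (G x 0) *v cvec c) $ i" for i
    by (simp add: matrix_vector_mult_def transpose_def cvec_def cnj_sum)
  then have "complex_of_real (Re ((transpose (G x 0) *v cvec c) $ i)) = (transpose (G x 0) *v cvec c) $ i" for i
    by (metis Reals_cnj_iff of_real_Re)
  then show ?thesis by (simp add: vec_eq_iff cvec_def frame_field_def)
qed

text \<open>Differentiating G(x, 0) G(x, 0)^T = 1 shows that the connection form at parameter 0 is
  skew. In direction k its entry at (k, l) is B_kl and its entry at (l, k) is - B_lk.\<close>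

lemma potential_symmetric:
  assumes x: "x \<in> W" and kl: "k \<noteq> l"
  shows "B x $ k $ l = B x $ l $ k"
proof -
  note bb = bounded_bilinear_matrix_mult
  have inv: "transpose (G x 0) ** G x 0 = mat 1" using frame_orthogonal_left[OF x, of 0] by simp
  have "((\<lambda>y. G y 0 ** transpose (G y 0)) has_derivative
      (\<lambda>v. G x 0 ** transpose (G x 0 ** cform (B x) 0 v) + G x 0 ** cform (B x) 0 v ** transpose (G x 0))) (at x)"
    by (intro bounded_bilinear.FDERIV[OF bb] bounded_linear.has_derivative[OF bounded_linear_transpose] frame_familyD[OF G] x)
  moreover have "((\<lambda>y. G y 0 ** transpose (G y 0)) has_derivative (\<lambda>v. 0)) (at x)"
    using has_derivative_transform_within_open[OF has_derivative_const W x, of "mat 1" "\<lambda>y. G y 0 ** transpose (G y 0)"]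
      frame_orthogonal[of _ 0] by simp
  ultimately have "(\<lambda>v. G x 0 ** transpose (G x 0 ** cform (B x) 0 v) + G x 0 ** cform (B x) 0 v ** transpose (G x 0)) = (\<lambda>v. 0)"
    by (rule has_derivative_unique)
  from fun_cong[OF this, of "axis k 1"]
  have "transpose (G x 0) ** (G x 0 ** transpose (G x 0 ** cform (B x) 0 (axis k 1))
      + G x 0 ** cform (B x) 0 (axis k 1) ** transpose (G x 0)) ** G x 0 = 0"
    by simp
  then have "transpose (cform (B x) 0 (axis k 1)) + cform (B x) 0 (axis k 1) = 0"
    by (simp add: matrix_distribs matrix_transpose_mul inv mult_assoc_eq[OF inv])
  from arg_cong[OF this, of "\<lambda>A. A $ k $ l"] show ?thesis
    using kl by (simp add: transpose_def cform_nth axis_def)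
qed

lemma transpose_cform_frame: "x \<in> W \<Longrightarrow> transpose (cform (B x) \<mu> v) = - cform (B x) (- \<mu>) v"
  by (rule transpose_cform[OF potential_symmetric])

lemma has_derivative_cvec_frame_field:
  assumes x: "x \<in> W"
  shows "((\<lambda>y. cvec (frame_field G c y)) has_derivative (\<lambda>v. - (cform (B x) 0 v *v cvec (frame_field G c x)))) (at x)"
proof -
  have "((\<lambda>y. transpose (G y 0) *v cvec c) has_derivative (\<lambda>v. transpose (G x 0 ** cform (B x) 0 v) *v cvec c)) (at x)"
    by (intro bounded_linear.has_derivative[OF bounded_bilinear.bounded_linear_left[OF bounded_bilinear_matrix_vector_mult]]
        bounded_linear.has_derivative[OF bounded_linear_transpose] frame_familyD[OF G] x)
  moreover have "transpose (G x 0 ** cform (B x) 0 v) *v cvec c = - (cform (B x) 0 v *v cvec (frame_field G c x))" for v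
    unfolding cvec_frame_field[OF x] matrix_transpose_mul transpose_cform_frame[OF x] minus_zero
      matrix_vector_mul_assoc[symmetric] matrix_vector_mult_minus_left ..
  ultimately have "((\<lambda>y. transpose (G y 0) *v cvec c) has_derivative (\<lambda>v. - (cform (B x) 0 v *v cvec (frame_field G c x)))) (at x)"
    by simp
  then show ?thesis
    by (rule has_derivative_transform_within_open[OF _ W x]) (simp add: cvec_frame_field)
qed

lemma smooth_on_cvec_frame_field: "smooth_on (\<lambda>x. cvec (frame_field G c x)) W"
proof (rule smooth_on_bootstrap[OF W has_derivative_cvec_frame_field])
  fix k i assume "Ck_on k (\<lambda>x. cvec (frame_field G c x)) W"
  then show "Ck_on k (\<lambda>x. - (cform (B x) 0 (axis i 1) *v cvec (frame_field G c x))) W"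
    using B unfolding smooth_on_def
    by (intro Ck_on_bounded_linear[OF W bounded_linear_minus[OF bounded_linear_ident]]
        Ck_on_bounded_bilinear[OF W bounded_bilinear_matrix_vector_mult] Ck_on_cform W) auto
qed

lemma frame_field_eq_Re: "frame_field G c x = (\<chi> i. Re (cvec (frame_field G c x) $ i))"
  by (simp add: cvec_def vec_eq_iff)

lemma smooth_on_frame_field: "smooth_on (frame_field G c) W"
  using smooth_on_bounded_linear[OF W bounded_linear_Re_vec smooth_on_cvec_frame_field]
  by (simp add: frame_field_eq_Re[symmetric])

lemma pd_frame_field:
  assumes x: "x \<in> W"
  shows "pd j (\<lambda>y. frame_field G c y $ i) x
    = - (\<Sum>l\<in>UNIV. (axis j 1 $ i - axis j 1 $ l) * Re (B x $ i $ l) * frame_field G c x $ l)"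
proof -
  have "((\<lambda>y. Re (cvec (frame_field G c y) $ i)) has_derivative
      (\<lambda>v. Re ((- (cform (B x) 0 v *v cvec (frame_field G c x))) $ i))) (at x)"
    by (intro bounded_linear.has_derivative[OF bounded_linear_Re] bounded_linear.has_derivative[OF bounded_linear_vec_nth]
        has_derivative_cvec_frame_field x)
  from pd_eqI[OF this, of j] show ?thesis
    by (simp add: cvec_def matrix_vector_mult_def cform_nth Re_sum of_real_diff[symmetric] del: of_real_diff cong: if_cong)
qed

text \<open>The sum is the derivative in direction v = (1, ..., 1), for which \<delta>(v) is the
  identity and commutes with B.\<close>

lemma sum_pd_frame_field:
  assumes x: "x \<in> W"
  shows "(\<Sum>j\<in>UNIV. pd j (\<lambda>y. frame_field G c y $ i) x) = 0"
proof -
  have "(\<Sum>j\<in>UNIV. (axis j 1 :: real^'n) $ k) = 1" for k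
    by (simp add: axis_def)
  then have "(\<Sum>j\<in>UNIV. (axis j 1 :: real^'n) $ i - axis j 1 $ l) = 0" for l
    by (simp add: sum_subtractf)
  then have "(\<Sum>l\<in>UNIV. (\<Sum>j\<in>UNIV. (axis j 1 :: real^'n) $ i - axis j 1 $ l) * Re (B x $ i $ l) * frame_field G c x $ l) = 0"
    by simp
  then have "(\<Sum>l\<in>UNIV. \<Sum>j\<in>UNIV. ((axis j 1 :: real^'n) $ i - axis j 1 $ l) * Re (B x $ i $ l) * frame_field G c x $ l) = 0"
    by (simp add: sum_distrib_right)
  then show ?thesis
    unfolding pd_frame_field[OF x] sum_negf by (subst sum.swap) simp
qed

lemma smooth_on_frame: "smooth_on (\<lambda>x. G x \<mu>) W"
proof (rule smooth_on_bootstrap[OF W frame_familyD[OF G]])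
  fix k i assume "Ck_on k (\<lambda>x. G x \<mu>) W"
  then show "Ck_on k (\<lambda>x. G x \<mu> ** cform (B x) \<mu> (axis i 1)) W"
    using B unfolding smooth_on_def
    by (intro Ck_on_bounded_bilinear[OF W bounded_bilinear_matrix_mult] Ck_on_cform W) auto
qed

lemma smooth_on_frame_mult:
  "smooth_on (\<lambda>x. G x \<mu> *v (A *v cvec (frame_field G c x))) W"
  by (intro smooth_on_bounded_bilinear[OF W bounded_bilinear_matrix_vector_mult] smooth_on_frame
      smooth_on_const smooth_on_cvec_frame_field)

lemma smooth_on_frame_primitive:
  fixes Y :: "real^'n \<Rightarrow> complex^'n"
  assumes "\<And>x. x \<in> W \<Longrightarrow> (Y has_derivative (\<lambda>v. G x \<mu> *v (dg v *v cvec (frame_field G c x)))) (at x)"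
  shows "smooth_on Y W"
  by (rule smooth_on_bootstrap[OF W assms]) (use smooth_on_frame_mult in \<open>auto simp: smooth_on_def\<close>)

text \<open>The derivative of the frame in the spectral parameter at \<open>0\<close>, applied to the frame field, is a
  system of flat coordinates; its component along \<open>c\<close> is the Egoroff potential.\<close>

lemma has_derivative_flat_coordinates:
  assumes x: "x \<in> W"
  shows "((\<lambda>y. mat_deriv (G y) 0 *v cvec (frame_field G c y)) has_derivative
    (\<lambda>v. G x 0 *v (dg v *v cvec (frame_field G c x)))) (at x)"
proof -
  let ?H = "cvec (frame_field G c x)"
  have "((\<lambda>y. mat_deriv (G y) 0 *v cvec (frame_field G c y)) has_derivative
    (\<lambda>v. mat_deriv (G x) 0 *v (- (cform (B x) 0 v *v ?H))
       + (mat_deriv (G x) 0 ** cform (B x) 0 v + G x 0 ** dg v) *v ?H)) (at x)"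
    by (intro bounded_bilinear.FDERIV[OF bounded_bilinear_matrix_vector_mult] has_derivative_cvec_frame_field x
        has_derivative_frame_mat_deriv[OF W x smooth_on_imp_continuous_on[OF B] G])
  moreover have "mat_deriv (G x) 0 *v (- (cform (B x) 0 v *v ?H))
       + (mat_deriv (G x) 0 ** cform (B x) 0 v + G x 0 ** dg v) *v ?H = G x 0 *v (dg v *v ?H)" for v
    by (simp add: matrix_vector_mult_add_rdistrib matrix_vector_mul_assoc
        bounded_bilinear.minus_right[OF bounded_bilinear_matrix_vector_mult])
  ultimately show ?thesis by simp
qed

text \<open>The frame contributes the connection form at \<mu>, the frame field that at 0 with
  opposite sign; the difference is \<mu> \<delta>(v), and the prefactor removes \<mu>.\<close>

lemma has_derivative_lagrangian:
  assumes x: "x \<in> W" and \<mu>: "\<mu> \<noteq> 0"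
  shows "((\<lambda>y. (1 / \<mu>) *s (G y \<mu> *v cvec (frame_field G c y) - u)) has_derivative
    (\<lambda>v. G x \<mu> *v (dg v *v cvec (frame_field G c x)))) (at x)"
proof -
  let ?H = "cvec (frame_field G c x)"
  have "((\<lambda>y. (1 / \<mu>) *s (G y \<mu> *v cvec (frame_field G c y) - u)) has_derivative
    (\<lambda>v. (1 / \<mu>) *s (G x \<mu> *v (- (cform (B x) 0 v *v ?H)) + (G x \<mu> ** cform (B x) \<mu> v) *v ?H - 0))) (at x)"
    by (intro bounded_linear.has_derivative[OF bounded_linear_vector_scalar_mult] has_derivative_diff has_derivative_const
        bounded_bilinear.FDERIV[OF bounded_bilinear_matrix_vector_mult] has_derivative_cvec_frame_field frame_familyD[OF G] x)
  moreover have "(1 / \<mu>) *s (G x \<mu> *v (- (cform (B x) 0 v *v ?H)) + (G x \<mu> ** cform (B x) \<mu> v) *v ?H - 0)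
      = G x \<mu> *v (dg v *v ?H)" for v
  proof -
    have "cform (B x) \<mu> v = cform (B x) 0 v + mscale \<mu> (dg v)" by (simp add: cform_def)
    then have eq: "G x \<mu> *v (- (cform (B x) 0 v *v ?H)) + (G x \<mu> ** cform (B x) \<mu> v) *v ?H
        = mscale \<mu> (G x \<mu> ** dg v) *v ?H"
      by (simp add: matrix_distribs matrix_vector_mult_add_rdistrib matrix_vector_mul_assoc
        bounded_bilinear.minus_right[OF bounded_bilinear_matrix_vector_mult])
    show ?thesis
      unfolding diff_zero eq mscale_vector_mult using \<mu> by (simp add: matrix_vector_mul_assoc vec_eq_iff)
  qed
  ultimately show ?thesis by simp
qed

text \<open>For imaginary \<mu> conjugation sends G(x, \<mu>) to G(x, - \<mu>), so orthogonality
  becomes unitarity. The case \<mu> = 0 gives a real orthogonal matrix.\<close>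

lemma frame_unitary:
  assumes x: "x \<in> W" and \<mu>: "cnj \<mu> = - \<mu>"
  shows "(\<Sum>k\<in>UNIV. cnj (G x \<mu> $ k $ i) * G x \<mu> $ k $ j) = (if i = j then 1 else 0)"
proof -
  have "cnj (G x \<mu> $ k $ i) = G x (- \<mu>) $ k $ i" for k
    using frame_real[OF x, of \<mu>] \<mu> by (metis cnj_mat_def vec_lambda_beta)
  then have "(\<Sum>k\<in>UNIV. cnj (G x \<mu> $ k $ i) * G x \<mu> $ k $ j) = (transpose (G x (- \<mu>)) ** G x \<mu>) $ i $ j"
    by (simp add: matrix_matrix_mult_def transpose_def)
  then show ?thesis by (simp add: frame_orthogonal_left[OF x] mat_def)
qed

lemma open_frame_domain: "open {x \<in> W. \<forall>i. frame_field G c x $ i \<noteq> 0}"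
proof -
  have "open (W \<inter> (\<lambda>x. frame_field G c x $ i) -` (- {0}))" for i
    by (intro continuous_open_preimage smooth_on_imp_continuous_on smooth_on_nth smooth_on_frame_field W) auto
  then have "open (\<Inter>i. W \<inter> (\<lambda>x. frame_field G c x $ i) -` (- {0}))"
    by (intro open_INT) auto
  moreover have "(\<Inter>i. W \<inter> (\<lambda>x. frame_field G c x $ i) -` (- {0})) = {x \<in> W. \<forall>i. frame_field G c x $ i \<noteq> 0}"
    by auto
  ultimately show ?thesis by simp
qed

lemma frame_field_egoroff:
  "egoroff_metric {x \<in> W. \<forall>i. frame_field G c x $ i \<noteq> 0} (frame_field G c)" (is "egoroff_metric ?V _")
proof -
  let ?h = "frame_field G c"
  define T where "T u = Re (\<Sum>k\<in>UNIV. complex_of_real (c $ k) * u $ k)" for u :: "complex^'n"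
  define \<phi> where "\<phi> x = T (mat_deriv (G x) 0 *v cvec (?h x))" for x
  have T: "bounded_linear T"
    unfolding linear_conv_bounded_linear[symmetric] T_def
    by (rule linearI) (auto simp: algebra_simps sum.distrib sum_distrib_left)
  have d\<phi>: "(\<phi> has_derivative (\<lambda>v. T (G x 0 *v (dg v *v cvec (?h x))))) (at x)" if "x \<in> W" for x
    unfolding \<phi>_def by (intro bounded_linear.has_derivative[OF T] has_derivative_flat_coordinates that)
  have "smooth_on (\<lambda>x. T (G x 0 *v (dg (axis i 1) *v cvec (?h x)))) W" for i
    by (intro smooth_on_bounded_linear[OF W T] smooth_on_frame_mult)
  then have s\<phi>: "smooth_on \<phi> W"
    by (intro smooth_on_bootstrap[OF W d\<phi>]) (auto simp: smooth_on_def)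
  have "(?h x $ i)\<^sup>2 = pd i \<phi> x" if x: "x \<in> W" for x i
  proof -
    \<comment> \<open>Pairing the i-th column of G(x, 0) with c reproduces h_i, so the partial
      derivative is h_i times h_i.\<close>
    have "pd i \<phi> x = Re ((\<Sum>k\<in>UNIV. G x 0 $ k $ i * complex_of_real (c $ k)) * complex_of_real (?h x $ i))"
      by (simp add: pd_eqI[OF d\<phi>[OF x]] T_def mult_dg_axis_nth sum_distrib_left sum_distrib_right mult_ac)
    also have "(\<Sum>k\<in>UNIV. G x 0 $ k $ i * complex_of_real (c $ k)) = (transpose (G x 0) *v cvec c) $ i"
      by (simp add: matrix_vector_mult_def transpose_def cvec_def)
    also have "\<dots> = complex_of_real (?h x $ i)"
      unfolding cvec_frame_field[OF x, symmetric] by (simp add: cvec_def)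
    finally show ?thesis by (simp add: power2_eq_square)
  qed
  then show ?thesis
    unfolding egoroff_metric_def
    using open_frame_domain smooth_on_subset[OF smooth_on_frame_field] smooth_on_subset[OF s\<phi>]
    by (auto intro!: exI[of _ \<phi>])
qed

text \<open>The Jacobian of the flat coordinates is G(x, 0) times the diagonal matrix of h; K is its
  explicit inverse. The metric g is left general so that induced metrics of the immersions are
  covered as well.\<close>

lemma flat_metric_on_frame_field:
  assumes V: "open V" "V \<subseteq> W" "\<And>x i. x \<in> V \<Longrightarrow> frame_field G c x $ i \<noteq> 0"
    and g: "\<And>x. x \<in> V \<Longrightarrow> g x = diag_metric (frame_field G c) x"
  shows "flat_metric_on g V"
proof -
  let ?h = "frame_field G c"
  define Y where "Y x = (\<chi> i. Re ((mat_deriv (G x) 0 *v cvec (?h x)) $ i))" for x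
  define K :: "real^'n \<Rightarrow> real^'n^'n" where "K x = (\<chi> j k. inverse (?h x $ j) * Re (G x 0 $ k $ j))" for x
  have "smooth_on (\<lambda>x. mat_deriv (G x) 0 *v cvec (?h x)) W"
    by (rule smooth_on_frame_primitive[OF has_derivative_flat_coordinates])
  then have sY: "smooth_on Y V"
    unfolding Y_def by (intro smooth_on_subset[OF _ V(2)] smooth_on_bounded_linear[OF W bounded_linear_Re_vec])
  have sK: "smooth_on K V"
  proof (intro smooth_on_vec V)
    fix j k
    have "smooth_on (\<lambda>x. Re (G x 0 $ k $ j)) V"
      by (intro smooth_on_subset[OF _ V(2)] smooth_on_bounded_linear[OF W bounded_linear_Re] smooth_on_nth W smooth_on_frame)
    then show "smooth_on (\<lambda>x. K x $ j $ k) V"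
      unfolding K_def
      by (simp, intro smooth_on_bounded_bilinear[OF V(1) bounded_bilinear_mult] smooth_on_inverse V smooth_on_nth
          smooth_on_subset[OF smooth_on_frame_field V(2)])
  qed
  have pdY: "pd j Y x $ k = Re (G x 0 $ k $ j) * ?h x $ j" if "x \<in> V" for j k x
  proof -
    have "(Y has_derivative (\<lambda>v. \<chi> i. Re ((G x 0 *v (dg v *v cvec (?h x))) $ i))) (at x)"
      unfolding Y_def using that V
      by (intro bounded_linear.has_derivative[OF bounded_linear_Re_vec] has_derivative_flat_coordinates) auto
    from pd_eqI[OF this] show ?thesis by (simp add: mult_dg_axis_nth)
  qed
  have ro: "(\<Sum>k\<in>UNIV. Re (G x 0 $ k $ i) * Re (G x 0 $ k $ j)) = (if i = j then 1 else 0)" if "x \<in> V" for x i j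
  proof -
    have x: "x \<in> W" using that V by auto
    have "cnj_mat (G x 0) = G x 0" using frame_real[OF x, of 0] by simp
    then have "cnj (G x 0 $ k $ i) = G x 0 $ k $ i" for k i by (metis cnj_mat_def vec_lambda_beta)
    then have im: "Im (G x 0 $ k $ i) = 0" for k i by (metis Reals_cnj_iff complex_is_Real_iff)
    have "Re (\<Sum>k\<in>UNIV. cnj (G x 0 $ k $ i) * G x 0 $ k $ j) = (if i = j then 1 else 0)"
      using frame_unitary[OF x, of 0 i j] by simp
    then show ?thesis by (simp add: im)
  qed
  show ?thesis
  proof (rule flat_metric_on_pullback[OF V(1) sY sK])
    fix x assume x: "x \<in> V"
    have "pd i Y x \<bullet> pd j Y x = (\<Sum>k\<in>UNIV. Re (G x 0 $ k $ i) * Re (G x 0 $ k $ j)) * (?h x $ i * ?h x $ j)" for i j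
      by (simp add: inner_vec_def pdY[OF x] sum_distrib_left sum_distrib_right mult_ac)
    then show "g x $ i $ j = pd i Y x \<bullet> pd j Y x" for i j
      by (simp add: ro[OF x] g[OF x] diag_metric_def power2_eq_square)
    have "(K x ** (\<chi> k j. pd j Y x $ k)) $ i $ j
        = (\<Sum>k\<in>UNIV. Re (G x 0 $ k $ i) * Re (G x 0 $ k $ j)) * (inverse (?h x $ i) * ?h x $ j)" for i j
      by (simp add: matrix_matrix_mult_def K_def pdY[OF x] sum_distrib_left sum_distrib_right mult_ac)
    then show "K x ** (\<chi> k j. pd j Y x $ k) = mat 1"
      using V(3)[OF x] by (simp add: vec_eq_iff ro[OF x] mat_def)
  qed
qed

lemma frame_field_invariant_flat:
  "invariant_flat_egoroff_metric {x \<in> W. \<forall>i. frame_field G c x $ i \<noteq> 0} (frame_field G c)"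
  unfolding invariant_flat_egoroff_metric_def
  by (intro conjI frame_field_egoroff flat_metric_on_frame_field open_frame_domain) (auto intro: sum_pd_frame_field)

text \<open>Off the diagonal the equation of the frame field reads: the l-th derivative of h_k is
  B_kl h_l, so rotation coefficients and B agree there. Their diagonals may differ, but do not enter
  the connection form.\<close>

lemma is_frame_frame_field:
  assumes "\<And>\<mu>. G 0 \<mu> = mat 1"
  shows "is_frame {x \<in> W. \<forall>i. frame_field G c x $ i \<noteq> 0} (rotation_coeff (frame_field G c)) G"
proof -
  have "connection_form (rotation_coeff (frame_field G c) x) \<mu> v = cform (B x) \<mu> v"
    if x: "x \<in> W" "\<And>i. frame_field G c x $ i \<noteq> 0" for x \<mu> v
  proof -
    have "cmat (rotation_coeff (frame_field G c) x) $ k $ l = B x $ k $ l" if "k \<noteq> l" for k l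
    proof -
      have "pd l (\<lambda>y. frame_field G c y $ k) x = (\<Sum>m\<in>UNIV. if m = l then Re (B x $ k $ m) * frame_field G c x $ m else 0)"
        unfolding pd_frame_field[OF x(1)] sum_negf[symmetric]
        using that by (intro sum.cong) (auto simp: axis_def)
      then have "rotation_coeff (frame_field G c) x $ k $ l = Re (B x $ k $ l)"
        using that x(2) by (simp add: rotation_coeff_def)
      moreover have "cnj (B x $ k $ l) = B x $ k $ l"
        using potential_real[OF x(1)] by (metis cnj_mat_def vec_lambda_beta)
      then have "complex_of_real (Re (B x $ k $ l)) = B x $ k $ l"
        by (metis Reals_cnj_iff of_real_Re)
      ultimately show ?thesis by (simp add: cmat_def)
    qed
    then have "cform (cmat (rotation_coeff (frame_field G c) x)) \<mu> v $ k $ l = cform (B x) \<mu> v $ k $ l" for k l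
      by (cases "k = l") (simp_all add: cform_nth)
    then show ?thesis unfolding connection_form_eq by (simp add: vec_eq_iff)
  qed
  moreover have "matrix_inv (G x \<mu>) ** (G x \<mu> ** A) = A" "invertible (G x \<mu>)" if "x \<in> W" for x \<mu> A
    using matrix_inv_left[OF invertibleI[OF frame_orthogonal[OF that]]] invertibleI[OF frame_orthogonal[OF that]]
    by (simp_all add: matrix_mul_assoc)
  ultimately show ?thesis
    unfolding is_frame_def using assms frame_familyD[OF G] by fastforce
qed

text \<open>The Hermitian products of the partial derivatives form a real diagonal matrix with
  entries h_i^2: vanishing imaginary parts make X Lagrangian, and the real parts are the metric
  already known to be flat.\<close>

lemma frame_field_lagrangian:
  fixes \<mu> :: complex and u :: "complex^'n"
  assumes \<mu>: "cnj \<mu> = - \<mu>" "\<mu> \<noteq> 0"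
    and X: "\<And>x. x \<in> W \<Longrightarrow> X x = (1 / \<mu>) *s (G x \<mu> *v cvec (frame_field G c x) - u)"
  shows "flat_lagrangian_immersion {x \<in> W. \<forall>i. frame_field G c x $ i \<noteq> 0} X" (is "flat_lagrangian_immersion ?V X")
proof -
  let ?h = "frame_field G c"
  have dX: "(X has_derivative (\<lambda>v. G x \<mu> *v (dg v *v cvec (?h x)))) (at x)" if "x \<in> W" for x
    by (rule has_derivative_transform_within_open[OF has_derivative_lagrangian[OF that \<mu>(2), of u] W that]) (simp add: X)
  have pdX: "pd i X x $ k = G x \<mu> $ k $ i * complex_of_real (?h x $ i)" if "x \<in> W" for i x k
    by (simp add: pd_eqI[OF dX[OF that]] mult_dg_axis_nth)
  have herm: "(\<Sum>k\<in>UNIV. cnj (pd i X x $ k) * pd j X x $ k) = (if i = j then complex_of_real ((?h x $ i)\<^sup>2) else 0)"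
    if x: "x \<in> W" for i j x
  proof -
    have "(\<Sum>k\<in>UNIV. cnj (pd i X x $ k) * pd j X x $ k)
        = (\<Sum>k\<in>UNIV. cnj (G x \<mu> $ k $ i) * G x \<mu> $ k $ j) * complex_of_real (?h x $ i * ?h x $ j)"
      by (simp add: pdX[OF x] sum_distrib_left sum_distrib_right mult_ac)
    then show ?thesis by (simp add: frame_unitary[OF x \<mu>(1)] power2_eq_square)
  qed
  have smooth: "smooth_on X ?V"
    by (rule smooth_on_subset[OF smooth_on_frame_primitive[OF dX]]) auto
  have inj: "inj (frechet_derivative X (at x))" if x: "x \<in> ?V" for x
  proof (rule injI)
    fix v w assume eq: "frechet_derivative X (at x) v = frechet_derivative X (at x) w"
    have xW: "x \<in> W" using x by simp
    have "G x \<mu> *v (dg v *v cvec (?h x)) = G x \<mu> *v (dg w *v cvec (?h x))"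
      using eq frechet_derivative_at[OF dX[OF xW]] by metis
    then have "transpose (G x (- \<mu>)) *v (G x \<mu> *v (dg v *v cvec (?h x))) = transpose (G x (- \<mu>)) *v (G x \<mu> *v (dg w *v cvec (?h x)))"
      by simp
    then have "dg v *v cvec (?h x) = dg w *v cvec (?h x)"
      by (simp add: matrix_vector_mul_assoc frame_orthogonal_left[OF xW] matrix_mul_assoc)
    moreover have "(dg v *v cvec (?h x)) $ i = complex_of_real (v $ i * ?h x $ i)" for v i
      by (simp add: matrix_vector_mult_def dg_def cvec_def if_distrib[of "\<lambda>x. x * _"] cong: if_cong)
    ultimately have "complex_of_real (v $ i * ?h x $ i) = complex_of_real (w $ i * ?h x $ i)" for i by metis
    then have "v $ i = w $ i" for i using x by (simp del: of_real_mult)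
    then show "v = w" by (simp add: vec_eq_iff)
  qed
  have sympl: "std_symplectic (pd i X x) (pd j X x) = 0" if "x \<in> ?V" for x i j
    using herm[of x i j] that by (simp add: std_symplectic_def)
  have "flat_metric_on (induced_metric X) ?V"
  proof (rule flat_metric_on_frame_field[OF open_frame_domain])
    fix x assume "x \<in> ?V"
    then have x: "x \<in> W" by simp
    have "pd i X x \<bullet> pd j X x = Re (\<Sum>k\<in>UNIV. cnj (pd i X x $ k) * pd j X x $ k)" for i j
      by (simp add: inner_vec_def inner_complex_def Re_sum)
    then show "induced_metric X x = diag_metric ?h x"
      by (simp add: herm[OF x] induced_metric_def diag_metric_def vec_eq_iff)
  qed auto
  with smooth inj sympl show ?thesis
    unfolding flat_lagrangian_immersion_def by blast
qed

end

theorem proposition7p4: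
  fixes U W :: "(real^'n::finite) set"
    and h :: "real^'n \<Rightarrow> real^'n"
    and E :: "real^'n \<Rightarrow> complex \<Rightarrow> complex^'n^'n"
    and \<alpha> :: real
    and N :: "complex^'n^'n"
    and c :: "real^'n"
  assumes "connected U" and "0 \<in> U"
    and "invariant_flat_egoroff_metric U h"
    and "is_frame U (rotation_coeff h) E"
    and "\<alpha> \<noteq> 0"
    and "N ** N = 0" and "cnj_mat N = N"
    and "open W" and "W \<subseteq> U" and "0 \<in> W"
    and "\<forall>x\<in>W. dressing_well_defined \<alpha> N E x"
  shows "\<exists>h' :: real^'n \<Rightarrow> real^'n.
    (\<forall>x\<in>W. cvec (h' x) = matrix_inv (dressed_frame \<alpha> N E x 0) *v cvec c) \<and>
    (let V = {x \<in> W. \<forall>i. h' x $ i \<noteq> 0};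
         X = (\<lambda>x \<mu>. (- \<i> / complex_of_real \<mu>) *s
               (dressed_frame \<alpha> N E x (\<i> * complex_of_real \<mu>)
                  *v (matrix_inv (dressed_frame \<alpha> N E x 0) *v cvec c) - cvec c))
     in invariant_flat_egoroff_metric V h' \<and>
        is_frame V (rotation_coeff h') (dressed_frame \<alpha> N E) \<and>
        (\<forall>\<mu>. \<mu> \<noteq> 0 \<longrightarrow>
           (\<forall>x\<in>V. associated_family (dressed_frame \<alpha> N E) h' x \<mu> = X x \<mu>) \<and>
           flat_lagrangian_immersion V (\<lambda>x. X x \<mu>)))"
proof -
  let ?G = "dressed_frame \<alpha> N E"
  let ?h = "frame_field ?G c"
  let ?B = "\<lambda>x. cmat (rotation_coeff h x)"
  have eg: "egoroff_metric U h" and U: "open U"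
    using assms(3) by (auto simp: invariant_flat_egoroff_metric_def egoroff_metric_def)
  note fr = egoroff_frame[OF assms(1,2) eg assms(4)]
  have B: "smooth_on ?B W"
    by (intro smooth_on_bounded_linear[OF assms(8) bounded_linear_cmat] smooth_on_subset[OF smooth_on_rotation_coeff[OF eg] assms(9)])
  have F: "frame_family W ?B E" using fr(1) assms(9) by (auto simp: frame_family_def)
  have fr2: "E x \<mu> ** transpose (E x (- \<mu>)) = mat 1" "cnj_mat (E x \<mu>) = E x (cnj \<mu>)" if "x \<in> W" for x \<mu>
    using fr(2,3) that assms(9) by auto
  have wd: "\<And>x. x \<in> W \<Longrightarrow> dressing_well_defined \<alpha> N E x" using assms(11) by simp
  note props = dressed_frame_properties[OF assms(8) B F fr2 cnj_mat_cmat assms(5-7) wd]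
  obtain B' where B': "smooth_on B' W" "frame_family W B' ?G" "\<forall>x\<in>W. cnj_mat (B' x) = B' x"
    using props(1) by blast
  have orth: "\<forall>x\<in>W. \<forall>\<mu>. ?G x \<mu> ** transpose (?G x (- \<mu>)) = mat 1"
    using props(2) by blast
  have real: "\<forall>x\<in>W. \<forall>\<mu>. cnj_mat (?G x \<mu>) = ?G x (cnj \<mu>)"
    using props(3) by blast
  note ctx = assms(8) B'(1,2) orth real B'(3)
  have G0: "?G 0 \<mu> = mat 1" for \<mu>
  proof -
    have "E 0 \<mu> = mat 1" for \<mu> using assms(4) unfolding is_frame_def by blast
    then show ?thesis using props(4) assms(10) by blast
  qed
  have inv: "cvec (?h x) = matrix_inv (?G x 0) *v cvec c" if "x \<in> W" for x
    using matrix_inv_eqI[of "?G x 0" "transpose (?G x 0)"] bspec[OF orth that, THEN spec, of 0] cvec_frame_field[OF ctx that] by simp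
  \<comment> \<open>Normalisation of the frame identifies the base point term of
    \<open>associated_family\<close> with c.\<close>
  have h0: "cvec (?h 0) = cvec c"
    using cvec_frame_field[OF ctx assms(10)] by (simp add: G0 transpose_mat)
  show ?thesis
    unfolding Let_def
  proof (intro exI[of _ ?h] conjI ballI allI impI)
    show "invariant_flat_egoroff_metric {x \<in> W. \<forall>i. ?h x $ i \<noteq> 0} ?h"
      by (rule frame_field_invariant_flat[OF ctx])
    show "is_frame {x \<in> W. \<forall>i. ?h x $ i \<noteq> 0} (rotation_coeff ?h) ?G"
      by (rule is_frame_frame_field[OF ctx G0])
    fix \<mu> :: real assume \<mu>: "\<mu> \<noteq> 0"
    show "associated_family ?G ?h x \<mu> = (- \<i> / complex_of_real \<mu>) *s
        (?G x (\<i> * complex_of_real \<mu>) *v (matrix_inv (?G x 0) *v cvec c) - cvec c)"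
      if "x \<in> {x \<in> W. \<forall>i. ?h x $ i \<noteq> 0}" for x
      using that by (simp add: associated_family_def h0 inv)
    show "flat_lagrangian_immersion {x \<in> W. \<forall>i. ?h x $ i \<noteq> 0}
      (\<lambda>x. (- \<i> / complex_of_real \<mu>) *s
        (?G x (\<i> * complex_of_real \<mu>) *v (matrix_inv (?G x 0) *v cvec c) - cvec c))"
    proof (rule frame_field_lagrangian[OF ctx, where \<mu> = "\<i> * complex_of_real \<mu>" and u = "cvec c"])
      \<comment> \<open>The prefactor is the reciprocal of the spectral parameter i\<mu>, which is
        purely imaginary, so the frame is unitary there.\<close>
      have "- \<i> / complex_of_real \<mu> = 1 / (\<i> * complex_of_real \<mu>)"
        using \<mu> by (simp add: field_simps)
      then show "(- \<i> / complex_of_real \<mu>) *s (?G x (\<i> * complex_of_real \<mu>) *v (matrix_inv (?G x 0) *v cvec c) - cvec c)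
        = (1 / (\<i> * complex_of_real \<mu>)) *s (?G x (\<i> * complex_of_real \<mu>) *v cvec (?h x) - cvec c)" if "x \<in> W" for x
        by (simp add: inv[OF that])
    qed (use \<mu> in auto)
  qed (rule inv)
qed

end
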